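(* Let $\lambda>0$. The bounded solution of the mixed Steklov problem $$\Delta u(x,y)=0\quad (x\in\mathbb{R},\ y>0),$$ $$\frac{\partial}{\partial y}u(x,0)=-\lambda u(x,0)\quad (x\in D),$$ $$u(x,0)=0\quad (x\notin D)$$ for $D=(0,\infty)$ is given by $$u(x,y)=e^{-\lambda y}\sin\left(\lambda x+\tfrac{\pi}{8}\right)-\frac{\sqrt2}{2\pi}\int_0^\infty\frac{t\cos(t\lambda y)-\sin(t\lambda y)}{1+t^2}\exp\left(-\frac1\pi\int_0^\infty\frac{\log(t+s)}{1+s^2}\,ds\right)e^{-t\lambda x}\,dt$$ for $x\ge 0$, $y\ge 0$, and $$u(x,y)=\frac{\sqrt2}{2\pi}\int_0^\infty\frac{\sin(t\lambda y)}{1+t^2}\exp\left(\frac1\pi\int_0^\infty\frac{\log(t+s)}{1+s^2}\,ds\right)e^{t\lambda x}\,dt$$ for $x\le 0$ and $y\ge 0$.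
   Context: $\Delta=\frac{\partial^2}{\partial x^2}+\frac{\partial^2}{\partial y^2}$ is the Laplace operator in $\mathbb{R}^2$, and $u$ is a real-valued function on the closed upper half-plane $\mathbb{R}\times[0,\infty)$. The derivative $\frac{\partial}{\partial y}u(x,0)$ is the one-sided derivative $\lim_{y\searrow0}\frac{u(x,y)-u(x,0)}{y}$. *)

theory Defs
  imports "HOL-Analysis.Analysis"
begin

definition dx :: "(real \<times> real \<Rightarrow> real) \<Rightarrow> real \<times> real \<Rightarrow> real" where
  "dx u = (\<lambda>(x, y). deriv (\<lambda>s. u (s, y)) x)"

definition dy :: "(real \<times> real \<Rightarrow> real) \<Rightarrow> real \<times> real \<Rightarrow> real" where
  "dy u = (\<lambda>(x, y). deriv (\<lambda>t. u (x, t)) y)"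

text \<open>Since \<^const>\<open>deriv\<close> is unspecified at points of non-differentiability, the existence of
  the partial derivatives has to be demanded separately. The sets are meant to be open.\<close>

definition C1_on :: "(real \<times> real) set \<Rightarrow> (real \<times> real \<Rightarrow> real) \<Rightarrow> bool" where
  "C1_on S u \<longleftrightarrow>
     (\<forall>(x, y) \<in> S. (\<lambda>s. u (s, y)) differentiable at x \<and> (\<lambda>t. u (x, t)) differentiable at y) \<and>
     continuous_on S (dx u) \<and> continuous_on S (dy u)"

definition C2_on :: "(real \<times> real) set \<Rightarrow> (real \<times> real \<Rightarrow> real) \<Rightarrow> bool" where
  "C2_on S u \<longleftrightarrow> C1_on S u \<and> C1_on S (dx u) \<and> C1_on S (dy u)"

definition laplacian :: "(real \<times> real \<Rightarrow> real) \<Rightarrow> real \<times> real \<Rightarrow> real" where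
  "laplacian u p = dx (dx u) p + dy (dy u) p"

abbreviation upper_half_plane :: "(real \<times> real) set" where
  "upper_half_plane \<equiv> UNIV \<times> {0<..}"

abbreviation closed_upper_half_plane :: "(real \<times> real) set" where
  "closed_upper_half_plane \<equiv> UNIV \<times> {0..}"

text \<open>Classical solutions: twice continuously differentiable in the open half-plane and continuous
  up to the boundary. Without the latter the values on the line \<open>y = 0\<close> outside \<open>D\<close> would be
  unrelated to those in the interior. The values of \<open>u\<close> below that line are irrelevant.\<close>

definition mixed_steklov_solution ::
    "real \<Rightarrow> real set \<Rightarrow> (real \<times> real \<Rightarrow> real) \<Rightarrow> bool" where
  "mixed_steklov_solution l D u \<longleftrightarrow>
     continuous_on closed_upper_half_plane u \<and>
     C2_on upper_half_plane u \<and>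
     (\<forall>x. \<forall>y>0. laplacian u (x, y) = 0) \<and>
     (\<forall>x\<in>D. ((\<lambda>y. (u (x, y) - u (x, 0)) / y) \<longlongrightarrow> - l * u (x, 0)) (at_right 0)) \<and>
     (\<forall>x. x \<notin> D \<longrightarrow> u (x, 0) = 0)"

definition bounded_mixed_steklov_solution ::
    "real \<Rightarrow> real set \<Rightarrow> (real \<times> real \<Rightarrow> real) \<Rightarrow> bool" where
  "bounded_mixed_steklov_solution l D u \<longleftrightarrow>
     mixed_steklov_solution l D u \<and> bounded (u ` closed_upper_half_plane)"

end

theory Submission
  imports Defs "HOL-Complex_Analysis.Complex_Analysis" "HOL-Real_Asymp.Real_Asymp"
begin

text \<open>Scaling reduces the problem to \<open>\<lambda> = 1\<close>. A harmonic function on the half-plane is \<open>Im f\<close> with \<open>f\<close>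
holomorphic, and in terms of \<open>f\<close> the boundary conditions read \<open>Re (f' - \<i> f) = 0\<close> on the positive
and \<open>Im f = 0\<close> on the negative half-axis. The formula and its uniqueness up to a factor both come from solving this
two-sided problem with the Wiener-Hopf factor \<open>b w = exp (- (1/\<pi>) \<integral> Log (w + s) / (1 + s\<^sup>2) ds)\<close>. It is
holomorphic off the negative half-axis, positive on the positive one, and satisfies
\<open>b w * b (- w) * (1 + \<i> w) = 1\<close> for \<open>Im w < 0\<close> (\<open>log_integral_reflection\<close>). So its continuation through
the lower half-plane to the negative half-axis, called \<open>wh_cont\<close>, is explicit there as well.

Existence. The two formulas are Laplace integrals of \<open>wh_cont w / (1 - \<i> w)\<close> along the positive and the
negative half-axis; each is holomorphic in a quadrant. On real arguments one integrand makes
\<open>f' - \<i> f\<close> imaginary and the other makes \<open>f\<close> real, which gives the boundary conditions. Turning the first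
ray into the second one through the lower half-plane crosses only the pole \<open>w = - \<i>\<close>, and because
\<open>b (- \<i>) = e\<^sup>i\<^sup>\<pi>\<^sup>/\<^sup>8 / \<surd>2\<close> its residue is precisely the summand \<open>exp (\<i> z + \<i> \<pi>/8)\<close>. Hence the two pieces
agree on the common boundary of the quadrants (\<open>kernel_residue_identity\<close>) and form one holomorphic
function.

Uniqueness. For a bounded solution, \<open>f'\<close> is \<open>O(1/y)\<close>, because \<open>Im f\<close> is bounded. Let \<open>F\<close> be a primitive
of \<open>f\<close>. Then \<open>Im (f - \<i> F)\<close> has vanishing normal derivative at every point of the positive half-axis. This
is only a pointwise one-sided statement, but comparison with harmonic polynomials that are even in
\<open>y\<close> (Weierstrass approximation and the maximum principle) turns it into estimates for \<open>f' - \<i> f\<close> up to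
the boundary (\<open>Neumann_gradient_estimate\<close>). Therefore the Laplace transform \<open>\<Phi>\<close> of \<open>f\<close>, taken along
rotating rays in the upper half-plane, is holomorphic near the closed lower half-plane without the
origin, is real on the negative half-axis, and has \<open>Re ((s - \<i>) \<Phi> s)\<close> equal to a constant \<open>\<kappa>\<close> on the
positive one. The function \<open>(1 + \<i> w) * wh_cont w * (w \<Phi> w - \<kappa>)\<close> is thus real on both half-axes. It extends
by reflection to the punctured plane, grows slower than \<open>|w|\<close> at infinity and blows up slower than
\<open>1/|w|\<close> at the origin, so it is a real constant (\<open>wiener_hopf_constant\<close>). Consequently
\<open>\<Phi>\<close> is determined up to one real factor and the real constant \<open>\<kappa>\<close>, which does not change \<open>Im f\<close>, and the
injectivity of the Laplace transform finishes the proof.\<close>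

section \<open>Integrals over the half-line\<close>

lemma set_integrable_halfline_bound:
  fixes f :: "real \<Rightarrow> 'a::{banach, second_countable_topology}" and m :: "real \<Rightarrow> real"
  assumes "continuous_on {0<..} f" "\<And>r. r > 0 \<Longrightarrow> norm (f r) \<le> m r" "set_integrable lborel {0<..} m"
  shows "set_integrable lborel {0<..} f"
proof (rule set_integrable_bound[OF assms(3)])
  show "set_borel_measurable lborel {0<..} f"
    using set_measurable_continuous_on[OF _ assms(1)] by (simp add: set_borel_measurable_def)
  show "AE x in lborel. x \<in> {0<..} \<longrightarrow> norm (f x) \<le> norm (m x)"
    using assms(2) by (force intro!: AE_I2)
qed

lemma halfline_integral_norm_bound:
  fixes f :: "real \<Rightarrow> 'a::{banach, second_countable_topology}" and m :: "real \<Rightarrow> real"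
  assumes "continuous_on {0<..} f" "\<And>r. r > 0 \<Longrightarrow> norm (f r) \<le> m r" "set_integrable lborel {0<..} m"
  shows "norm (LBINT r:{0<..}. f r) \<le> (LBINT r:{0<..}. m r)"
proof -
  have i: "set_integrable lborel {0<..} f" by (rule set_integrable_halfline_bound[OF assms])
  have "norm (LBINT r:{0<..}. f r) \<le> (LBINT r. norm (indicator {0<..} r *\<^sub>R f r))"
    unfolding set_lebesgue_integral_def by (rule integral_norm_bound)
  also have "\<dots> \<le> (LBINT r. indicator {0<..} r *\<^sub>R m r)"
  proof (rule integral_mono)
    show "integrable lborel (\<lambda>r. norm (indicat_real {0<..} r *\<^sub>R f r))"
      using i unfolding set_integrable_def by (rule integrable_norm)
    show "integrable lborel (\<lambda>r. indicat_real {0<..} r *\<^sub>R m r)"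
      using assms(3) by (simp add: set_integrable_def)
  qed (use assms(2) in \<open>auto simp: indicator_def\<close>)
  finally show ?thesis by (simp add: set_lebesgue_integral_def)
qed

lemma halfline_dominated_convergence:
  fixes f :: "nat \<Rightarrow> real \<Rightarrow> 'a::{banach, second_countable_topology}" and m :: "real \<Rightarrow> real"
  assumes "\<And>n. continuous_on {0<..} (f n)" "\<And>n r. r > 0 \<Longrightarrow> norm (f n r) \<le> m r"
    "set_integrable lborel {0<..} m" "\<And>r. r > 0 \<Longrightarrow> (\<lambda>n. f n r) \<longlonglongrightarrow> g r"
  shows "(\<lambda>n. LBINT r:{0<..}. f n r) \<longlonglongrightarrow> (LBINT r:{0<..}. g r)"
  unfolding set_lebesgue_integral_def
proof (rule integral_dominated_convergence)
  have b: "(\<lambda>r. indicat_real {0<..} r *\<^sub>R f n r) \<in> borel_measurable lborel" for n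
    using borel_measurable_continuous_on_indicator[OF _ assms(1)[of n]] by simp
  then show "\<And>i. (\<lambda>r. indicat_real {0<..} r *\<^sub>R f i r) \<in> borel_measurable lborel" .
  have lim: "(\<lambda>n. indicat_real {0<..} r *\<^sub>R f n r) \<longlonglongrightarrow> indicat_real {0<..} r *\<^sub>R g r" for r
    using assms(4)[of r] by (auto simp: indicator_def)
  show "(\<lambda>r. indicat_real {0<..} r *\<^sub>R g r) \<in> borel_measurable lborel"
    by (rule borel_measurable_LIMSEQ_metric[OF b lim])
  show "integrable lborel (\<lambda>r. indicat_real {0<..} r *\<^sub>R m r)"
    using assms(3) by (simp add: set_integrable_def)
  show "AE r in lborel. (\<lambda>n. indicat_real {0<..} r *\<^sub>R f n r) \<longlonglongrightarrow> indicat_real {0<..} r *\<^sub>R g r"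
    using lim by simp
  show "\<And>i. AE r in lborel. norm (indicat_real {0<..} r *\<^sub>R f i r) \<le> indicat_real {0<..} r *\<^sub>R m r"
    using assms(2) by (auto simp: indicator_def)
qed

lemma halfline_integral_continuous_on:
  fixes f :: "real \<Rightarrow> 'b::metric_space \<Rightarrow> 'a::{banach, second_countable_topology}"
  assumes "\<And>z. z \<in> S \<Longrightarrow> continuous_on {0<..} (\<lambda>r. f r z)"
    "\<And>r. r > 0 \<Longrightarrow> continuous_on S (f r)"
    "\<And>r z. r > 0 \<Longrightarrow> z \<in> S \<Longrightarrow> norm (f r z) \<le> m r" "set_integrable lborel {0<..} m"
  shows "continuous_on S (\<lambda>z. LBINT r:{0<..}. f r z)"
  unfolding continuous_on_sequentially comp_def
proof (intro ballI allI impI, elim conjE)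
  fix X :: "nat \<Rightarrow> 'b" and a assume *: "a \<in> S" "\<forall>n. X n \<in> S" "X \<longlonglongrightarrow> a"
  show "(\<lambda>n. LBINT r:{0<..}. f r (X n)) \<longlonglongrightarrow> (LBINT r:{0<..}. f r a)"
  proof (rule halfline_dominated_convergence[where m=m])
    fix r :: real assume "r > 0"
    show "(\<lambda>n. f r (X n)) \<longlonglongrightarrow> f r a"
      using assms(2)[OF \<open>r > 0\<close>] * unfolding continuous_on_sequentially comp_def by auto
  qed (use * assms in auto)
qed

text \<open>Differentiation under the integral sign. A bound on the functions alone suffices, since Cauchy's
  inequality turns it into a bound on the derivatives.\<close>

lemma halfline_integral_has_field_derivative:
  fixes k k' :: "real \<Rightarrow> complex \<Rightarrow> complex"
  assumes e: "e > 0" and cont: "\<And>z. z \<in> ball z0 e \<Longrightarrow> continuous_on {0<..} (\<lambda>r. k r z)"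
    and der: "\<And>r z. r > 0 \<Longrightarrow> z \<in> ball z0 e \<Longrightarrow> (k r has_field_derivative k' r z) (at z)"
    and bound: "\<And>r z. r > 0 \<Longrightarrow> z \<in> ball z0 e \<Longrightarrow> norm (k r z) \<le> m r"
    and m: "set_integrable lborel {0<..} m"
  shows "((\<lambda>z. LBINT r:{0<..}. k r z) has_field_derivative (LBINT r:{0<..}. k' r z0)) (at z0)"
proof -
  have z0: "z0 \<in> ball z0 e" using e by simp
  have hol: "k r holomorphic_on ball z0 e" if "r > 0" for r
    using der[OF that] by (meson field_differentiable_at_within field_differentiable_def holomorphic_onI)
  have k'_bound: "norm (k' r z) \<le> m r * (2/e)" if r: "r > 0" and z: "z \<in> ball z0 (e/2)" for r z
  proof -
    have bb: "norm (k' r z) \<le> m r / \<rho>" if \<rho>: "0 < \<rho>" "\<rho> < e/2" for \<rho>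
    proof -
      have sub: "cball z \<rho> \<subseteq> ball z0 e"
      proof
        fix x assume "x \<in> cball z \<rho>"
        then show "x \<in> ball z0 e" using \<rho> z dist_triangle[of z0 x z] by auto
      qed
      have "norm ((deriv ^^ 1) (k r) z) \<le> fact 1 * m r / \<rho> ^ 1"
      proof (rule Cauchy_inequality)
        have h: "k r holomorphic_on cball z \<rho>" using hol[OF r] sub by (rule holomorphic_on_subset)
        show "k r holomorphic_on ball z \<rho>" using h by (rule holomorphic_on_subset) auto
        show "continuous_on (cball z \<rho>) (k r)" using h by (rule holomorphic_on_imp_continuous_on)
        show "norm (k r x) \<le> m r" if "norm (z - x) = \<rho>" for x
          using bound[OF r, of x] sub that by (auto simp: dist_norm)
      qed (use \<rho> in auto)
      moreover have "deriv (k r) z = k' r z"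
        using der[OF r, of z] z e by (intro DERIV_imp_deriv) auto
      ultimately show ?thesis by simp
    qed
    have "norm (k' r z) * \<rho> \<le> m r" if "\<rho> < e/2" for \<rho>
    proof (cases "\<rho> > 0")
      case True
      then show ?thesis using bb[OF True that] by (simp only: pos_le_divide_eq)
    next
      case False
      then have "norm (k' r z) * \<rho> \<le> 0" by (simp add: mult_nonneg_nonpos)
      also have "0 \<le> m r" using order_trans[OF norm_ge_zero bound[OF r z0]] .
      finally show ?thesis .
    qed
    note * = this
    have "norm (k' r z) * (e/2) \<le> m r"
    proof (rule field_le_mult_one_interval)
      fix t :: real assume t: "0 < t" "t < 1"
      then have "t * (e/2) < e/2" using e by simp
      from *[OF this] show "t * (norm (k' r z) * (e/2)) \<le> m r" by (simp only: mult.left_commute)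
    qed
    then show ?thesis using e by (simp add: field_simps)
  qed
  have m2: "set_integrable lborel {0<..} (\<lambda>r. m r * (2/e))" using m by simp
  have int: "set_integrable lborel {0<..} (\<lambda>r. k r z)" if "z \<in> ball z0 e" for z
    using set_integrable_halfline_bound[OF cont[OF that] bound m] that by simp
  show ?thesis
    unfolding has_field_derivative_iff tendsto_at_iff_sequentially comp_def
  proof (intro allI impI)
    fix X :: "nat \<Rightarrow> complex" assume X: "\<forall>i. X i \<in> UNIV - {z0}" "X \<longlonglongrightarrow> z0"
    have "\<forall>\<^sub>F n in sequentially. X n \<in> ball z0 (e/2)"
      using X(2) e by (intro topological_tendstoD[OF X(2)]) auto
    then obtain N where N: "\<And>n. n \<ge> N \<Longrightarrow> X n \<in> ball z0 (e/2)"
      by (auto simp: eventually_sequentially)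
    define Y where "Y n = X (n + N)" for n
    have Y: "Y n \<in> ball z0 (e/2)" "Y n \<in> ball z0 e" "Y n \<noteq> z0" for n
      using N[of "n+N"] X(1) e unfolding Y_def by auto
    have Ylim: "Y \<longlonglongrightarrow> z0" unfolding Y_def using X(2) by (rule LIMSEQ_ignore_initial_segment)
    have "(\<lambda>n. LBINT r:{0<..}. (k r (Y n) - k r z0) / (Y n - z0)) \<longlonglongrightarrow> (LBINT r:{0<..}. k' r z0)"
    proof (rule halfline_dominated_convergence[where m="\<lambda>r. m r * (2/e)"])
      show "continuous_on {0<..} (\<lambda>r. (k r (Y n) - k r z0) / (Y n - z0))" for n
        using Y z0 by (intro continuous_intros cont) auto
      show "norm ((k r (Y n) - k r z0) / (Y n - z0)) \<le> m r * (2/e)" if r: "r > 0" for n r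
      proof -
        have "norm (k r (Y n) - k r z0) \<le> m r * (2/e) * norm (Y n - z0)"
          by (rule field_differentiable_bound[OF convex_ball[of z0 "e/2"]])
             (use Y[of n] e k'_bound[OF r] in \<open>auto intro!: has_field_derivative_at_within[OF der[OF r]]\<close>)
        then show ?thesis using Y(3)[of n] by (simp add: norm_divide field_simps)
      qed
      show "(\<lambda>n. (k r (Y n) - k r z0) / (Y n - z0)) \<longlonglongrightarrow> k' r z0" if r: "r > 0" for r
        using der[OF r z0] Ylim Y(3)
        unfolding has_field_derivative_iff tendsto_at_iff_sequentially comp_def by auto
    qed (rule m2)
    moreover have "(LBINT r:{0<..}. (k r (Y n) - k r z0) / (Y n - z0)) =
       ((LBINT r:{0<..}. k r (Y n)) - (LBINT r:{0<..}. k r z0)) / (Y n - z0)" for n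
      using set_integral_diff[OF int[OF Y(2)[of n]] int[OF z0]] by simp
    ultimately have "(\<lambda>n. ((LBINT r:{0<..}. k r (Y n)) - (LBINT r:{0<..}. k r z0)) / (Y n - z0)) \<longlonglongrightarrow> (LBINT r:{0<..}. k' r z0)"
      by (simp only:)
    then show "(\<lambda>n. ((LBINT r:{0<..}. k r (X n)) - (LBINT r:{0<..}. k r z0)) / (X n - z0)) \<longlonglongrightarrow> (LBINT r:{0<..}. k' r z0)"
      unfolding Y_def by (rule LIMSEQ_offset)
  qed
qed

lemma halfline_FTC:
  fixes f F :: "real \<Rightarrow> 'a::euclidean_space"
  assumes "\<And>x. 0 < x \<Longrightarrow> (F has_vector_derivative f x) (at x)"
    and "continuous_on {0<..} f" "set_integrable lborel {0<..} f"
    and "(F \<longlongrightarrow> A) (at_right 0)" "(F \<longlongrightarrow> B) at_top"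
  shows "(LBINT x:{0<..}. f x) = B - A"
proof -
  have e: "einterval 0 \<infinity> = {0<..}" by (auto simp: einterval_def)
  have "(LBINT x=0..\<infinity>. f x) = B - A"
  proof (rule interval_integral_FTC_integrable)
    show "\<And>x. 0 < ereal x \<Longrightarrow> ereal x < \<infinity> \<Longrightarrow> isCont f x"
      using assms(2) continuous_on_eq_continuous_at[of "{0<..}" f] by auto
    show "((F \<circ> real_of_ereal) \<longlongrightarrow> A) (at_right 0)"
      using assms(4) by (simp add: ereal_tendsto_simps zero_ereal_def)
    show "((F \<circ> real_of_ereal) \<longlongrightarrow> B) (at_left \<infinity>)"
      using assms(5) by (simp add: ereal_tendsto_simps)
  qed (use assms e in auto)
  then show ?thesis by (simp add: interval_lebesgue_integral_def e)
qed

lemma halfline_FTC_nonneg: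
  fixes f F :: "real \<Rightarrow> real"
  assumes "\<And>x. 0 < x \<Longrightarrow> (F has_real_derivative f x) (at x)"
    and "continuous_on {0<..} f" "\<And>x. 0 < x \<Longrightarrow> 0 \<le> f x"
    and "(F \<longlongrightarrow> A) (at_right 0)" "(F \<longlongrightarrow> B) at_top"
  shows "set_integrable lborel {0<..} f" "(LBINT x:{0<..}. f x) = B - A"
proof -
  have e: "einterval 0 \<infinity> = {0<..}" by (auto simp: einterval_def)
  have c: "\<And>x. 0 < ereal x \<Longrightarrow> ereal x < \<infinity> \<Longrightarrow> isCont f x"
      using assms(2) continuous_on_eq_continuous_at[of "{0<..}" f] by auto
  have A: "((F \<circ> real_of_ereal) \<longlongrightarrow> A) (at_right 0)"
      using assms(4) by (simp add: ereal_tendsto_simps zero_ereal_def)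
  have B: "((F \<circ> real_of_ereal) \<longlongrightarrow> B) (at_left \<infinity>)"
      using assms(5) by (simp add: ereal_tendsto_simps)
  note * = interval_integral_FTC_nonneg[of 0 "\<infinity>" F f A B, OF _ _ c _ A B]
  show "set_integrable lborel {0<..} f" "(LBINT x:{0<..}. f x) = B - A"
    using * assms(1,3) e by (auto simp: interval_lebesgue_integral_def)
qed

text \<open>The weight \<open>1 / (\<surd>r (1 + r))\<close> is the common majorant for the rotation of rays: it allows for a logarithm at
  the origin and is weaker than exponential decay, but \<open>r\<close> times it still vanishes at \<open>0\<close> and \<open>\<infinity>\<close>.\<close>

lemma tail_weight_integrable: "set_integrable lborel {0<..} (\<lambda>r::real. 1 / (sqrt r * (1 + r)))"
proof (rule halfline_FTC_nonneg)
  show "((\<lambda>x. 2 * arctan (sqrt x)) has_real_derivative 1 / (sqrt x * (1 + x))) (at x)" if "0 < x" for x :: real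
    using that by (auto intro!: derivative_eq_intros simp: divide_simps)
  show "((\<lambda>x. 2 * arctan (sqrt x)) \<longlongrightarrow> 2 * arctan (sqrt 0)) (at_right 0)"
    by (intro tendsto_intros)
  show "((\<lambda>x. 2 * arctan (sqrt x)) \<longlongrightarrow> 2 * (pi/2)) at_top"
    by (intro tendsto_intros filterlim_compose[OF tendsto_arctan_at_top] sqrt_at_top)
qed (auto intro!: continuous_intros)

lemma inverse_square_weight_integrable: "set_integrable lborel {0<..} (\<lambda>r::real. 1 / (1 + r\<^sup>2))"
  and inverse_square_weight_integral: "(LBINT r:{0<..}. 1 / (1 + r\<^sup>2)) = pi / 2"
proof -
  have 1: "(arctan has_real_derivative 1 / (1 + x\<^sup>2)) (at x)" for x
    by (auto intro!: derivative_eq_intros simp: field_simps)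
  have 2: "(arctan \<longlongrightarrow> 0) (at_right 0)" using tendsto_arctan[OF tendsto_ident_at, of 0] by simp
  have 3: "continuous_on {0<..} (\<lambda>r::real. 1 / (1 + r\<^sup>2))"
    by (auto intro!: continuous_intros simp: add_nonneg_eq_0_iff)
  note * = halfline_FTC_nonneg[OF 1 3 _ 2 tendsto_arctan_at_top]
  show "set_integrable lborel {0<..} (\<lambda>r::real. 1 / (1 + r\<^sup>2))"
     "(LBINT r:{0<..}. 1 / (1 + r\<^sup>2)) = pi / 2" using * by auto
qed

lemma Im_set_integral:
  assumes "set_integrable M A f" shows "Im (LINT x:A|M. f x) = (LINT x:A|M. Im (f x))"
  using integral_Im[OF assms[unfolded set_integrable_def]] unfolding set_lebesgue_integral_def by simp

lemma Re_set_integral: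
  assumes "set_integrable M A f" shows "Re (LINT x:A|M. f x) = (LINT x:A|M. Re (f x))"
  using integral_Re[OF assms[unfolded set_integrable_def]] unfolding set_lebesgue_integral_def by simp

lemma set_integral_atLeast_greaterThan:
  fixes f :: "real \<Rightarrow> real"
  shows "(LBINT t:{a..}. f t) = (LBINT t:{a<..}. f t)"
  unfolding set_lebesgue_integral_def
  by (rule integral_discrete_difference[where X="{a}"]) (auto simp: indicator_def)

text \<open>\<open>\<surd>s + 1 / \<surd>s\<close> is a common majorant for \<open>1\<close>, \<open>|ln s|\<close> and \<open>ln (1 + s)\<close>.\<close>

lemma log_weight_integrable: "set_integrable lborel {0<..} (\<lambda>s::real. (sqrt s + 1 / sqrt s) / (1 + s\<^sup>2))"
proof (rule set_integrable_halfline_bound[OF _ _ set_integrable_mult_right[OF tail_weight_integrable, of 2]])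
  fix s :: real assume s: "s > 0"
  have e: "sqrt s + 1 / sqrt s = (1 + s) / sqrt s" using s by (simp add: add_divide_distrib real_div_sqrt)
  have "0 \<le> (1 - s)\<^sup>2" by simp
  then have "(1 + s) * (1 + s) \<le> 2 * (1 + s\<^sup>2)" by (simp add: power2_eq_square algebra_simps)
  then have "(1 + s) / (1 + s\<^sup>2) \<le> 2 / (1 + s)" using s
    by (subst divide_le_eq, (simp add: add_pos_pos)) (simp add: field_simps)
  then have "(1 + s) / (1 + s\<^sup>2) / sqrt s \<le> 2 / (1 + s) / sqrt s" using s by (intro divide_right_mono) auto
  then show "norm ((sqrt s + 1 / sqrt s) / (1 + s\<^sup>2)) \<le> 2 * (1 / (sqrt s * (1 + s)))"
    using s by (simp add: e mult_ac)
qed (auto intro!: continuous_intros simp: add_nonneg_eq_0_iff)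

lemma one_le_log_weight: "s > 0 \<Longrightarrow> 1 \<le> sqrt s + 1 / sqrt (s::real)"
  by (cases "s \<ge> 1") (auto intro: add_increasing2 add_increasing)

lemma ln_one_plus_le_log_weight: "s > 0 \<Longrightarrow> ln (1 + s) \<le> 2 * (sqrt s + 1 / sqrt (s::real))"
proof -
  assume s: "s > 0"
  have "ln (1 + s) = 2 * ln (sqrt (1 + s))" using s by (simp add: ln_sqrt)
  also have "\<dots> \<le> 2 * (sqrt (1 + s) - 1)" using ln_le_minus_one[of "sqrt (1+s)"] s by simp
  also have "sqrt (1 + s) \<le> sqrt 1 + sqrt s" by (rule sqrt_add_le_add_sqrt) (use s in auto)
  finally show ?thesis using s by (simp add: add_increasing2)
qed

lemma abs_ln_le_log_weight:
  assumes s: "s > 0" shows "\<bar>ln s\<bar> \<le> 2 * (sqrt s + 1 / sqrt (s::real))"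
proof -
  have "ln s = 2 * ln (sqrt s)" using s by (simp add: ln_sqrt)
  also have "ln (sqrt s) \<le> sqrt s - 1" using ln_le_minus_one[of "sqrt s"] s by simp
  finally have 1: "ln s \<le> 2 * (sqrt s - 1)" by simp
  have "- ln s = 2 * ln (1 / sqrt s)" using s by (simp add: ln_sqrt ln_div)
  also have "ln (1 / sqrt s) \<le> 1 / sqrt s - 1" using ln_le_minus_one[of "1 / sqrt s"] s by simp
  finally have 2: "- ln s \<le> 2 * (1 / sqrt s - 1)" by simp
  have "sqrt s > 0" "1 / sqrt s > 0" using s by auto
  with 1 2 show ?thesis by (simp only: abs_le_iff) argo
qed

lemma exp_decay_weight:
  assumes "r > 0" "s > 0"
  shows "(sqrt r + 1 / sqrt r) * exp (- s * r) \<le> (1 + 2/s + 2/s^2) * (1 / (sqrt r * (1 + r)))"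
proof -
  have r: "r > 0" using assms by simp
  have "1 + s*r + (s*r)^2/2 \<le> exp (s * r)" using exp_lower_Taylor_quadratic[of "s*r"] r \<open>s > 0\<close> by simp
  then have "(1 + s*r + (s*r)^2/2) * exp (- s * r) \<le> exp (s*r) * exp (- s * r)" by (intro mult_right_mono) auto
  then have e: "(1 + s*r + (s*r)^2/2) * exp (- s * r) \<le> 1" by (simp flip: exp_add)
  have "(1+r)^2 \<le> (1 + 2/s + 2/s^2) * (1 + s*r + (s*r)^2/2)"
    using r \<open>s > 0\<close> by (simp add: field_simps power2_eq_square)
  then have "(1+r)^2 * exp (- s * r) \<le> (1 + 2/s + 2/s^2) * ((1 + s*r + (s*r)^2/2) * exp (- s * r))"
    by (simp add: mult_right_mono flip: mult.assoc)
  also have "\<dots> \<le> (1 + 2/s + 2/s^2) * 1" using e \<open>s>0\<close> by (intro mult_left_mono) auto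
  finally have "(1+r)^2 * exp (- s * r) / (sqrt r * (1 + r)) \<le> (1 + 2/s + 2/s^2) / (sqrt r * (1 + r))"
    using r by (intro divide_right_mono) auto
  moreover have "sqrt r + 1 / sqrt r = (1+r)^2 / (sqrt r * (1 + r))"
  proof -
    have "sqrt r + 1 / sqrt r = (1+r) / sqrt r" using r by (simp add: add_divide_distrib real_div_sqrt)
    also have "\<dots> = (1+r)^2 / (sqrt r * (1 + r))" using r by (simp add: power2_eq_square)
    finally show ?thesis .
  qed
  ultimately show ?thesis by simp
qed

lemma exp_decay_weight_integrable:
  assumes s: "s > 0" shows "set_integrable lborel {0<..} (\<lambda>r. (sqrt r + 1 / sqrt r) * exp (- s * r))"
proof (rule set_integrable_halfline_bound[OF _ _ set_integrable_mult_right[OF tail_weight_integrable, of "1 + 2/s + 2/s^2"]])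
  show "norm ((sqrt r + 1 / sqrt r) * exp (- s * r)) \<le> (1 + 2/s + 2/s^2) * (1 / (sqrt r * (1 + r)))" if r: "r > 0" for r
    using exp_decay_weight[OF r s] r by (simp add: abs_mult)
qed (auto intro!: continuous_intros)

lemma cubic_exp_bound:
  fixes r s :: real
  assumes "r \<ge> 0" "s > 0" shows "(1 + r) ^ 3 * exp (- s * r) \<le> (1 + 6 / s) ^ 3 * exp (- (s / 2) * r)"
proof -
  have "1 + r \<le> (1 + 6 / s) * (1 + s / 6 * r)" using assms by (simp add: field_simps)
  also have "\<dots> \<le> (1 + 6 / s) * exp (s / 6 * r)" using assms by (intro mult_left_mono exp_ge_add_one_self) auto
  finally have "(1 + r) ^ 3 \<le> ((1 + 6 / s) * exp (s / 6 * r)) ^ 3" using assms by (intro power_mono) auto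
  also have "\<dots> = (1 + 6 / s) ^ 3 * exp (s / 2 * r)" by (simp add: power_mult_distrib exp_of_nat_mult[symmetric])
  finally have "(1 + r) ^ 3 * exp (- s * r) \<le> (1 + 6 / s) ^ 3 * exp (s / 2 * r) * exp (- s * r)" by (intro mult_right_mono) auto
  also have "\<dots> = (1 + 6 / s) ^ 3 * exp (- (s / 2) * r)" by (simp add: mult.assoc mult_exp_exp)
  finally show ?thesis .
qed

lemma exp_decay_integral:
  assumes s: "s > (0::real)"
  shows "set_integrable lborel {0<..} (\<lambda>r. exp (- s * r))" "(LBINT r:{0<..}. exp (- s * r)) = 1 / s"
proof -
  have D: "((\<lambda>r. - exp (- s * r) / s) has_real_derivative exp (- s * x)) (at x)" for x :: real
    using s by (auto intro!: derivative_eq_intros)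
  have A: "((\<lambda>r. - exp (- s * r) / s) \<longlongrightarrow> - exp (- s * 0) / s) (at_right 0)" using s by (intro tendsto_intros) auto
  have B: "((\<lambda>r. - exp (- s * r) / s) \<longlongrightarrow> 0) at_top" using s by real_asymp
  have c: "continuous_on {0<..} (\<lambda>r. exp (- s * r))" by (intro continuous_intros)
  show "set_integrable lborel {0<..} (\<lambda>r. exp (- s * r))" "(LBINT r:{0<..}. exp (- s * r)) = 1 / s"
    using halfline_FTC_nonneg[OF D c _ A B] by auto
qed

section \<open>Rotating rays, gradient bounds and injectivity of the Laplace transform\<close>

text \<open>Cauchy's theorem, localized by the weight. With a primitive \<open>H\<close> of \<open>h\<close>, the difference
  of the integrals along the two rays over \<open>[\<delta>, R]\<close> is controlled by \<open>H\<close> on the chords at radii \<open>\<delta>\<close> and \<open>R\<close>, whose contribution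
  is at most the radius times the weight.\<close>

lemma ray_integral_shift:
  fixes h :: "complex \<Rightarrow> complex"
  assumes S: "open S" "convex S" "h holomorphic_on S"
    and sub: "\<And>r v. r > 0 \<Longrightarrow> v \<in> closed_segment u1 u2 \<Longrightarrow> of_real r * v \<in> S"
    and bd: "\<And>r v. r > 0 \<Longrightarrow> v \<in> closed_segment u1 u2 \<Longrightarrow> norm (h (of_real r * v)) \<le> C / (sqrt r * (1 + r))"
  shows "u1 * (LBINT r:{0<..}. h (of_real r * u1)) = u2 * (LBINT r:{0<..}. h (of_real r * u2))"
proof -
  obtain H where H: "\<And>x. x \<in> S \<Longrightarrow> (H has_field_derivative h x) (at x within S)"
    using holomorphic_convex_primitive'[OF S(2,1,3)] by blast
  have H': "(H has_field_derivative h x) (at x)" if "x \<in> S" for x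
    using H[OF that] at_within_open[OF that S(1)] by simp
  have conth: "continuous_on S h" using S(3) by (rule holomorphic_on_imp_continuous_on)
  have cont: "continuous_on {0<..} (\<lambda>r. h (of_real r * v))" if "v \<in> closed_segment u1 u2" for v
    by (rule continuous_on_compose2[OF conth]) (use sub that in \<open>auto intro!: continuous_intros\<close>)
  have m: "set_integrable lborel {0<..} (\<lambda>r::real. C / (sqrt r * (1 + r)))"
    using set_integrable_mult_right[OF tail_weight_integrable, of C] by simp
  have int: "set_integrable lborel {0<..} (\<lambda>r. v * h (of_real r * v))" if "v \<in> closed_segment u1 u2" for v
    by (rule set_integrable_mult_right)
       (rule set_integrable_halfline_bound[OF cont[OF that] _ m], use bd that in auto)
  define D where "D r = H (of_real r * u1) - H (of_real r * u2)" for r :: real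
  have Dbound: "norm (D r) \<le> r * norm (u1 - u2) * (C / (sqrt r * (1 + r)))" if r: "r > 0" for r
  proof -
    have seg: "closed_segment (of_real r * u1) (of_real r * u2) = (\<lambda>v. of_real r * v) ` closed_segment u1 u2"
      by (rule closed_segment_linear_image) (auto intro!: linearI simp: algebra_simps)
    have "norm (H (of_real r * u1) - H (of_real r * u2)) \<le> (C / (sqrt r * (1 + r))) * norm (of_real r * u1 - of_real r * u2)"
      by (rule field_differentiable_bound[of "closed_segment (of_real r * u1) (of_real r * u2)"])
         (use r sub bd in \<open>auto simp: seg intro!: DERIV_subset[OF H]  intro: has_field_derivative_at_within H'\<close>)
    also have "norm (of_real r * u1 - of_real r * u2) = r * norm (u1 - u2)"
      using r by (simp add: norm_mult flip: right_diff_distrib)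
    finally show ?thesis by (simp add: D_def mult_ac)
  qed
  have u: "u1 \<in> closed_segment u1 u2" "u2 \<in> closed_segment u1 u2" by auto
  have "(LBINT r:{0<..}. u1 * h (of_real r * u1) - u2 * h (of_real r * u2)) = 0 - 0"
  proof (rule halfline_FTC)
    show "(D has_vector_derivative u1 * h (of_real r * u1) - u2 * h (of_real r * u2)) (at r)" if "0 < r" for r
    proof -
      have "((\<lambda>r. H (of_real r * v)) has_vector_derivative v * h (of_real r * v)) (at r)" if "v \<in> closed_segment u1 u2" for v
      proof -
        have "((\<lambda>r. of_real r * v) has_vector_derivative v) (at r)"
          by (auto intro!: derivative_eq_intros)
        from field_vector_diff_chain_at[OF this H'] show ?thesis
          using sub that \<open>0 < r\<close> by (simp add: o_def)
      qed
      from has_vector_derivative_diff[OF this[OF u(1)] this[OF u(2)]] show ?thesis unfolding D_def .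
    qed
    show "continuous_on {0<..} (\<lambda>r. u1 * h (of_real r * u1) - u2 * h (of_real r * u2))"
      using cont u by (intro continuous_intros) auto
    show "set_integrable lborel {0<..} (\<lambda>r. u1 * h (of_real r * u1) - u2 * h (of_real r * u2))"
      using int u by (intro set_integral_diff) auto
    have lim: "((\<lambda>r. r * norm (u1 - u2) * (C / (sqrt r * (1 + r)))) \<longlongrightarrow> 0) (at_right 0)"
      "((\<lambda>r. r * norm (u1 - u2) * (C / (sqrt r * (1 + r)))) \<longlongrightarrow> 0) at_top"
      by real_asymp+
    show "(D \<longlongrightarrow> 0) (at_right 0)"
      by (rule Lim_null_comparison[OF eventually_mono[OF eventually_at_right_less[of 0] Dbound] lim(1)])
    show "(D \<longlongrightarrow> 0) at_top"
      by (rule Lim_null_comparison[OF eventually_mono[OF eventually_gt_at_top[of 0] Dbound] lim(2)])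
  qed
  then show ?thesis
    using set_integral_diff(2)[OF int[OF u(1)] int[OF u(2)]] by simp
qed

text \<open>A gradient bound for the harmonic function \<open>Im f\<close>, obtained from Cauchy's inequality for
  \<open>exp (- \<i> f / M)\<close>, which is bounded from above and below.\<close>

lemma norm_deriv_le_Im_bound:
  assumes f: "f holomorphic_on ball z \<rho>" and \<rho>: "\<rho> > 0" and M: "M > 0"
    and b: "\<And>w. w \<in> ball z \<rho> \<Longrightarrow> \<bar>Im (f w)\<bar> \<le> M"
  shows "norm (deriv f z) \<le> 2 * exp 2 * M / \<rho>"
proof -
  define g where "g w = exp (- \<i> * f w / of_real M)" for w
  have z: "z \<in> ball z \<rho>" using \<rho> by simp
  have fd: "(f has_field_derivative deriv f z) (at z)"
    using f z open_ball by (metis holomorphic_derivI)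
  have gd: "(g has_field_derivative g z * (- \<i> * deriv f z / of_real M)) (at z)"
    unfolding g_def using M by (auto intro!: derivative_eq_intros fd)
  have ng: "norm (g w) = exp (Im (f w) / M)" for w by (simp add: g_def norm_exp_eq_Re)
  have hg: "g holomorphic_on ball z \<rho>" unfolding g_def by (intro holomorphic_intros f) (use M in auto)
  have sub: "cball z (\<rho>/2) \<subseteq> ball z \<rho>" using \<rho> by auto
  have "norm ((deriv ^^ 1) g z) \<le> fact 1 * exp 1 / (\<rho>/2) ^ 1"
  proof (rule Cauchy_inequality)
    show "continuous_on (cball z (\<rho>/2)) g"
      by (rule holomorphic_on_imp_continuous_on[OF holomorphic_on_subset[OF hg sub]])
    show "g holomorphic_on ball z (\<rho>/2)" using \<rho> by (intro holomorphic_on_subset[OF hg]) auto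
    show "norm (g x) \<le> exp 1" if "norm (z - x) = \<rho>/2" for x
      using b[of x] that \<rho> M by (simp add: ng dist_norm abs_le_iff)
  qed (use \<rho> in auto)
  then have "exp (Im (f z) / M) * norm (deriv f z) / M \<le> 2 * exp 1 / \<rho>"
    using DERIV_imp_deriv[OF gd] M \<rho> by (simp add: norm_mult norm_divide ng field_simps)
  moreover have "exp (-1) \<le> exp (Im (f z) / M)" using b[OF z] M by (simp add: abs_le_iff field_simps)
  then have "exp (-1) * norm (deriv f z) / M \<le> exp (Im (f z) / M) * norm (deriv f z) / M"
    using M by (intro divide_right_mono mult_right_mono) auto
  ultimately have "exp (-1) * norm (deriv f z) / M \<le> 2 * exp 1 / \<rho>" by linarith
  then have "exp 1 * M * (exp (-1) * norm (deriv f z) / M) \<le> exp 1 * M * (2 * exp 1 / \<rho>)"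
    using M by (intro mult_left_mono) auto
  moreover have "exp 1 * M * (exp (-1) * norm (deriv f z) / M) = norm (deriv f z)"
    using M by (simp add: exp_minus)
  moreover have "exp 1 * M * (2 * exp 1 / \<rho>) = 2 * exp 2 * M / \<rho>"
    using exp_add[of "1::real" 1] by simp
  ultimately show ?thesis by (simp only:)
qed

text \<open>Lerch's theorem. In the variable \<open>t = exp (- r)\<close> the hypothesis says that all moments vanish; the factor
  \<open>t (1 - t)\<close> makes the function continuous on \<open>[0, 1]\<close>, so that Weierstrass approximation by polynomials
  in \<open>t\<close> shows that the integral of its square is zero.\<close>

lemma Laplace_transform_injective_real:
  fixes f :: "real \<Rightarrow> real"
  assumes cont: "continuous_on {0<..} f"
    and bd: "\<And>r. r > 0 \<Longrightarrow> \<bar>f r\<bar> \<le> C * (sqrt r + 1 / sqrt r)"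
    and zero: "\<And>s. s > 0 \<Longrightarrow> (LBINT r:{0<..}. f r * exp (- s * r)) = 0"
    and r: "r > 0"
  shows "f r = 0"
proof -
  have fi: "set_integrable lborel {0<..} (\<lambda>r. f r * exp (- s * r))" if "s > 0" for s
    by (rule set_integrable_halfline_bound[OF _ _ set_integrable_mult_right[OF exp_decay_weight_integrable[OF that], of C]])
       (use bd in \<open>auto intro!: continuous_intros cont mult_right_mono simp: abs_mult\<close>)
  define k where "k r = exp (- r) * (1 - exp (- r)) * f r" for r
  define g where "g t = (if 0 < t \<and> t < 1 then k (- ln t) else 0)" for t
  have kc: "continuous_on {0<..} k" unfolding k_def by (intro continuous_intros cont)
  have gk: "g (exp (- r)) = k r" if "r > 0" for r using that by (simp add: g_def)
  have kb: "\<bar>k r\<bar> \<le> exp (-r) * (1 - exp (-r)) * (C * (sqrt r + 1 / sqrt r))" if "r > 0" for r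
    using bd[OF that] that unfolding k_def abs_mult by (intro mult_mono) auto
  have gb: "norm (g t) \<le> exp (ln t) * (1 - exp (ln t)) * (C * (sqrt (-ln t) + 1 / sqrt (-ln t)))"
    if "0 < t" "t < 1" for t
    using kb[of "- ln t"] that by (simp add: g_def)
  have gcont: "continuous_on {0..1} g"
    unfolding continuous_on_def
  proof
    fix t :: real assume "t \<in> {0..1}"
    then consider "t = 0" | "t = 1" | "0 < t" "t < 1" by fastforce
    then show "(g \<longlongrightarrow> g t) (at t within {0..1})"
    proof cases
      case 1
      have "((\<lambda>t. exp (ln t) * (1 - exp (ln t)) * (C * (sqrt (-ln t) + 1 / sqrt (-ln t)))) \<longlongrightarrow> 0) (at_right 0)"
        by real_asymp
      then have "(g \<longlongrightarrow> 0) (at_right 0)"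
      proof (rule Lim_null_comparison[rotated])
        show "\<forall>\<^sub>F t in at_right 0. norm (g t) \<le> exp (ln t) * (1 - exp (ln t)) * (C * (sqrt (-ln t) + 1 / sqrt (-ln t)))"
          using eventually_at_right_real[of 0 1, OF zero_less_one]
          by (rule eventually_mono) (use gb in auto)
      qed
      then show ?thesis using 1 by (simp add: g_def at_within_Icc_at_right)
    next
      case 2
      have "((\<lambda>t. exp (ln t) * (1 - exp (ln t)) * (C * (sqrt (-ln t) + 1 / sqrt (-ln t)))) \<longlongrightarrow> 0) (at_left 1)"
        by real_asymp
      then have "(g \<longlongrightarrow> 0) (at_left 1)"
      proof (rule Lim_null_comparison[rotated])
        show "\<forall>\<^sub>F t in at_left 1. norm (g t) \<le> exp (ln t) * (1 - exp (ln t)) * (C * (sqrt (-ln t) + 1 / sqrt (-ln t)))"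
          using eventually_at_left_real[of 0 1, OF zero_less_one]
          by (rule eventually_mono) (use gb in auto)
      qed
      then show ?thesis using 2 by (simp add: g_def at_within_Icc_at_left)
    next
      case 3
      have "continuous_on {0<..<1} (\<lambda>t. k (- ln t))"
        by (rule continuous_on_compose2[OF kc]) (auto intro!: continuous_intros)
      then have "continuous_on {0<..<1} g"
        by (rule continuous_on_eq) (auto simp: g_def)
      then have "isCont g t" using 3 by (simp add: continuous_on_eq_continuous_at)
      then show ?thesis unfolding isCont_def by (rule Lim_at_imp_Lim_at_within)
    qed
  qed
  have kint: "set_integrable lborel {0<..} (\<lambda>r. \<bar>k r\<bar> * exp (- r))"
  proof (rule set_integrable_halfline_bound[OF _ _ set_integrable_abs[OF fi[of 1]]])
    show "norm (\<bar>k r\<bar> * exp (- r)) \<le> \<bar>f r * exp (- 1 * r)\<bar>" if "r > 0" for r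
    proof -
      have "exp (- r) * (1 - exp (- r)) \<le> 1" using that by (intro mult_le_one) auto
      then have "exp (- r) * (1 - exp (- r)) * (\<bar>f r\<bar> * exp (- r)) \<le> 1 * (\<bar>f r\<bar> * exp (- r))"
        by (intro mult_right_mono) auto
      then show ?thesis using that by (simp add: k_def abs_mult mult_ac)
    qed
  qed (auto intro!: continuous_intros kc)
  have kpoly: "(LBINT r:{0<..}. k r * exp (- r) * p (exp (- r))) = 0" if p: "real_polynomial_function p" for p
  proof -
    obtain a n where pa: "p = (\<lambda>x. \<Sum>i\<le>n. a i * x ^ i)" using p real_polynomial_function_iff_sum by auto
    have e: "k r * exp (- r) * p (exp (- r)) = (\<Sum>i\<le>n. a i * (f r * exp (- real (i+2) * r) - f r * exp (- real (i+3) * r)))" for r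
      unfolding pa sum_distrib_left
    proof (rule sum.cong)
      fix i
      have E: "exp (- real n * r) = exp (- r) ^ n" for n using exp_of_nat_mult[of n "- r"] by simp
      show "k r * exp (- r) * (a i * exp (- r) ^ i) = a i * (f r * exp (- real (i+2) * r) - f r * exp (- real (i+3) * r))"
        unfolding E k_def by (simp only: power_add power2_eq_square power3_eq_cube) (simp add: algebra_simps)
    qed simp
    define q where "q i x = f x * exp (- real (i + 2) * x) - f x * exp (- real (i + 3) * x)" for i :: nat and x
    have qi: "set_integrable lborel {0<..} (q i)" "(LBINT x:{0<..}. q i x) = 0" for i
      using set_integral_diff[OF fi[of "real (i+2)"] fi[of "real (i+3)"]] zero[of "real (i+2)"] zero[of "real (i+3)"]
      unfolding q_def by auto
    have "(LBINT x:{0<..}. (\<Sum>i\<le>n. a i * q i x)) = (\<Sum>i\<le>n. LBINT x:{0<..}. a i * q i x)"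
      unfolding set_lebesgue_integral_def scaleR_sum_right
      by (rule Bochner_Integration.integral_sum)
         (use set_integrable_mult_right[OF qi(1)] in \<open>simp add: set_integrable_def\<close>)
    also have "\<dots> = 0" using qi(2) by simp
    finally show ?thesis unfolding e q_def .
  qed
  have nn: "0 \<le> k r * exp (- r) * k r" for r
  proof -
    have "0 \<le> exp (- r) * (k r)\<^sup>2" by simp
    also have "\<dots> = k r * exp (- r) * k r" by (simp add: power2_eq_square)
    finally show ?thesis .
  qed
  define J where "J = (LBINT r:{0<..}. k r * exp (- r) * k r)"
  have k2int: "set_integrable lborel {0<..} (\<lambda>r. k r * exp (- r) * k r)"
  proof -
    obtain B where B: "\<And>t. t \<in> {0..1} \<Longrightarrow> norm (g t) \<le> B"
      using compact_imp_bounded[OF compact_continuous_image[OF gcont compact_Icc]] unfolding bounded_iff by (metis imageI)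
    show ?thesis
    proof (rule set_integrable_halfline_bound[OF _ _ set_integrable_mult_right[OF kint, of B]])
      show "norm (k r * exp (- r) * k r) \<le> B * (\<bar>k r\<bar> * exp (- r))" if "r > 0" for r
      proof -
        have "\<bar>k r\<bar> \<le> B" using B[of "exp (- r)"] gk[OF that] that by simp
        then have "\<bar>k r\<bar> * (\<bar>k r\<bar> * exp (- r)) \<le> B * (\<bar>k r\<bar> * exp (- r))" by (intro mult_right_mono) auto
        then show ?thesis by (simp add: abs_mult mult_ac)
      qed
    qed (intro continuous_intros kc)
  qed
  have "\<bar>J\<bar> \<le> \<epsilon> * (LBINT r:{0<..}. \<bar>k r\<bar> * exp (- r))" if "\<epsilon> > 0" for \<epsilon>
  proof -
    obtain p where p: "real_polynomial_function p" "\<And>x. x \<in> {0..1} \<Longrightarrow> \<bar>g x - p x\<bar> < \<epsilon>"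
      using Stone_Weierstrass_real_polynomial_function[OF _ gcont \<open>\<epsilon> > 0\<close>] by auto
    have pc: "continuous_on {0<..} (\<lambda>r. p (exp (- r)))"
      by (rule continuous_on_compose2[OF continuous_on_polymonial_function[of p UNIV]])
        (auto intro!: continuous_intros simp: p(1) simp flip: real_polynomial_function_eq)
    have b: "\<bar>k r * exp (- r) * (k r - p (exp (- r)))\<bar> \<le> \<epsilon> * (\<bar>k r\<bar> * exp (- r))" if "r > 0" for r
    proof -
      have "\<bar>k r - p (exp (- r))\<bar> \<le> \<epsilon>" using p(2)[of "exp (- r)"] gk[OF that] that by simp
      then have "(\<bar>k r\<bar> * exp (- r)) * \<bar>k r - p (exp (- r))\<bar> \<le> (\<bar>k r\<bar> * exp (- r)) * \<epsilon>" by (intro mult_left_mono) auto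
      then show ?thesis by (simp add: abs_mult mult_ac)
    qed
    have cc: "continuous_on {0<..} (\<lambda>r. k r * exp (- r) * (k r - p (exp (- r))))"
      by (intro continuous_intros kc pc)
    have mi: "set_integrable lborel {0<..} (\<lambda>r. \<epsilon> * (\<bar>k r\<bar> * exp (- r)))" using kint by simp
    have i: "set_integrable lborel {0<..} (\<lambda>r. k r * exp (- r) * (k r - p (exp (- r))))"
      by (rule set_integrable_halfline_bound[OF cc _ mi]) (use b in auto)
    have "(\<lambda>r. k r * exp (- r) * p (exp (- r))) = (\<lambda>r. k r * exp (- r) * k r - k r * exp (- r) * (k r - p (exp (- r))))"
      by (auto simp: algebra_simps)
    then have "(LBINT r:{0<..}. k r * exp (- r) * p (exp (- r))) = J - (LBINT r:{0<..}. k r * exp (- r) * (k r - p (exp (- r))))"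
      unfolding J_def using set_integral_diff(2)[OF k2int i] by simp
    then have "J = (LBINT r:{0<..}. k r * exp (- r) * (k r - p (exp (- r))))" using kpoly[OF p(1)] by simp
    then show ?thesis using halfline_integral_norm_bound[OF cc _ mi] b by simp
  qed
  note Jb = this
  have "\<bar>J\<bar> \<le> 0"
  proof (rule field_le_epsilon)
    fix e :: real assume "e > 0"
    define L where "L = (LBINT r:{0<..}. \<bar>k r\<bar> * exp (- r))"
    have L: "L \<ge> 0" unfolding L_def set_lebesgue_integral_def by (rule integral_nonneg_AE) (auto simp: indicator_def)
    have "\<bar>J\<bar> \<le> e / (L + 1) * L" unfolding L_def by (rule Jb) (use L \<open>e > 0\<close> in \<open>simp add: L_def\<close>)
    also have "\<dots> \<le> e" using L \<open>e > 0\<close> by (simp add: field_simps)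
    finally show "\<bar>J\<bar> \<le> 0 + e" by simp
  qed
  then have J0: "J = 0" by simp
  have "k r * exp (- r) * k r = 0"
  proof -
    let ?I = "{r/2..r}"
    have sub: "?I \<subseteq> {0<..}" using r by auto
    have c: "continuous_on ?I (\<lambda>r. k r * exp (- r) * k r)"
      by (intro continuous_intros continuous_on_subset[OF kc sub])
    have "(LBINT r:?I. k r * exp (- r) * k r) \<le> J" unfolding J_def set_lebesgue_integral_def
    proof (rule integral_mono)
      show "integrable lborel (\<lambda>x. indicat_real ?I x *\<^sub>R (k x * exp (- x) * k x))"
        using set_integrable_subset[OF k2int _ sub] by (simp add: set_integrable_def)
      show "integrable lborel (\<lambda>x. indicat_real {0<..} x *\<^sub>R (k x * exp (- x) * k x))"
        using k2int by (simp add: set_integrable_def)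
    qed (use r nn in \<open>auto simp: indicator_def\<close>)
    moreover have "(LBINT r:?I. k r * exp (- r) * k r) = integral ?I (\<lambda>r. k r * exp (- r) * k r)"
      using set_integrable_subset[OF k2int _ sub] by (intro set_borel_integral_eq_integral) auto
    moreover have "integral ?I (\<lambda>r. k r * exp (- r) * k r) \<ge> 0"
      using integrable_continuous_real[OF c] by (intro integral_nonneg) (use nn in auto)
    ultimately have "integral ?I (\<lambda>r. k r * exp (- r) * k r) = 0" using J0 by simp
    then show ?thesis
      using integral_eq_0_iff[OF c _ nn] r by simp
  qed
  then show ?thesis using r by (simp add: k_def)
qed

lemma Laplace_transform_injective:
  fixes f :: "real \<Rightarrow> complex"
  assumes cont: "continuous_on {0<..} f"
    and bd: "\<And>r. r > 0 \<Longrightarrow> norm (f r) \<le> C * (sqrt r + 1 / sqrt r)"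
    and int: "\<And>s. s > 0 \<Longrightarrow> set_integrable lborel {0<..} (\<lambda>r. f r * of_real (exp (- s * r)))"
    and zero: "\<And>s. s > 0 \<Longrightarrow> (LBINT r:{0<..}. f r * of_real (exp (- s * r))) = 0"
    and r: "r > 0"
  shows "f r = 0"
proof -
  have "(LBINT r:{0<..}. Re (f r) * exp (- s * r)) = Re (LBINT r:{0<..}. f r * of_real (exp (- s * r)))"
      "(LBINT r:{0<..}. Im (f r) * exp (- s * r)) = Im (LBINT r:{0<..}. f r * of_real (exp (- s * r)))" if "s > 0" for s
    using integral_Re[OF int[OF that, unfolded set_integrable_def]] integral_Im[OF int[OF that, unfolded set_integrable_def]]
    unfolding set_lebesgue_integral_def by (auto simp: o_def)
  then have z: "(LBINT r:{0<..}. Re (f r) * exp (- s * r)) = 0" "(LBINT r:{0<..}. Im (f r) * exp (- s * r)) = 0" if "s > 0" for s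
    using zero that by auto
  have "Re (f r) = 0"
    by (rule Laplace_transform_injective_real[OF _ _ z(1) r, of C])
       (use cont bd in \<open>auto intro!: continuous_intros intro: order_trans[OF abs_Re_le_cmod]\<close>)
  moreover have "Im (f r) = 0"
    by (rule Laplace_transform_injective_real[OF _ _ z(2) r, of C])
       (use cont bd in \<open>auto intro!: continuous_intros intro: order_trans[OF abs_Im_le_cmod]\<close>)
  ultimately show ?thesis by (simp add: complex_eq_iff)
qed

section \<open>The Wiener-Hopf factor\<close>

lemma Im_complex_of_real_mult: "Im (of_real a * z) = a * Im z" by simp

lemma norm_Ln_le: "z \<noteq> 0 \<Longrightarrow> norm (Ln z) \<le> \<bar>ln (norm z)\<bar> + pi"
  using cmod_le[of "Ln z"] mpi_less_Im_Ln[of z] Im_Ln_le_pi[of z] by auto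

definition log_integral :: "complex \<Rightarrow> complex" where
  "log_integral w = (LBINT s:{0<..}. Ln (w + of_real s) / of_real (1 + s\<^sup>2))"

lemma not_nonpos_add_pos: "(w::complex) \<notin> \<real>\<^sub>\<le>\<^sub>0 \<Longrightarrow> s \<ge> 0 \<Longrightarrow> w + of_real s \<notin> \<real>\<^sub>\<le>\<^sub>0"
  by (auto simp: complex_nonpos_Reals_iff)

lemma of_real_one_plus_square_nonzero [simp]: "1 + (of_real s)\<^sup>2 \<noteq> (0::complex)"
proof -
  have "1 + (of_real s)\<^sup>2 = (of_real (1 + s\<^sup>2) :: complex)" by simp
  moreover have "1 + s\<^sup>2 \<noteq> 0" by (simp add: add_nonneg_eq_0_iff)
  ultimately show ?thesis by (metis of_real_eq_0_iff)
qed

lemma log_integrand_bound_near: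
  assumes "w0 \<notin> \<real>\<^sub>\<le>\<^sub>0"
  obtains e C where "e > 0" "ball w0 e \<subseteq> - \<real>\<^sub>\<le>\<^sub>0"
    "\<And>w s. w \<in> ball w0 e \<Longrightarrow> s > 0 \<Longrightarrow>
       norm (Ln (w + of_real s) / of_real (1 + s\<^sup>2)) \<le> C * ((sqrt s + 1 / sqrt s) / (1 + s\<^sup>2))"
proof -
  have "open (- (\<real>\<^sub>\<le>\<^sub>0 :: complex set))" by (simp add: open_Compl)
  then obtain d where d: "d > 0" "ball w0 d \<subseteq> - \<real>\<^sub>\<le>\<^sub>0"
    using assms unfolding open_contains_ball by (metis ComplI)
  define A where "A = norm w0 + d"
  define C where "C = \<bar>ln (d/2)\<bar> + ln (1 + A) + 2 + pi"
  have A: "A > 0" using d by (simp add: A_def add_nonneg_pos)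
  show ?thesis
  proof
    show "d/2 > 0" "ball w0 (d/2) \<subseteq> - \<real>\<^sub>\<le>\<^sub>0" using d by (auto simp: subset_iff)
    fix w :: complex and s :: real assume w: "w \<in> ball w0 (d/2)" and s: "s > 0"
    define P where "P = sqrt s + 1 / sqrt s"
    have P: "P \<ge> 1" using one_le_log_weight[OF s] by (simp add: P_def)
    have "- complex_of_real s \<in> \<real>\<^sub>\<le>\<^sub>0" using s by (simp add: complex_nonpos_Reals_iff)
    then have "- complex_of_real s \<notin> ball w0 d" using d by auto
    then have "d \<le> norm (w0 + of_real s)" by (simp add: dist_norm)
    also have "\<dots> \<le> norm (w + of_real s) + norm (w0 - w)"
      using norm_triangle_ineq[of "w + of_real s" "w0 - w"] by (simp add: add.commute)
    also have "norm (w0 - w) < d/2" using w by (simp add: dist_norm)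
    finally have lo: "d/2 \<le> norm (w + of_real s)" by simp
    have "norm w \<le> norm w0 + norm (w0 - w)" using norm_triangle_ineq2[of w w0] by (simp add: norm_minus_commute)
    then have "norm w \<le> A" using w d unfolding A_def by (simp add: dist_norm)
    then have "norm (w + of_real s) \<le> A + s" using norm_triangle_ineq[of w "of_real s"] s by simp
    also have "\<dots> \<le> (1 + A) * (1 + s)" using s A by (simp add: algebra_simps)
    finally have "ln (norm (w + of_real s)) \<le> ln ((1 + A) * (1 + s))" using lo d by (intro ln_mono) auto
    also have "\<dots> = ln (1 + A) + ln (1 + s)" using s A by (simp add: ln_mult)
    also have "\<dots> \<le> ln (1 + A) + 2 * P" using ln_one_plus_le_log_weight[OF s] by (simp add: P_def)
    finally have up: "ln (norm (w + of_real s)) \<le> ln (1 + A) + 2 * P" .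
    have "ln (d/2) \<le> ln (norm (w + of_real s))" using lo d by (intro ln_mono) auto
    then have "\<bar>ln (norm (w + of_real s))\<bar> \<le> \<bar>ln (d/2)\<bar> + ln (1 + A) + 2 * P"
      using up P A ln_ge_zero[of "1 + A"] by linarith
    then have "norm (Ln (w + of_real s)) \<le> \<bar>ln (d/2)\<bar> + ln (1 + A) + 2 * P + pi"
      using norm_Ln_le[of "w + of_real s"] lo d by fastforce
    also have "\<dots> \<le> C * P"
    proof -
      have "(\<bar>ln (d/2)\<bar> + ln (1 + A) + pi) * 1 \<le> (\<bar>ln (d/2)\<bar> + ln (1 + A) + pi) * P"
        using P A by (intro mult_left_mono) auto
      then show ?thesis unfolding C_def by (simp add: algebra_simps)
    qed
    finally have "norm (Ln (w + of_real s)) / (1 + s\<^sup>2) \<le> C * P / (1 + s\<^sup>2)" by (intro divide_right_mono) auto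
    then show "norm (Ln (w + of_real s) / of_real (1 + s\<^sup>2)) \<le> C * ((sqrt s + 1 / sqrt s) / (1 + s\<^sup>2))"
      by (simp add: norm_divide P_def norm_of_real del: of_real_add of_real_power)
  qed
qed

lemma continuous_on_log_integrand:
  assumes "w \<notin> \<real>\<^sub>\<le>\<^sub>0"
  shows "continuous_on {0<..} (\<lambda>s. Ln (w + of_real s) / of_real (1 + s\<^sup>2))"
  using not_nonpos_add_pos[OF assms] by (auto intro!: continuous_intros)

lemma log_integrand_integrable:
  assumes "w \<notin> \<real>\<^sub>\<le>\<^sub>0"
  shows "set_integrable lborel {0<..} (\<lambda>s. Ln (w + of_real s) / of_real (1 + s\<^sup>2))"
proof -
  obtain e C where e: "e > 0" "ball w e \<subseteq> - \<real>\<^sub>\<le>\<^sub>0"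
    "\<And>u s. u \<in> ball w e \<Longrightarrow> s > 0 \<Longrightarrow>
       norm (Ln (u + of_real s) / of_real (1 + s\<^sup>2)) \<le> C * ((sqrt s + 1 / sqrt s) / (1 + s\<^sup>2))"
    using log_integrand_bound_near[OF assms] by metis
  show ?thesis
    by (rule set_integrable_halfline_bound[OF continuous_on_log_integrand[OF assms] e(3) set_integrable_mult_right[OF log_weight_integrable]])
       (use e in auto)
qed

lemma log_integral_has_field_derivative:
  assumes "w \<notin> \<real>\<^sub>\<le>\<^sub>0"
  shows "(log_integral has_field_derivative (LBINT s:{0<..}. 1 / ((w + of_real s) * of_real (1 + s\<^sup>2)))) (at w)"
proof -
  obtain e C where e: "e > 0" "ball w e \<subseteq> - \<real>\<^sub>\<le>\<^sub>0"
    "\<And>u s. u \<in> ball w e \<Longrightarrow> s > 0 \<Longrightarrow>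
       norm (Ln (u + of_real s) / of_real (1 + s\<^sup>2)) \<le> C * ((sqrt s + 1 / sqrt s) / (1 + s\<^sup>2))"
    using log_integrand_bound_near[OF assms] by metis
  have "((\<lambda>w. LBINT s:{0<..}. Ln (w + of_real s) / of_real (1 + s\<^sup>2)) has_field_derivative
     (LBINT s:{0<..}. 1 / ((w + of_real s) * of_real (1 + s\<^sup>2)))) (at w)"
  proof (rule halfline_integral_has_field_derivative[OF e(1) _ _ e(3)])
    show "continuous_on {0<..} (\<lambda>r. Ln (z + of_real r) / of_real (1 + r\<^sup>2))" if "z \<in> ball w e" for z
      using e(2) that by (intro continuous_on_log_integrand) auto
    show "((\<lambda>a. Ln (a + of_real r) / of_real (1 + r\<^sup>2)) has_field_derivative 1 / ((z + of_real r) * of_real (1 + r\<^sup>2))) (at z)"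
      if "0 < r" "z \<in> ball w e" for r z
    proof -
      have "z \<notin> \<real>\<^sub>\<le>\<^sub>0" using that e(2) by auto
      then have "z + of_real r \<notin> \<real>\<^sub>\<le>\<^sub>0" using that by (intro not_nonpos_add_pos) auto
      then show ?thesis by (auto intro!: derivative_eq_intros simp: divide_simps)
    qed
    show "set_integrable lborel {0<..} (\<lambda>s. C * ((sqrt s + 1 / sqrt s) / (1 + s\<^sup>2)))"
      using log_weight_integrable by (rule set_integrable_mult_right)
  qed
  then show ?thesis unfolding log_integral_def[abs_def] .
qed

lemma log_integral_holomorphic: "log_integral holomorphic_on - \<real>\<^sub>\<le>\<^sub>0"
  using log_integral_has_field_derivative
  by (intro holomorphic_onI) (auto simp: field_differentiable_def intro: has_field_derivative_at_within)

lemma log_integral_cnj: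
  assumes "w \<notin> \<real>\<^sub>\<le>\<^sub>0" shows "log_integral (cnj w) = cnj (log_integral w)"
proof -
  have "(LBINT s:{0<..}. Ln (cnj w + of_real s) / of_real (1 + s\<^sup>2)) = (LBINT s:{0<..}. cnj (Ln (w + of_real s) / of_real (1 + s\<^sup>2)))"
  proof (rule set_lebesgue_integral_cong)
    show "\<forall>s. s \<in> {0<..} \<longrightarrow> Ln (cnj w + of_real s) / of_real (1 + s\<^sup>2) = cnj (Ln (w + of_real s) / of_real (1 + s\<^sup>2))"
      using cnj_Ln[OF not_nonpos_add_pos[OF assms]] by (simp add: less_imp_le)
  qed auto
  also have "\<dots> = cnj (LBINT s:{0<..}. Ln (w + of_real s) / of_real (1 + s\<^sup>2))"
  proof -
    have "(LBINT s. indicat_real {0<..} s *\<^sub>R cnj (Ln (w + of_real s) / of_real (1 + s\<^sup>2)))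
        = (LBINT s. cnj (indicat_real {0<..} s *\<^sub>R (Ln (w + of_real s) / of_real (1 + s\<^sup>2))))"
      by simp
    also have "\<dots> = cnj (LBINT s. indicat_real {0<..} s *\<^sub>R (Ln (w + of_real s) / of_real (1 + s\<^sup>2)))"
      by (rule Bochner_Integration.integral_cnj)
    finally show ?thesis unfolding set_lebesgue_integral_def .
  qed
  finally show ?thesis by (simp add: log_integral_def)
qed

lemma log_integral_of_real:
  assumes t: "t > 0"
  shows "log_integral (of_real t) = of_real (LBINT s:{0<..}. ln (t + s) / (1 + s\<^sup>2))"
proof -
  have "(LBINT s:{0<..}. Ln (of_real t + of_real s) / of_real (1 + s\<^sup>2)) = (LBINT s:{0<..}. complex_of_real (ln (t + s) / (1 + s\<^sup>2)))"
    by (rule set_lebesgue_integral_cong) (use t in \<open>auto simp flip: of_real_add simp: Ln_of_real\<close>)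
  then show ?thesis unfolding log_integral_def by (simp only: set_integral_complex_of_real)
qed

lemma Re_log_integral:
  assumes "w \<notin> \<real>\<^sub>\<le>\<^sub>0" shows "Re (log_integral w) = (LBINT s:{0<..}. ln (norm (w + of_real s)) / (1 + s\<^sup>2))"
    and "set_integrable lborel {0<..} (\<lambda>s. ln (norm (w + of_real s)) / (1 + s\<^sup>2))"
proof -
  note i = log_integrand_integrable[OF assms, unfolded set_integrable_def]
  have e: "indicat_real {0<..} s *\<^sub>R (ln (norm (w + of_real s)) / (1 + s\<^sup>2)) = Re (indicat_real {0<..} s *\<^sub>R (Ln (w + of_real s) / of_real (1 + s\<^sup>2)))" for s
  proof (cases "s > 0")
    case True
    then have "w + of_real s \<noteq> 0" using not_nonpos_add_pos[OF assms, of s] by (auto simp: less_imp_le)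
    then show ?thesis using True by (simp add: Re_divide_of_real del: of_real_add of_real_power)
  qed simp
  show "Re (log_integral w) = (LBINT s:{0<..}. ln (norm (w + of_real s)) / (1 + s\<^sup>2))"
    unfolding log_integral_def set_lebesgue_integral_def e using integral_Re[OF i] by simp
  show "set_integrable lborel {0<..} (\<lambda>s. ln (norm (w + of_real s)) / (1 + s\<^sup>2))"
    unfolding set_integrable_def e by (rule integrable_Re[OF i])
qed

text \<open>The case \<open>\<tau> = 1\<close> is excluded by the partial fraction decomposition.\<close>

lemma integral_inverse_quadratics:
  assumes \<tau>: "\<tau> > 0" "\<tau> \<noteq> 1"
  shows "(LBINT s:{0<..}. 1 / ((s\<^sup>2 + \<tau>\<^sup>2) * (1 + s\<^sup>2))) = pi / (2 * \<tau> * (1 + \<tau>))"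
proof -
  have t2: "1 - \<tau>\<^sup>2 \<noteq> 0" using \<tau> by (simp add: power2_eq_1_iff)
  define F where "F s = (arctan (s / \<tau>) / \<tau> - arctan s) / (1 - \<tau>\<^sup>2)" for s
  have "(LBINT s:{0<..}. 1 / ((s\<^sup>2 + \<tau>\<^sup>2) * (1 + s\<^sup>2))) = (pi/2 / \<tau> - pi/2) / (1 - \<tau>\<^sup>2) - (arctan (0/\<tau>) / \<tau> - arctan 0) / (1 - \<tau>\<^sup>2)"
  proof (rule halfline_FTC_nonneg)
    show "(F has_real_derivative 1 / ((s\<^sup>2 + \<tau>\<^sup>2) * (1 + s\<^sup>2))) (at s)" for s
    proof -
      have p: "s\<^sup>2 + \<tau>\<^sup>2 > 0" "1 + s\<^sup>2 > 0" using \<tau> by (auto simp: add_nonneg_pos add_pos_nonneg)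
      have "(F has_real_derivative (1 / \<tau> / (1 + (s/\<tau>)\<^sup>2) / \<tau> - 1 / (1 + s\<^sup>2)) / (1 - \<tau>\<^sup>2)) (at s)"
      proof -
        have "((\<lambda>s. arctan (s / \<tau>)) has_real_derivative 1 / \<tau> / (1 + (s/\<tau>)\<^sup>2)) (at s)"
          using \<tau>(1) by (auto intro!: derivative_eq_intros simp: divide_inverse)
        moreover have "(arctan has_real_derivative 1 / (1 + s\<^sup>2)) (at s)"
          by (rule derivative_eq_intros refl)+ (simp add: divide_inverse)
        ultimately show ?thesis unfolding F_def by (intro DERIV_cdivide DERIV_diff)
      qed
      moreover have "1 / \<tau> / (1 + (s/\<tau>)\<^sup>2) / \<tau> = 1 / (s\<^sup>2 + \<tau>\<^sup>2)"
      proof -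
        have "\<tau> * (1 + (s/\<tau>)\<^sup>2) * \<tau> = s\<^sup>2 + \<tau>\<^sup>2" using \<tau> by (simp add: field_simps power2_eq_square)
        then show ?thesis by (simp add: divide_divide_eq_left)
      qed
      moreover have "(1 / (s\<^sup>2 + \<tau>\<^sup>2) - 1 / (1 + s\<^sup>2)) / (1 - \<tau>\<^sup>2) = 1 / ((s\<^sup>2 + \<tau>\<^sup>2) * (1 + s\<^sup>2))"
      proof -
        have "1 / (s\<^sup>2 + \<tau>\<^sup>2) - 1 / (1 + s\<^sup>2) = (1 - \<tau>\<^sup>2) / ((s\<^sup>2 + \<tau>\<^sup>2) * (1 + s\<^sup>2))"
          using p by (subst diff_frac_eq) auto
        moreover have "(d / A) / d = 1 / A" if "d \<noteq> 0" for d A :: real using that by simp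
        ultimately show ?thesis using t2 by (simp only:)
      qed
      ultimately show ?thesis by simp
    qed
    show "(F \<longlongrightarrow> (arctan (0/\<tau>) / \<tau> - arctan 0) / (1 - \<tau>\<^sup>2)) (at_right 0)"
      unfolding F_def using \<tau> t2 by (intro tendsto_intros) auto
    have "filterlim (\<lambda>s. s / \<tau>) at_top at_top" using \<tau>(1) by real_asymp
    then have l: "((\<lambda>s. arctan (s / \<tau>)) \<longlongrightarrow> pi/2) at_top"
      by (rule filterlim_compose[OF tendsto_arctan_at_top])
    show "(F \<longlongrightarrow> (pi/2 / \<tau> - pi/2) / (1 - \<tau>\<^sup>2)) at_top"
      unfolding F_def using \<tau> t2 by (intro tendsto_intros l tendsto_arctan_at_top) auto
  qed (use \<tau> in \<open>auto intro!: continuous_intros simp: add_nonneg_eq_0_iff\<close>)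
  also have "\<dots> = pi / (2 * \<tau> * (1 + \<tau>))"
  proof -
    have "1 - \<tau>\<^sup>2 = (1 - \<tau>) * (1 + \<tau>)" by (simp add: power2_eq_square algebra_simps)
    moreover have "pi/2 / \<tau> - pi/2 = pi * (1 - \<tau>) / (2 * \<tau>)" using \<tau> by (simp add: field_simps)
    ultimately show ?thesis using \<tau> by simp
  qed
  finally show ?thesis .
qed

text \<open>The reflection identity behind the Wiener-Hopf factorization. The derivatives of both sides agree on
  \<open>- \<i> \<tau>\<close>, \<open>\<tau> > 1\<close>, by an elementary integral, hence in the whole half-plane. The constant of integration is
  zero since the difference of the two sides at \<open>- \<i> \<tau>\<close> is the integral of
  \<open>ln ((s\<^sup>2 + \<tau>\<^sup>2) / (1 + \<tau>)\<^sup>2) / (1 + s\<^sup>2)\<close>, which tends to zero for \<open>\<tau> \<rightarrow> \<infinity>\<close>.\<close>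

lemma log_integral_reflection:
  assumes "Im w < 0"
  shows "log_integral w + log_integral (- w) = of_real pi * Ln (1 + \<i> * w)"
proof -
  let ?L = "{w::complex. Im w < 0}"
  define E where "E w = log_integral w + log_integral (- w) - of_real pi * Ln (1 + \<i> * w)" for w
  define D where "D w = (LBINT s:{0<..}. 1 / ((w + of_real s) * of_real (1 + s\<^sup>2)))
     - (LBINT s:{0<..}. 1 / ((- w + of_real s) * of_real (1 + s\<^sup>2))) - of_real pi * \<i> / (1 + \<i> * w)" for w
  have L: "open ?L" "convex ?L" by (auto simp: open_halfspace_Im_lt convex_halfspace_Im_lt)
  have conn: "connected ?L" using L(2) by (rule convex_connected)
  have np: "w \<notin> \<real>\<^sub>\<le>\<^sub>0" "- w \<notin> \<real>\<^sub>\<le>\<^sub>0" "1 + \<i> * w \<notin> \<real>\<^sub>\<le>\<^sub>0" if "w \<in> ?L" for w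
    using that by (auto simp: complex_nonpos_Reals_iff)
  have ED: "(E has_field_derivative D w) (at w)" if "w \<in> ?L" for w
  proof -
    have 1: "((\<lambda>w. log_integral (- w)) has_field_derivative (LBINT s:{0<..}. 1 / ((- w + of_real s) * of_real (1 + s\<^sup>2))) * (-1)) (at w)"
      by (rule DERIV_chain2[where f=log_integral and g=uminus, OF log_integral_has_field_derivative[OF np(2)[OF that]]]) (auto intro!: derivative_eq_intros)
    have 2: "((\<lambda>w. of_real pi * Ln (1 + \<i> * w)) has_field_derivative of_real pi * \<i> / (1 + \<i> * w)) (at w)"
      using np(3)[OF that] by (auto intro!: derivative_eq_intros simp: divide_inverse mult_ac)
    show ?thesis unfolding E_def[abs_def] D_def
      using DERIV_diff[OF DERIV_add[OF log_integral_has_field_derivative[OF np(1)[OF that]] 1] 2] by simp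
  qed
  have Ehol: "E holomorphic_on ?L"
    using ED by (intro holomorphic_onI) (auto simp: field_differentiable_def intro: has_field_derivative_at_within)
  have dE: "deriv E w = D w" if "w \<in> ?L" for w using ED[OF that] by (rule DERIV_imp_deriv)
  have Daxis: "D (- \<i> * of_real \<tau>) = 0" if \<tau>: "\<tau> > 1" for \<tau>
  proof -
    let ?w = "- \<i> * complex_of_real \<tau>"
    have wL: "?w \<in> ?L" using \<tau> by simp
    have bnd: "set_integrable lborel {0<..} (\<lambda>s. 1 / ((v + of_real s) * of_real (1 + s\<^sup>2)))" if v: "v = \<i> * of_real \<tau> \<or> v = - \<i> * of_real \<tau>" for v
    proof (rule set_integrable_halfline_bound[OF _ _ set_integrable_mult_right[OF inverse_square_weight_integrable, of "1/\<tau>"]])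
      have nz: "v + of_real s \<noteq> 0" for s using v \<tau> by (auto simp: complex_eq_iff)
      then show "continuous_on {0<..} (\<lambda>s. 1 / ((v + of_real s) * of_real (1 + s\<^sup>2)))"
        by (auto intro!: continuous_intros)
      fix s :: real assume "s > 0"
      have "\<tau> \<le> norm (v + of_real s)" using v abs_Im_le_cmod[of "v + of_real s"] \<tau> by auto
      then have "1 / (norm (v + of_real s) * (1 + s\<^sup>2)) \<le> 1 / (\<tau> * (1 + s\<^sup>2))"
        using \<tau> by (intro divide_left_mono mult_right_mono mult_pos_pos) (auto simp: add_pos_nonneg)
      then show "norm (1 / ((v + of_real s) * of_real (1 + s\<^sup>2))) \<le> 1/\<tau> * (1 / (1 + s\<^sup>2))"
        by (simp add: norm_divide norm_mult del: of_real_add of_real_power)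
    qed
    have "(LBINT s:{0<..}. 1 / ((?w + of_real s) * of_real (1 + s\<^sup>2))) - (LBINT s:{0<..}. 1 / ((- ?w + of_real s) * of_real (1 + s\<^sup>2)))
       = (LBINT s:{0<..}. 1 / ((?w + of_real s) * of_real (1 + s\<^sup>2)) - 1 / ((- ?w + of_real s) * of_real (1 + s\<^sup>2)))"
      by (rule set_integral_diff(2)[symmetric]; rule bnd) auto
    also have "\<dots> = (LBINT s:{0<..}. 2 * \<i> * of_real \<tau> * complex_of_real (1 / ((s\<^sup>2 + \<tau>\<^sup>2) * (1 + s\<^sup>2))))"
    proof (rule set_lebesgue_integral_cong, simp, intro allI impI)
      fix s :: real assume "s \<in> {0<..}"
      have nz: "?w + of_real s \<noteq> 0" "- ?w + of_real s \<noteq> 0" using \<tau> by (auto simp: complex_eq_iff)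
      have pr: "(?w + of_real s) * (- ?w + of_real s) = complex_of_real (s\<^sup>2 + \<tau>\<^sup>2)"
        by (simp add: algebra_simps power2_eq_square)
      have "1 / (?w + of_real s) - 1 / (- ?w + of_real s) = ((- ?w + of_real s) - (?w + of_real s)) / ((?w + of_real s) * (- ?w + of_real s))"
        by (simp only: diff_frac_eq[OF nz] mult_1_left)
      also have "\<dots> = 2 * \<i> * of_real \<tau> / complex_of_real (s\<^sup>2 + \<tau>\<^sup>2)" unfolding pr by simp
      finally have *: "1 / (?w + of_real s) - 1 / (- ?w + of_real s) = 2 * \<i> * of_real \<tau> / complex_of_real (s\<^sup>2 + \<tau>\<^sup>2)" .
      have "1 / ((?w + of_real s) * of_real (1 + s\<^sup>2)) - 1 / ((- ?w + of_real s) * of_real (1 + s\<^sup>2))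
        = (1 / (?w + of_real s) - 1 / (- ?w + of_real s)) / of_real (1 + s\<^sup>2)"
        by (simp only: diff_divide_distrib divide_divide_eq_left)
      also have "\<dots> = 2 * \<i> * of_real \<tau> * complex_of_real (1 / ((s\<^sup>2 + \<tau>\<^sup>2) * (1 + s\<^sup>2)))"
        unfolding * by simp
      finally show "1 / ((?w + of_real s) * of_real (1 + s\<^sup>2)) - 1 / ((- ?w + of_real s) * of_real (1 + s\<^sup>2)) = 2 * \<i> * of_real \<tau> * complex_of_real (1 / ((s\<^sup>2 + \<tau>\<^sup>2) * (1 + s\<^sup>2)))" .
    qed
    also have "\<dots> = 2 * \<i> * of_real \<tau> * of_real (pi / (2 * \<tau> * (1 + \<tau>)))"
      using integral_inverse_quadratics[of \<tau>] \<tau> by (simp only: set_integral_mult_right set_integral_complex_of_real)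
    also have "\<dots> = \<i> * of_real pi / (1 + of_real \<tau>)"
    proof -
      have "2 * \<tau> * (pi / (2 * \<tau> * (1 + \<tau>))) = pi / (1 + \<tau>)" using \<tau> by simp
      then have "\<i> * of_real (2 * \<tau> * (pi / (2 * \<tau> * (1 + \<tau>)))) = \<i> * complex_of_real (pi / (1 + \<tau>))" by (simp only:)
      then show ?thesis by (simp only: of_real_mult of_real_divide of_real_add of_real_1 of_real_numeral mult.assoc mult.left_commute times_divide_eq_right)
    qed
    finally show ?thesis unfolding D_def by (simp add: mult_ac)
  qed
  have D0: "D w = 0" if w: "w \<in> ?L" for w
  proof -
    let ?U = "{- \<i> * of_real \<tau> |\<tau>. \<tau> > 1}"
    have "deriv E w = 0"
    proof (rule analytic_continuation[OF holomorphic_deriv[OF Ehol L(1)] L(1) conn, of ?U "- 2 * \<i>"])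
      show "?U \<subseteq> ?L" by auto
      show "- 2 * \<i> islimpt ?U"
      proof (rule islimptI)
        fix T assume T: "- 2 * \<i> \<in> T" "open T"
        then obtain e where e: "e > 0" "ball (- 2 * \<i>) e \<subseteq> T" by (auto simp: open_contains_ball)
        define y where "y = - \<i> * of_real (2 + e/2)"
        have "dist (- 2 * \<i>) y = e/2" using e by (simp add: y_def dist_norm algebra_simps norm_mult)
        then have "y \<in> T" "y \<noteq> - 2 * \<i>" using e by auto
        moreover have "y \<in> ?U" using e by (auto simp: y_def intro!: exI[of _ "2 + e/2"])
        ultimately show "\<exists>y\<in>?U. y \<in> T \<and> y \<noteq> - 2 * \<i>" by blast
      qed
      show "deriv E z = 0" if zU: "z \<in> ?U" for z
      proof -
        obtain \<tau> where "z = - \<i> * of_real \<tau>" "\<tau> > 1" using zU by blast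
        then show ?thesis using Daxis[of \<tau>] dE[of z] by simp
      qed
    qed (use w in auto)
    then show ?thesis using dE w by simp
  qed
  obtain c where c: "\<And>w. w \<in> ?L \<Longrightarrow> E w = c"
    using has_field_derivative_zero_constant[OF L(2), of E] ED D0 by (metis has_field_derivative_at_within)
  have "(\<lambda>n. E (- \<i> * of_real (real n + 1))) \<longlonglongrightarrow> 0"
  proof -
    \<comment> \<open>At \<open>- \<i> \<tau>\<close> the two logarithms are conjugate, and their sum is \<open>ln (s\<^sup>2 + \<tau>\<^sup>2)\<close>.\<close>
    define q where "q n s = (ln (s\<^sup>2 + (real n + 1)\<^sup>2) - 2 * ln (1 + (real n + 1))) / (1 + s\<^sup>2)" for n s
    have Eq: "E (- \<i> * of_real (real n + 1)) = of_real (LBINT s:{0<..}. q n s)" for n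
    proof -
      define \<tau> where "\<tau> = real n + 1"
      have \<tau>: "\<tau> > 0" by (simp add: \<tau>_def)
      let ?w = "- \<i> * complex_of_real \<tau>"
      have np: "?w \<notin> \<real>\<^sub>\<le>\<^sub>0" "- ?w = cnj ?w" using \<tau> by (auto simp: complex_nonpos_Reals_iff)
      have "log_integral ?w + log_integral (- ?w) = of_real (2 * Re (log_integral ?w))"
        unfolding np(2) log_integral_cnj[OF np(1)] by (rule complex_add_cnj)
      also have "2 * Re (log_integral ?w) = (LBINT s:{0<..}. 2 * (ln (norm (?w + of_real s)) / (1 + s\<^sup>2)))"
        unfolding Re_log_integral(1)[OF np(1)] by (simp only: set_integral_mult_right)
      also have "(LBINT s:{0<..}. 2 * (ln (norm (?w + of_real s)) / (1 + s\<^sup>2))) = (LBINT s:{0<..}. q n s + 2 * ln (1 + \<tau>) * (1 / (1 + s\<^sup>2)))"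
      proof (rule set_lebesgue_integral_cong, simp, intro allI impI)
        fix s :: real assume "s \<in> {0<..}"
        have p: "s\<^sup>2 + \<tau>\<^sup>2 > 0" using \<tau> by (simp add: add_nonneg_pos)
        have "norm (?w + of_real s) = sqrt (s\<^sup>2 + \<tau>\<^sup>2)" by (simp add: cmod_def)
        then have "2 * ln (norm (?w + of_real s)) = ln (s\<^sup>2 + \<tau>\<^sup>2)" using p by (simp add: ln_sqrt)
        then have "2 * (ln (norm (?w + of_real s)) / (1 + s\<^sup>2)) = ln (s\<^sup>2 + \<tau>\<^sup>2) / (1 + s\<^sup>2)" by simp
        then show "2 * (ln (norm (?w + of_real s)) / (1 + s\<^sup>2)) = q n s + 2 * ln (1 + \<tau>) * (1 / (1 + s\<^sup>2))"
          by (simp add: q_def \<tau>_def diff_divide_distrib)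
      qed
      also have "\<dots> = (LBINT s:{0<..}. q n s) + 2 * ln (1 + \<tau>) * (pi/2)"
      proof -
        have i2: "set_integrable lborel {0<..} (\<lambda>s::real. 2 * ln (1 + \<tau>) * (1 / (1 + s\<^sup>2)))"
          by (rule set_integrable_mult_right[OF inverse_square_weight_integrable])
        have "set_integrable lborel {0<..} (q n)"
        proof -
          have "set_integrable lborel {0<..} (\<lambda>s. 2 * (ln (norm (?w + of_real s)) / (1 + s\<^sup>2)) - 2 * ln (1 + \<tau>) * (1 / (1 + s\<^sup>2)))"
            by (intro set_integral_diff set_integrable_mult_right i2 Re_log_integral(2)[OF np(1)])
          moreover have "2 * (ln (norm (?w + of_real s)) / (1 + s\<^sup>2)) - 2 * ln (1 + \<tau>) * (1 / (1 + s\<^sup>2)) = q n s" for s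
          proof -
            have p: "s\<^sup>2 + \<tau>\<^sup>2 > 0" using \<tau> by (simp add: add_nonneg_pos)
            have "norm (?w + of_real s) = sqrt (s\<^sup>2 + \<tau>\<^sup>2)" by (simp add: cmod_def)
            then have "2 * ln (norm (?w + of_real s)) = ln (s\<^sup>2 + \<tau>\<^sup>2)" using p by (simp add: ln_sqrt)
            then have "2 * (ln (norm (?w + of_real s)) / (1 + s\<^sup>2)) = ln (s\<^sup>2 + \<tau>\<^sup>2) / (1 + s\<^sup>2)" by simp
            then show ?thesis by (simp add: q_def \<tau>_def diff_divide_distrib)
          qed
          ultimately show ?thesis by simp
        qed
        from set_integral_add(2)[OF this i2] show ?thesis
          by (simp only: set_integral_mult_right inverse_square_weight_integral)
      qed
      finally have "log_integral ?w + log_integral (- ?w) = of_real ((LBINT s:{0<..}. q n s) + 2 * ln (1 + \<tau>) * (pi/2))" .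
      moreover have "Ln (1 + \<i> * ?w) = of_real (ln (1 + \<tau>))"
      proof -
        have "1 + \<i> * ?w = of_real (1 + \<tau>)" by simp
        then show ?thesis using \<tau> by (simp only: Ln_of_real)
      qed
      ultimately show ?thesis unfolding E_def \<tau>_def[symmetric] by simp
    qed
    have "(\<lambda>n. LBINT s:{0<..}. q n s) \<longlonglongrightarrow> set_lebesgue_integral lborel {0<..} (\<lambda>s::real. 0 :: real)"
    proof (rule halfline_dominated_convergence[where m="\<lambda>s. 8 * ((sqrt s + 1 / sqrt s) / (1 + s\<^sup>2))"])
      show "set_integrable lborel {0<..} (\<lambda>s::real. 8 * ((sqrt s + 1 / sqrt s) / (1 + s\<^sup>2)))"
        by (rule set_integrable_mult_right[OF log_weight_integrable])
    next
      fix n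
      show "continuous_on {0<..} (q n)" unfolding q_def
        by (intro continuous_intros) (auto simp: add_nonneg_eq_0_iff sum_power2_eq_zero_iff)
    next
      fix n and s :: real assume s: "s > 0"
      define \<tau> where "\<tau> = real n + 1"
      have \<tau>: "\<tau> \<ge> 1" by (simp add: \<tau>_def)
      define P where "P = sqrt s + 1 / sqrt s"
      have P: "P \<ge> 1" "ln (1 + s) \<le> 2 * P" using one_le_log_weight[OF s] ln_one_plus_le_log_weight[OF s] by (auto simp: P_def)
      have "s\<^sup>2 + \<tau>\<^sup>2 \<le> ((1 + s) * (1 + \<tau>))\<^sup>2" using s \<tau> by (simp add: power2_eq_square algebra_simps)
      then have "ln (s\<^sup>2 + \<tau>\<^sup>2) \<le> ln (((1 + s) * (1 + \<tau>))\<^sup>2)" using \<tau> s by (intro ln_mono) (auto simp: add_pos_pos)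
      also have "\<dots> = 2 * (ln (1 + s) + ln (1 + \<tau>))" using s \<tau> by (simp add: ln_realpow ln_mult)
      finally have 1: "ln (s\<^sup>2 + \<tau>\<^sup>2) - 2 * ln (1 + \<tau>) \<le> 4 * P" using P by simp
      have e2: "2 * ln (1 + \<tau>) = ln ((1 + \<tau>)\<^sup>2)" using \<tau> by (simp add: ln_realpow)
      have "(1 + \<tau>)\<^sup>2 \<le> (2 * \<tau>)\<^sup>2" using \<tau> by (intro power_mono) auto
      also have "(2 * \<tau>)\<^sup>2 = 4 * \<tau>\<^sup>2" by (simp add: power_mult_distrib)
      also have "\<dots> \<le> 4 * (s\<^sup>2 + \<tau>\<^sup>2)" by simp
      finally have "(1 + \<tau>)\<^sup>2 \<le> 4 * (s\<^sup>2 + \<tau>\<^sup>2)" .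
      then have "ln ((1 + \<tau>)\<^sup>2) \<le> ln (4 * (s\<^sup>2 + \<tau>\<^sup>2))" using \<tau> by (intro ln_mono) auto
      also have "ln (4 * (s\<^sup>2 + \<tau>\<^sup>2)) = ln 4 + ln (s\<^sup>2 + \<tau>\<^sup>2)" using \<tau> s by (intro ln_mult_pos) (auto simp: add_pos_pos)
      also have "ln 4 \<le> (3::real)" using ln_le_minus_one[of "4::real"] by simp
      finally have "ln ((1 + \<tau>)\<^sup>2) \<le> 3 + ln (s\<^sup>2 + \<tau>\<^sup>2)" by simp
      then have "\<bar>ln (s\<^sup>2 + \<tau>\<^sup>2) - 2 * ln (1 + \<tau>)\<bar> \<le> 8 * P" using 1 P e2 by linarith
      then have "\<bar>ln (s\<^sup>2 + \<tau>\<^sup>2) - 2 * ln (1 + \<tau>)\<bar> / (1 + s\<^sup>2) \<le> 8 * P / (1 + s\<^sup>2)" by (intro divide_right_mono) auto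
      then show "norm (q n s) \<le> 8 * ((sqrt s + 1 / sqrt s) / (1 + s\<^sup>2))"
        by (simp add: q_def P_def \<tau>_def)
      have "(\<lambda>n. ln (c + (real n + 1)\<^sup>2) - 2 * ln (1 + (real n + 1))) \<longlonglongrightarrow> 0" for c :: real by real_asymp
      from tendsto_divide_zero[OF this] show "(\<lambda>n. q n s) \<longlonglongrightarrow> 0" unfolding q_def .
    qed
    from tendsto_of_real[OF this] show ?thesis unfolding Eq by simp
  qed
  moreover have "E (- \<i> * of_real (real n + 1)) = c" for n by (rule c) simp
  ultimately have "c = 0" by (simp add: LIMSEQ_const_iff)
  then show ?thesis using c[of w] assms by (simp add: E_def)
qed

text \<open>The real part comes from the reflection identity at \<open>w = - \<i>\<close>, where the two summands are conjugate. The
  imaginary part is the integral of \<open>(arctan s - \<pi>/2) / (1 + s\<^sup>2)\<close>. This value is the origin of the phase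
  \<open>\<pi>/8\<close>.\<close>

lemma log_integral_minus_i:
  "log_integral (- \<i>) = of_real (pi / 2 * ln 2) - \<i> * of_real (pi\<^sup>2 / 8)"
proof -
  have np: "- \<i> \<notin> \<real>\<^sub>\<le>\<^sub>0" by (simp add: complex_nonpos_Reals_iff)
  have neg: "Im (- \<i>) < 0" by simp
  have two: "1 + \<i> * (- \<i>) = of_real 2" by simp
  have ln2: "Ln (of_real 2) = of_real (ln 2)" by (rule Ln_of_real) simp
  have ci: "- (- \<i>) = cnj (- \<i>)" by simp
  have "log_integral (- \<i>) + cnj (log_integral (- \<i>)) = of_real pi * of_real (ln 2)"
    using log_integral_reflection[OF neg] unfolding ci log_integral_cnj[OF np] two ln2 .
  then have "of_real (2 * Re (log_integral (- \<i>))) = complex_of_real (pi * ln 2)"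
    unfolding complex_add_cnj of_real_mult[of pi "ln 2"] .
  then have "2 * Re (log_integral (- \<i>)) = pi * ln 2" by (simp only: of_real_eq_iff)
  then have re: "Re (log_integral (- \<i>)) = pi / 2 * ln 2" by linarith
  define g where "g s = (pi/2 - arctan s) / (1 + s\<^sup>2)" for s
  have L: "Im (Ln (- \<i> + of_real s)) = arctan s - pi/2" if "s > 0" for s
  proof -
    have p: "1 + s\<^sup>2 > 0" by (simp add: add_pos_nonneg)
    have "Ln (- \<i> + of_real s) = Complex (ln (sqrt (1 + s\<^sup>2))) (arctan s - pi/2)"
    proof (rule Ln_unique)
      have "exp (Complex (ln (sqrt (1 + s\<^sup>2))) (arctan s - pi/2)) = of_real (sqrt (1 + s\<^sup>2)) * cis (arctan s - pi/2)"
        using p by (simp add: exp_eq_polar)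
      also have "\<dots> = - \<i> + of_real s"
        using p by (auto simp: complex_eq_iff cos_diff sin_diff cos_arctan sin_arctan)
      finally show "exp (Complex (ln (sqrt (1 + s\<^sup>2))) (arctan s - pi/2)) = - \<i> + of_real s" .
    qed (use arctan_lbound[of s] arctan_ubound[of s] that zero_less_arctan_iff[of s] in auto)
    then show ?thesis by simp
  qed
  have L': "Im (Ln (of_real s - \<i>)) = arctan s - pi/2" if "s > 0" for s
    using L[OF that] by simp
  have "(LBINT s:{0<..}. g s) = 0 - - (pi/2 - arctan 0)\<^sup>2 / 2"
  proof (rule halfline_FTC_nonneg)
    show "((\<lambda>s. - (pi/2 - arctan s)\<^sup>2 / 2) has_real_derivative g s) (at s)" for s
    proof -
      have A: "(arctan has_real_derivative 1 / (1 + s\<^sup>2)) (at s)"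
        using DERIV_arctan[of s] by (simp add: inverse_eq_divide)
      have D: "((\<lambda>s. pi/2 - arctan s) has_real_derivative 0 - 1 / (1 + s\<^sup>2)) (at s)"
        by (rule DERIV_diff[OF DERIV_const A])
      have nz: "1 + s\<^sup>2 \<noteq> 0" "2 + s\<^sup>2 * 2 \<noteq> 0" "2 + 2 * s\<^sup>2 \<noteq> 0" by (auto simp: add_nonneg_eq_0_iff)
      from DERIV_cdivide[OF DERIV_minus[OF DERIV_power[OF D, of 2]], of 2]
      show ?thesis by (rule DERIV_cong) (simp add: g_def, simp add: nz frac_eq_eq algebra_simps)
    qed
    show "continuous_on {0<..} g" unfolding g_def by (auto intro!: continuous_intros simp: add_nonneg_eq_0_iff)
    show "0 \<le> g s" for s unfolding g_def using arctan_ubound[of s] by (intro divide_nonneg_nonneg) auto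
    show "((\<lambda>s. - (pi / 2 - arctan s)\<^sup>2 / 2) \<longlongrightarrow> - (pi / 2 - arctan 0)\<^sup>2 / 2) (at_right 0)"
      by (intro tendsto_intros) auto
    have "((\<lambda>s. - (pi / 2 - arctan s)\<^sup>2 / 2) \<longlongrightarrow> - (pi / 2 - pi/2)\<^sup>2 / 2) at_top"
      by (intro tendsto_intros tendsto_arctan_at_top) auto
    then show "((\<lambda>s. - (pi / 2 - arctan s)\<^sup>2 / 2) \<longlongrightarrow> 0) at_top" by simp
  qed
  then have gI: "(LBINT s:{0<..}. g s) = pi\<^sup>2 / 8" by (simp add: power_divide)
  have "Im (log_integral (- \<i>)) = (LBINT s. Im (indicat_real {0<..} s *\<^sub>R (Ln (- \<i> + of_real s) / of_real (1 + s\<^sup>2))))"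
    unfolding log_integral_def set_lebesgue_integral_def
    by (rule integral_Im[OF log_integrand_integrable[OF np, unfolded set_integrable_def], symmetric])
  also have "\<dots> = (LBINT s:{0<..}. - g s)" unfolding set_lebesgue_integral_def
  proof (rule Bochner_Integration.integral_cong)
    fix s :: real
    have "- g s = (arctan s - pi/2) / (1 + s\<^sup>2)" unfolding g_def minus_divide_left by simp
    then show "Im (indicat_real {0<..} s *\<^sub>R (Ln (- \<i> + of_real s) / of_real (1 + s\<^sup>2))) = indicat_real {0<..} s *\<^sub>R - g s"
      by (cases "s > 0") (simp_all add: Im_divide_of_real L' del: of_real_add of_real_power)
  qed simp
  also have "\<dots> = - (LBINT s:{0<..}. g s)" unfolding set_lebesgue_integral_def by simp
  finally have im: "Im (log_integral (- \<i>)) = - (pi\<^sup>2 / 8)" using gI by simp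
  show ?thesis using re im by (simp add: complex_eq_iff)
qed

definition wh_factor :: "complex \<Rightarrow> complex" where
  "wh_factor w = exp (- log_integral w / of_real pi)"

lemma wh_factor_nonzero [simp]: "wh_factor w \<noteq> 0" by (simp add: wh_factor_def)

lemma wh_factor_holomorphic: "wh_factor holomorphic_on - \<real>\<^sub>\<le>\<^sub>0"
  unfolding wh_factor_def[abs_def] by (intro holomorphic_intros log_integral_holomorphic) auto

lemma wh_factor_reflection:
  assumes "Im w < 0" shows "wh_factor w * wh_factor (- w) * (1 + \<i> * w) = 1"
proof -
  have nz: "1 + \<i> * w \<noteq> 0" using assms by (auto simp: complex_eq_iff)
  have "wh_factor w * wh_factor (- w) = exp (- (log_integral w + log_integral (- w)) / of_real pi)"
    unfolding wh_factor_def exp_add[symmetric] by (simp add: add_divide_distrib diff_divide_distrib)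
  also have "\<dots> = exp (- Ln (1 + \<i> * w))" unfolding log_integral_reflection[OF assms] by simp
  also have "\<dots> = 1 / (1 + \<i> * w)" using nz by (simp add: exp_minus exp_Ln inverse_eq_divide)
  finally show ?thesis using nz by simp
qed

lemma wh_factor_minus_i: "wh_factor (- \<i>) = exp (\<i> * of_real (pi / 8)) / of_real (sqrt 2)"
proof -
  have "- log_integral (- \<i>) / of_real pi = of_real (- (ln 2 / 2)) + \<i> * of_real (pi / 8)"
    by (simp add: log_integral_minus_i complex_eq_iff power2_eq_square)
  then have "wh_factor (- \<i>) = of_real (exp (- (ln 2 / 2))) * exp (\<i> * of_real (pi / 8))"
    unfolding wh_factor_def by (simp only: exp_add exp_of_real)
  also have "exp (- (ln 2 / 2)) = 1 / sqrt (2::real)"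
    by (simp add: exp_minus inverse_eq_divide ln_sqrt[symmetric])
  finally show ?thesis by simp
qed

lemma wh_factor_of_real:
  assumes "t > 0"
  shows "wh_factor (of_real t) = of_real (exp (- (1 / pi) * (LBINT s:{0<..}. ln (t + s) / (1 + s\<^sup>2))))"
proof -
  have "- log_integral (of_real t) / of_real pi = of_real (- (1 / pi) * (LBINT s:{0<..}. ln (t + s) / (1 + s\<^sup>2)))"
    by (simp add: log_integral_of_real[OF assms])
  then show ?thesis unfolding wh_factor_def by (simp only: exp_of_real)
qed

text \<open>For \<open>Re w \<ge> 0\<close> the modulus of \<open>w + s\<close> is comparable to \<open>|w| + s\<close>, whose logarithm differs from
  \<open>ln (1 + |w|)\<close> by an integrable amount.\<close>

lemma wh_factor_bounds:
  obtains C where "C \<ge> 1"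
    "\<And>w. Re w \<ge> 0 \<Longrightarrow> w \<noteq> 0 \<Longrightarrow> norm (wh_factor w) \<le> C / sqrt (1 + norm w)"
    "\<And>w. Re w \<ge> 0 \<Longrightarrow> w \<noteq> 0 \<Longrightarrow> 1 / (C * sqrt (1 + norm w)) \<le> norm (wh_factor w)"
proof -
  define J where "J = (LBINT s:{0<..}. 5 * ((sqrt s + 1 / sqrt s) / (1 + s\<^sup>2)))"
  have Ji: "set_integrable lborel {0<..} (\<lambda>s::real. 5 * ((sqrt s + 1 / sqrt s) / (1 + s\<^sup>2)))"
    by (rule set_integrable_mult_right[OF log_weight_integrable])
  have key: "\<bar>Re (log_integral w) - pi / 2 * ln (1 + norm w)\<bar> \<le> J" if w: "Re w \<ge> 0" "w \<noteq> 0" for w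
  proof -
    have np: "w \<notin> \<real>\<^sub>\<le>\<^sub>0" using w by (auto simp: complex_nonpos_Reals_iff complex_eq_iff)
    define \<rho> where "\<rho> = norm w"
    have \<rho>: "\<rho> > 0" using w by (simp add: \<rho>_def)
    define d where "d s = ln (norm (w + of_real s)) / (1 + s\<^sup>2) - ln (1 + \<rho>) * (1 / (1 + s\<^sup>2))" for s
    have i2: "set_integrable lborel {0<..} (\<lambda>s. ln (1 + \<rho>) * (1 / (1 + s\<^sup>2)))"
      by (rule set_integrable_mult_right[OF inverse_square_weight_integrable])
    have d: "(LBINT s:{0<..}. d s) = Re (log_integral w) - pi / 2 * ln (1 + \<rho>)"
      unfolding d_def using set_integral_diff(2)[OF Re_log_integral(2)[OF np] i2]
      by (simp only: Re_log_integral(1)[OF np] set_integral_mult_right inverse_square_weight_integral mult.commute)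
    have "norm (LBINT s:{0<..}. d s) \<le> J" unfolding J_def
    proof (rule halfline_integral_norm_bound[OF _ _ Ji])
      have "w + of_real s \<noteq> 0" if "s > 0" for s using w that by (auto simp: complex_eq_iff)
      then show "continuous_on {0<..} d" unfolding d_def
        by (intro continuous_intros) (auto simp: add_nonneg_eq_0_iff)
      fix s :: real assume s: "s > 0"
      define P where "P = sqrt s + 1 / sqrt s"
      have P: "P \<ge> 1" "ln (1 + s) \<le> 2 * P" "\<bar>ln s\<bar> \<le> 2 * P"
        using one_le_log_weight[OF s] ln_one_plus_le_log_weight[OF s] abs_ln_le_log_weight[OF s] by (auto simp: P_def)
      have up: "norm (w + of_real s) \<le> \<rho> + s" using norm_triangle_ineq[of w "of_real s"] s by (simp add: \<rho>_def)
      have "(\<rho> + s)\<^sup>2 \<le> 2 * (\<rho>\<^sup>2 + s\<^sup>2)" using zero_le_power2[of "\<rho> - s"] by (simp add: power2_eq_square algebra_simps)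
      also have "\<rho>\<^sup>2 + s\<^sup>2 \<le> (norm (w + of_real s))\<^sup>2"
        using w s unfolding \<rho>_def cmod_power2 by (simp add: power2_eq_square algebra_simps)
      finally have "(\<rho> + s)\<^sup>2 \<le> 2 * (norm (w + of_real s))\<^sup>2" by simp
      also have "\<dots> \<le> 4 * (norm (w + of_real s))\<^sup>2" by simp
      also have "\<dots> = (2 * norm (w + of_real s))\<^sup>2" by (simp add: power_mult_distrib)
      finally have "(\<rho> + s)\<^sup>2 \<le> (2 * norm (w + of_real s))\<^sup>2" .
      then have lo: "\<rho> + s \<le> 2 * norm (w + of_real s)" by (rule power2_le_imp_le) simp
      have "ln (norm (w + of_real s)) \<le> ln ((1 + \<rho>) * (1 + s))"
        using up lo \<rho> s by (intro ln_mono) (auto simp: algebra_simps intro: order_trans[OF up])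
      also have "\<dots> = ln (1 + \<rho>) + ln (1 + s)" using \<rho> s by (simp add: ln_mult)
      finally have 1: "ln (norm (w + of_real s)) - ln (1 + \<rho>) \<le> 5 * P" using P by linarith
      have "(1 + \<rho>) * (if s < 1 then s else 1) \<le> \<rho> + s" using \<rho> s by (auto simp: algebra_simps)
      also note lo
      finally have "ln ((1 + \<rho>) * (if s < 1 then s else 1)) \<le> ln (2 * norm (w + of_real s))"
        using \<rho> s by (intro ln_mono) auto
      also have "\<dots> = ln 2 + ln (norm (w + of_real s))" using lo \<rho> s by (intro ln_mult_pos) auto
      also have "ln ((1 + \<rho>) * (if s < 1 then s else 1)) = ln (1 + \<rho>) + ln (if s < 1 then s else 1)"
        using \<rho> s by (intro ln_mult_pos) auto
      finally have "ln (1 + \<rho>) + ln (if s < 1 then s else 1) \<le> ln 2 + ln (norm (w + of_real s))" .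
      moreover have "ln (if s < 1 then s else 1) \<ge> - \<bar>ln s\<bar>" using s by auto
      ultimately have "ln (1 + \<rho>) - ln (norm (w + of_real s)) \<le> ln 2 + \<bar>ln s\<bar>" by linarith
      then have 2: "ln (1 + \<rho>) - ln (norm (w + of_real s)) \<le> 5 * P" using P ln_le_minus_one[of "2::real"] by linarith
      have "d s = (ln (norm (w + of_real s)) - ln (1 + \<rho>)) / (1 + s\<^sup>2)" by (simp add: d_def diff_divide_distrib)
      moreover have "\<bar>ln (norm (w + of_real s)) - ln (1 + \<rho>)\<bar> / (1 + s\<^sup>2) \<le> 5 * P / (1 + s\<^sup>2)"
        using 1 2 by (intro divide_right_mono) auto
      ultimately show "norm (d s) \<le> 5 * ((sqrt s + 1 / sqrt s) / (1 + s\<^sup>2))" by (simp add: P_def)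
    qed
    then show ?thesis unfolding d by (simp add: \<rho>_def)
  qed
  have nb: "norm (wh_factor w) = exp (- Re (log_integral w) / pi)" for w
    by (simp add: wh_factor_def norm_exp_eq_Re Re_divide_of_real)
  have sq: "exp (- ln (1 + norm w) / 2) = 1 / sqrt (1 + norm (w::complex))" for w
  proof -
    have "0 < 1 + norm w" by (simp add: add_pos_nonneg)
    then have "exp (ln (1 + norm w) / 2) = sqrt (1 + norm w)" by (simp add: ln_sqrt[symmetric])
    then show ?thesis by (simp add: exp_minus inverse_eq_divide)
  qed
  have J: "J \<ge> 0" using key[of 1] by (smt (verit) one_complex.simps(1) zero_neq_one)
  show ?thesis
  proof
    show "1 \<le> exp (J / pi)" using J by simp
    fix w :: complex assume w: "Re w \<ge> 0" "w \<noteq> 0"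
    have "- Re (log_integral w) / pi \<le> (J - pi / 2 * ln (1 + norm w)) / pi"
      using key[OF w] by (intro divide_right_mono) auto
    also have "\<dots> = J / pi + - ln (1 + norm w) / 2" by (simp add: diff_divide_distrib)
    finally have "exp (- Re (log_integral w) / pi) \<le> exp (J / pi + - ln (1 + norm w) / 2)" by simp
    also have "\<dots> = exp (J / pi) / sqrt (1 + norm w)" unfolding exp_add sq by simp
    finally show "norm (wh_factor w) \<le> exp (J / pi) / sqrt (1 + norm w)" unfolding nb .
    have "(- J - pi / 2 * ln (1 + norm w)) / pi \<le> - Re (log_integral w) / pi"
      using key[OF w] by (intro divide_right_mono) auto
    moreover have "(- J - pi / 2 * ln (1 + norm w)) / pi = - (J / pi) + - ln (1 + norm w) / 2" by (simp add: diff_divide_distrib)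
    ultimately have "exp (- (J / pi) + - ln (1 + norm w) / 2) \<le> exp (- Re (log_integral w) / pi)" by simp
    moreover have "exp (- (J / pi) + - ln (1 + norm w) / 2) = 1 / (exp (J / pi) * sqrt (1 + norm w))"
      unfolding exp_add sq by (simp add: exp_minus inverse_eq_divide)
    ultimately show "1 / (exp (J / pi) * sqrt (1 + norm w)) \<le> norm (wh_factor w)" unfolding nb by (simp only:)
  qed
qed

text \<open>The continuation of the factor from the right half-plane through the lower half-plane into the left
  one. The cut is thereby moved to the positive imaginary axis; the formula on the left is forced by the
  reflection identity.\<close>

definition wh_cont :: "complex \<Rightarrow> complex" where
  "wh_cont w = (if Re w \<ge> 0 then wh_factor w else 1 / ((1 + \<i> * w) * wh_factor (- w)))"

definition up_slit :: "complex set" where "up_slit = {w. Re w \<noteq> 0 \<or> Im w < 0}"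

lemma wh_cont_lower: "Im w < 0 \<Longrightarrow> wh_cont w = wh_factor w"
proof -
  assume w: "Im w < 0"
  have nz: "1 + \<i> * w \<noteq> 0" using w by (auto simp: complex_eq_iff)
  show ?thesis using wh_factor_reflection[OF w] nz unfolding wh_cont_def
    by (simp add: divide_simps) (simp add: mult_ac)
qed

lemma one_plus_i_nonzero: "w \<in> up_slit \<Longrightarrow> 1 + \<i> * w \<noteq> 0"
  by (auto simp: up_slit_def complex_eq_iff)

lemma wh_cont_holomorphic: "wh_cont holomorphic_on up_slit"
proof -
  have o: "open {w::complex. Re w > 0}" "open {w::complex. Re w < 0}" "open {w::complex. Im w < 0}"
    by (auto simp: open_halfspace_Re_gt open_halfspace_Re_lt open_halfspace_Im_lt)
  have sub: "up_slit = ({w. Re w > 0} \<union> {w. Re w < 0}) \<union> {w. Im w < 0}" by (auto simp: up_slit_def)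
  have 1: "wh_cont holomorphic_on {w. Re w > 0}"
    by (rule holomorphic_transform[of wh_factor])
       (auto simp: wh_cont_def complex_nonpos_Reals_iff intro: holomorphic_on_subset[OF wh_factor_holomorphic])
  have 3: "wh_cont holomorphic_on {w. Im w < 0}"
    by (rule holomorphic_transform[of wh_factor])
       (auto simp: wh_cont_lower complex_nonpos_Reals_iff intro: holomorphic_on_subset[OF wh_factor_holomorphic])
  have 2: "wh_cont holomorphic_on {w. Re w < 0}"
  proof (rule holomorphic_transform)
    have "(\<lambda>w. wh_factor (- w)) holomorphic_on {w. Re w < 0}"
      by (rule holomorphic_on_compose_gen[OF _ wh_factor_holomorphic, of uminus, unfolded o_def])
         (auto intro!: holomorphic_intros simp: complex_nonpos_Reals_iff)
    then show "(\<lambda>w. 1 / ((1 + \<i> * w) * wh_factor (- w))) holomorphic_on {w. Re w < 0}"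
      by (intro holomorphic_intros) (use one_plus_i_nonzero in \<open>auto simp: up_slit_def\<close>)
  qed (auto simp: wh_cont_def)
  show ?thesis unfolding sub using 1 2 3 o by (intro holomorphic_on_Un open_Un) auto
qed

lemma norm_one_plus_i_ge:
  assumes "Im w \<le> 0" shows "1 + norm w \<le> sqrt 2 * norm (1 + \<i> * w)"
proof -
  have "(1 + norm w)\<^sup>2 \<le> 2 * (1 + (norm w)\<^sup>2)" using zero_le_power2[of "1 - norm w"] by (simp add: power2_eq_square algebra_simps)
  also have "1 + (norm w)\<^sup>2 \<le> (norm (1 + \<i> * w))\<^sup>2" using assms unfolding cmod_power2 by (simp add: power2_eq_square algebra_simps)
  finally have "(1 + norm w)\<^sup>2 \<le> (sqrt 2 * norm (1 + \<i> * w))\<^sup>2" by (simp add: power_mult_distrib)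
  then show ?thesis by (rule power2_le_imp_le) simp
qed

lemma wh_cont_bound:
  obtains C where "C \<ge> 1" "\<And>w. Im w \<le> 0 \<Longrightarrow> w \<noteq> 0 \<Longrightarrow> norm (wh_cont w) \<le> C / sqrt (1 + norm w)"
proof -
  obtain C where C: "C \<ge> 1"
    "\<And>w. Re w \<ge> 0 \<Longrightarrow> w \<noteq> 0 \<Longrightarrow> norm (wh_factor w) \<le> C / sqrt (1 + norm w)"
    "\<And>w. Re w \<ge> 0 \<Longrightarrow> w \<noteq> 0 \<Longrightarrow> 1 / (C * sqrt (1 + norm w)) \<le> norm (wh_factor w)"
    by (rule wh_factor_bounds) blast
  show ?thesis
  proof
    show "sqrt 2 * C \<ge> 1" using C(1) mult_mono[of 1 "sqrt 2" 1 C] by simp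
    fix w :: complex assume w: "Im w \<le> 0" "w \<noteq> 0"
    define q where "q = sqrt (1 + norm w)"
    have q: "q > 0" "q * q = 1 + norm w" by (auto simp: q_def add_pos_nonneg)
    show "norm (wh_cont w) \<le> sqrt 2 * C / sqrt (1 + norm w)"
    proof (cases "Re w \<ge> 0")
      case True
      have "C / q \<le> sqrt 2 * C / q" using C(1) q by (intro divide_right_mono) auto
      then show ?thesis using C(2)[OF True w(2)] True unfolding wh_cont_def q_def by simp
    next
      case False
      have b: "1 / (C * q) \<le> norm (wh_factor (- w))" using C(3)[of "- w"] False w by (simp add: q_def)
      have n: "q * q / sqrt 2 \<le> norm (1 + \<i> * w)" using norm_one_plus_i_ge[OF w(1)] q(2) by (simp add: field_simps)
      have pos: "0 < q * q / sqrt 2" "0 < 1 / (C * q)" using q(1) C(1) by auto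
      have "norm (wh_cont w) = 1 / (norm (1 + \<i> * w) * norm (wh_factor (- w)))"
        using False by (simp add: wh_cont_def norm_divide norm_mult)
      also have "\<dots> \<le> 1 / ((q * q / sqrt 2) * (1 / (C * q)))"
      proof (rule frac_le)
        show "q * q / sqrt 2 * (1 / (C * q)) \<le> norm (1 + \<i> * w) * norm (wh_factor (- w))"
          by (rule mult_mono[OF n b norm_ge_zero less_imp_le[OF pos(2)]])
        show "0 < q * q / sqrt 2 * (1 / (C * q))" by (rule mult_pos_pos[OF pos])
      qed auto
      also have "\<dots> = sqrt 2 * C / q" using q(1) C(1) by (simp add: field_simps)
      finally show ?thesis by (simp add: q_def)
    qed
  qed
qed

lemma wh_cont_of_real: "t > 0 \<Longrightarrow> wh_cont (of_real t) = wh_factor (of_real t)"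
  "t > 0 \<Longrightarrow> wh_cont (- of_real t) = 1 / ((1 - \<i> * of_real t) * wh_factor (of_real t))"
  by (auto simp: wh_cont_def)

section \<open>The explicit solution\<close>

text \<open>Its values on the positive and negative half-axis are the densities of the two Laplace integrals
  of the solution, see \<open>dock_kernel_of_real\<close>.\<close>

definition dock_kernel :: "complex \<Rightarrow> complex" where "dock_kernel w = wh_cont w / (1 - \<i> * w)"

lemma norm_one_minus_i_of_real: "1 + \<bar>t\<bar> \<le> sqrt 2 * norm (1 - \<i> * of_real t)"
  using norm_one_plus_i_ge[of "- of_real t"] by simp

lemma dock_kernel_bound:
  obtains M where "M > 0" "\<And>t. t > 0 \<Longrightarrow> norm (dock_kernel (of_real t)) \<le> M * (1 / (sqrt t * (1 + t)))"
    "\<And>t. t > 0 \<Longrightarrow> norm (dock_kernel (- of_real t)) \<le> M * (1 / (sqrt t * (1 + t)))"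
proof -
  obtain C where C: "C \<ge> 1" "\<And>w. Im w \<le> 0 \<Longrightarrow> w \<noteq> 0 \<Longrightarrow> norm (wh_cont w) \<le> C / sqrt (1 + norm w)"
    by (rule wh_cont_bound) blast
  have *: "norm (dock_kernel (of_real x)) \<le> (sqrt 2 * C) * (1 / (sqrt t * (1 + t)))" if "t > 0" "\<bar>x\<bar> = t" for x t
  proof -
    have "norm (wh_cont (of_real x)) \<le> C / sqrt (1 + t)" using C(2)[of "of_real x"] that by auto
    also have "\<dots> \<le> C / sqrt t" using that C(1) by (intro divide_left_mono mult_pos_pos) auto
    finally have a: "norm (wh_cont (of_real x)) \<le> C / sqrt t" .
    have b: "(1 + t) / sqrt 2 \<le> norm (1 - \<i> * of_real x)"
      using norm_one_minus_i_of_real[of x] that by (simp add: field_simps)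
    have "norm (dock_kernel (of_real x)) \<le> (C / sqrt t) / ((1 + t) / sqrt 2)"
      unfolding dock_kernel_def norm_divide using a b that C(1) by (intro frac_le) auto
    then show ?thesis by (simp add: mult_ac)
  qed
  show ?thesis
  proof
    show "sqrt 2 * C > 0" using C(1) by simp
    show "t > 0 \<Longrightarrow> norm (dock_kernel (of_real t)) \<le> (sqrt 2 * C) * (1 / (sqrt t * (1 + t)))" for t
      by (rule *) auto
    show "t > 0 \<Longrightarrow> norm (dock_kernel (- of_real t)) \<le> (sqrt 2 * C) * (1 / (sqrt t * (1 + t)))" for t
      using *[of t "- t"] by simp
  qed
qed

lemma one_minus_i_real_nonzero [simp]: "1 - \<i> * of_real t \<noteq> 0" "1 + \<i> * of_real t \<noteq> 0"
  by (auto simp: complex_eq_iff)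

lemma dock_kernel_continuous: "continuous_on {0<..} (\<lambda>t. dock_kernel (of_real t))"
  "continuous_on {0<..} (\<lambda>t. dock_kernel (- of_real t))"
proof -
  have c: "continuous_on up_slit wh_cont" by (rule holomorphic_on_imp_continuous_on[OF wh_cont_holomorphic])
  have "continuous_on {0<..} (\<lambda>t. wh_cont (of_real t))" "continuous_on {0<..} (\<lambda>t. wh_cont (- of_real t))"
    by (rule continuous_on_compose2[OF c], auto intro!: continuous_intros simp: up_slit_def)+
  then show "continuous_on {0<..} (\<lambda>t. dock_kernel (of_real t))" "continuous_on {0<..} (\<lambda>t. dock_kernel (- of_real t))"
    unfolding dock_kernel_def by (auto intro!: continuous_intros)
qed

definition lap_right :: "complex \<Rightarrow> complex" where
  "lap_right z = (LBINT t:{0<..}. dock_kernel (of_real t) * exp (- of_real t * z))"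

definition lap_left :: "complex \<Rightarrow> complex" where
  "lap_left z = (LBINT t:{0<..}. dock_kernel (- of_real t) * exp (of_real t * z))"

lemma Laplace_integral_right_half_plane:
  fixes k :: "real \<Rightarrow> complex"
  assumes k: "continuous_on {0<..} k" "\<And>t. t > 0 \<Longrightarrow> norm (k t) \<le> M * (1 / (sqrt t * (1 + t)))"
  shows "continuous_on {z. Re z \<ge> 0} (\<lambda>z. LBINT t:{0<..}. k t * exp (- of_real t * z))"
    and "Re z \<ge> 0 \<Longrightarrow> set_integrable lborel {0<..} (\<lambda>t. k t * exp (- of_real t * z))"
    and "Re z \<ge> 0 \<Longrightarrow> norm (LBINT t:{0<..}. k t * exp (- of_real t * z)) \<le> (LBINT t:{0<..}. M * (1 / (sqrt t * (1 + t))))"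
    and "Re z > 0 \<Longrightarrow> ((\<lambda>z. LBINT t:{0<..}. k t * exp (- of_real t * z)) has_field_derivative
            (LBINT t:{0<..}. - of_real t * (k t * exp (- of_real t * z)))) (at z)"
    and "Re z > 0 \<Longrightarrow> set_integrable lborel {0<..} (\<lambda>t. - of_real t * (k t * exp (- of_real t * z)))"
proof -
  have m: "set_integrable lborel {0<..} (\<lambda>t. M * (1 / (sqrt t * (1 + t))))"
    by (rule set_integrable_mult_right[OF tail_weight_integrable])
  have b: "norm (k t * exp (- of_real t * z)) \<le> M * (1 / (sqrt t * (1 + t)))" if "t > 0" "Re z \<ge> 0" for t z
  proof -
    have "norm (k t) * norm (exp (- of_real t * z)) \<le> norm (k t) * 1"
      using that by (intro mult_left_mono) (auto simp: norm_exp_eq_Re)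
    then show ?thesis using k(2)[OF that(1)] by (simp add: norm_mult)
  qed
  have c: "continuous_on {0<..} (\<lambda>t. k t * exp (- of_real t * z))" for z
    by (intro continuous_intros k)
  show "continuous_on {z. Re z \<ge> 0} (\<lambda>z. LBINT t:{0<..}. k t * exp (- of_real t * z))"
    by (rule halfline_integral_continuous_on[OF c _ b m]) (auto intro!: continuous_intros)
  show "Re z \<ge> 0 \<Longrightarrow> set_integrable lborel {0<..} (\<lambda>t. k t * exp (- of_real t * z))"
    by (rule set_integrable_halfline_bound[OF c b m])
  show "Re z \<ge> 0 \<Longrightarrow> norm (LBINT t:{0<..}. k t * exp (- of_real t * z)) \<le> (LBINT t:{0<..}. M * (1 / (sqrt t * (1 + t))))"
    by (rule halfline_integral_norm_bound[OF c b m])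
  show "((\<lambda>z. LBINT t:{0<..}. k t * exp (- of_real t * z)) has_field_derivative
            (LBINT t:{0<..}. - of_real t * (k t * exp (- of_real t * z)))) (at z)" if z: "Re z > 0"
  proof (rule halfline_integral_has_field_derivative[OF _ c _ b m])
    show "Re z > 0" by (rule z)
    show "Re w \<ge> 0" if "w \<in> ball z (Re z)" for w
      using that abs_Re_le_cmod[of "z - w"] by (auto simp: dist_norm)
  qed (auto intro!: derivative_eq_intros)
  show "set_integrable lborel {0<..} (\<lambda>t. - of_real t * (k t * exp (- of_real t * z)))" if z: "Re z > 0"
  proof (rule set_integrable_halfline_bound[OF _ _ set_integrable_mult_right[OF m, of "1 / Re z"]])
    fix t :: real assume t: "t > 0"
    have "t * Re z \<le> exp (t * Re z)" using exp_ge_add_one_self[of "t * Re z"] by linarith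
    then have "t * exp (- t * Re z) \<le> 1 / Re z" using z by (simp add: exp_minus field_simps)
    then have "norm (k t) * (t * exp (- t * Re z)) \<le> (M * (1 / (sqrt t * (1 + t)))) * (1 / Re z)"
      using k(2)[OF t] t order_trans[OF norm_ge_zero k(2)[OF t]] by (intro mult_mono) auto
    then show "norm (- of_real t * (k t * exp (- of_real t * z))) \<le> 1 / Re z * (M * (1 / (sqrt t * (1 + t))))"
      using t by (simp add: norm_mult norm_exp_eq_Re mult_ac)
  qed (intro continuous_intros k)
qed

text \<open>Residue calculus for the pole at \<open>- \<i>\<close> without contour integrals. Subtracting
  \<open>p / (1 + w\<^sup>2)\<close> with a suitable \<open>p\<close> removes the pole, and the remaining function has the same integral along
  the rays \<open>1\<close>, \<open>- \<i>\<close> and \<open>- 1\<close>. The subtracted term contributes \<open>p\<close> times the integral of \<open>1 / (1 + t\<^sup>2)\<close>.\<close>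

lemma kernel_residue_identity:
  assumes y: "y \<ge> 0"
  shows "lap_right (\<i> * of_real y) + lap_left (\<i> * of_real y) = of_real (2 * pi) * (wh_factor (- \<i>) * exp (- of_real y))"
proof -
  \<comment> \<open>Chosen such that \<open>n\<close> vanishes at \<open>- \<i>\<close>, where \<open>1 + \<i> w = 2\<close>; then \<open>q\<close>, the difference quotient of \<open>n\<close>, has no pole.\<close>
  define p where "p = 2 * wh_factor (- \<i>) * exp (- of_real y)"
  define n where "n w = wh_cont w * exp (- \<i> * w * of_real y) * (1 + \<i> * w) - p" for w
  define q where "q w = (if w = - \<i> then deriv n (- \<i>) else (n w - n (- \<i>)) / (w - (- \<i>)))" for w
  define h where "h w = \<i> * q w / (1 + \<i> * w)" for w
  have ops: "open up_slit" unfolding up_slit_def Collect_disj_eq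
    by (intro open_Un) (auto intro!: open_Collect_neq open_halfspace_Im_lt continuous_intros)
  have nh: "n holomorphic_on up_slit" unfolding n_def by (intro holomorphic_intros wh_cont_holomorphic)
  have n0: "n (- \<i>) = 0" by (simp add: n_def p_def wh_cont_lower)
  have qh: "q holomorphic_on up_slit" unfolding q_def[abs_def] by (rule pole_lemma_open[OF nh ops])
  have hh: "h holomorphic_on up_slit" unfolding h_def[abs_def]
    by (intro holomorphic_intros qh) (use one_plus_i_nonzero in auto)
  have hq: "h w = dock_kernel w * exp (- \<i> * w * of_real y) - p / ((1 + \<i> * w) * (1 - \<i> * w))" if "w \<in> up_slit" "w \<noteq> - \<i>" for w
  proof -
    have nz: "1 + \<i> * w \<noteq> 0" using that by (rule_tac one_plus_i_nonzero)
    have e: "w + \<i> = \<i> * (1 - \<i> * w)" by (simp add: algebra_simps)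
    have nz2: "1 - \<i> * w \<noteq> 0" using that(2) e by (metis add.inverse_inverse add_eq_0_iff2 mult_zero_right)
    have "h w = \<i> * (n w / (\<i> * (1 - \<i> * w))) / (1 + \<i> * w)"
      using that n0 by (simp add: h_def q_def e)
    also have "\<dots> = n w / ((1 + \<i> * w) * (1 - \<i> * w))" by simp
    also have "\<dots> = dock_kernel w * exp (- \<i> * w * of_real y) - p / ((1 + \<i> * w) * (1 - \<i> * w))"
      unfolding n_def diff_divide_distrib dock_kernel_def using nz by simp
    finally show ?thesis .
  qed
  obtain C where C: "C \<ge> 1" "\<And>w. Im w \<le> 0 \<Longrightarrow> w \<noteq> 0 \<Longrightarrow> norm (wh_cont w) \<le> C / sqrt (1 + norm w)"
    by (rule wh_cont_bound) blast
  have cb: "cball (- \<i>) (1/2) \<subseteq> up_slit"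
  proof
    fix w assume "w \<in> cball (- \<i>) (1/2)"
    then have "\<bar>Im (- \<i> - w)\<bar> \<le> 1/2" using abs_Im_le_cmod[of "- \<i> - w"] by (simp only: mem_cball dist_norm)
    then show "w \<in> up_slit" by (auto simp: up_slit_def abs_if split: if_splits)
  qed
  obtain B where B: "\<And>w. w \<in> cball (- \<i>) (1/2) \<Longrightarrow> norm (h w) \<le> B"
    using compact_imp_bounded[OF compact_continuous_image[OF continuous_on_subset[OF holomorphic_on_imp_continuous_on[OF hh] cb] compact_cball]]
    unfolding bounded_iff by (metis imageI)
  define T where "T = \<bar>B\<bar> * 8 + 6 * C + 12 * norm p"
  have hb: "norm (h w) \<le> T / (sqrt (1 + norm w) * (1 + norm w))" if w: "Im w \<le> 0" "w \<in> up_slit" for w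
  proof (cases "w \<in> cball (- \<i>) (1/2)")
    case True
    have "norm w \<le> norm (- \<i> - w) + norm (\<i>)" using norm_triangle_ineq4[of "- \<i> - w" "- \<i>"] by (simp add: norm_minus_commute)
    then have nw: "1 + norm w \<le> 3" using True by (simp add: dist_norm)
    have "sqrt (1 + norm w) \<le> sqrt 4" using nw by (intro real_sqrt_le_mono) simp
    then have "sqrt (1 + norm w) * (1 + norm w) \<le> 2 * 3" using nw by (intro mult_mono) auto
    moreover have "0 < sqrt (1 + norm w) * (1 + norm w)" by (intro mult_pos_pos) (auto simp: add_pos_nonneg)
    ultimately have "\<bar>B\<bar> * (sqrt (1 + norm w) * (1 + norm w)) \<le> \<bar>B\<bar> * 8" by (intro mult_left_mono) auto
    also have "\<dots> \<le> T" using C(1) by (simp add: T_def)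
    finally have "\<bar>B\<bar> \<le> T / (sqrt (1 + norm w) * (1 + norm w))"
      using \<open>0 < sqrt (1 + norm w) * (1 + norm w)\<close> by (simp only: pos_le_divide_eq)
    then show ?thesis using B[OF True] by linarith
  next
    case False
    have wi: "w \<noteq> - \<i>" using False by auto
    have w0: "w \<noteq> 0" using w by (auto simp: up_slit_def)
    define a where "a = 1 + norm w"
    have a: "a \<ge> 1" by (simp add: a_def)
    have e: "norm (1 - \<i> * w) = norm (w + \<i>)"
    proof -
      have "w + \<i> = \<i> * (1 - \<i> * w)" by (simp add: algebra_simps)
      then show ?thesis by (metis mult_1 norm_ii norm_mult)
    qed
    have d1: "norm (w + \<i>) > 1/2" using False by (simp add: dist_norm norm_minus_commute add.commute)
    have "norm w \<le> norm (w + \<i>) + 1" using norm_triangle_ineq4[of "w + \<i>" "\<i>"] by simp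
    then have "1 + norm w \<le> 6 * norm (w + \<i>)" using d1 by argo
    then have d: "a / 6 \<le> norm (1 - \<i> * w)" unfolding e a_def by simp
    have d2: "a / 2 \<le> norm (1 + \<i> * w)"
    proof -
      have "sqrt 2 * norm (1 + \<i> * w) \<le> 2 * norm (1 + \<i> * w)"
        using real_sqrt_le_mono[of 2 4] by (intro mult_right_mono) auto
      then show ?thesis using norm_one_plus_i_ge[OF w(1)] by (simp add: a_def)
    qed
    have sq: "sqrt a > 0" "sqrt a \<le> a" using a real_sqrt_le_mono[of a "a * a"] by auto
    have k1: "norm (dock_kernel w * exp (- \<i> * w * of_real y)) \<le> 6 * C / (sqrt a * a)"
    proof -
      have "norm (exp (- \<i> * w * of_real y)) \<le> 1" using w(1) y by (simp add: norm_exp_eq_Re mult_nonpos_nonneg)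
      then have "norm (dock_kernel w * exp (- \<i> * w * of_real y)) \<le> norm (dock_kernel w) * 1"
        unfolding norm_mult by (intro mult_left_mono) auto
      also have "\<dots> \<le> (C / sqrt a) / (a / 6)" unfolding dock_kernel_def norm_divide mult_1_right
        using C(2)[OF w(1) w0] d a C(1) by (intro frac_le) (auto simp: a_def add_pos_nonneg)
      finally show ?thesis by (simp add: mult_ac)
    qed
    have k2: "norm (p / ((1 + \<i> * w) * (1 - \<i> * w))) \<le> 12 * norm p / (sqrt a * a)"
    proof -
      have "norm (p / ((1 + \<i> * w) * (1 - \<i> * w))) \<le> norm p / ((a/2) * (a/6))"
        unfolding norm_divide norm_mult using d d2 a by (intro frac_le mult_mono mult_pos_pos) auto
      also have "\<dots> = 12 * norm p / (a * a)" by simp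
      also have "\<dots> \<le> 12 * norm p / (sqrt a * a)" using sq a by (intro divide_left_mono mult_right_mono mult_pos_pos) auto
      finally show ?thesis .
    qed
    have "norm (h w) \<le> 6 * C / (sqrt a * a) + 12 * norm p / (sqrt a * a)"
      unfolding hq[OF w(2) wi] using norm_triangle_ineq4 k1 k2 by (rule order_trans[OF _ add_mono])
    also have "\<dots> \<le> T / (sqrt a * a)" unfolding add_divide_distrib[symmetric] T_def
      using sq a by (intro divide_right_mono) auto
    finally show ?thesis by (simp add: a_def)
  qed
  have hr: "norm (h (of_real r * v)) \<le> (4 * T) / (sqrt r * (1 + r))" if r: "r > 0" and v: "norm v \<ge> 1/2" "Im v \<le> 0" "v \<in> up_slit" for r v
  proof -
    have T: "T \<ge> 0" using C(1) by (simp add: T_def)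
    have nv: "norm (of_real r * v) \<ge> r / 2" using r v by (simp add: norm_mult)
    have "sqrt (r/4) \<le> sqrt (1 + norm (of_real r * v))" using nv r by (intro real_sqrt_le_mono) linarith
    then have "sqrt r / 2 \<le> sqrt (1 + norm (of_real r * v))" by (simp add: real_sqrt_divide)
    then have "(sqrt r / 2) * ((1 + r) / 2) \<le> sqrt (1 + norm (of_real r * v)) * (1 + norm (of_real r * v))"
      using nv r by (intro mult_mono) auto
    moreover have "(sqrt r / 2) * ((1 + r) / 2) > 0" using r by (intro mult_pos_pos) auto
    ultimately have "T / (sqrt (1 + norm (of_real r * v)) * (1 + norm (of_real r * v))) \<le> T / ((sqrt r / 2) * ((1 + r) / 2))"
      using T r by (intro divide_left_mono mult_pos_pos[where 'a=real]) (auto simp: add_pos_nonneg)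
    moreover have "norm (h (of_real r * v)) \<le> T / (sqrt (1 + norm (of_real r * v)) * (1 + norm (of_real r * v)))"
      by (rule hb) (use r v in \<open>auto simp: up_slit_def mult_nonneg_nonpos mult_pos_neg\<close>)
    ultimately show ?thesis by (simp add: mult_ac)
  qed
  have shift1: "1 * (LBINT r:{0<..}. h (of_real r * 1)) = - \<i> * (LBINT r:{0<..}. h (of_real r * (- \<i>)))"
  proof (rule ray_integral_shift)
    let ?S = "{w. Re w - Im w > 0}"
    have eq: "?S = {w. Complex 1 (- 1) \<bullet> w > 0}" by (auto simp: inner_complex_def)
    show "open ?S" "convex ?S" unfolding eq by (rule open_halfspace_gt convex_halfspace_gt)+
    show "h holomorphic_on ?S" by (rule holomorphic_on_subset[OF hh]) (auto simp: up_slit_def)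
    fix r :: real and v assume r: "r > 0" and v: "v \<in> closed_segment 1 (- \<i>)"
    then obtain s where s: "0 \<le> s" "s \<le> 1" "v = (1 - s) *\<^sub>R 1 + s *\<^sub>R (- \<i>)" by (auto simp: in_segment)
    have v': "Re v = 1 - s" "Im v = - s" using s by auto
    have "Re (of_real r * v) - Im (of_real r * v) = r" by (simp add: v' algebra_simps)
    then show "of_real r * v \<in> ?S" using r by (simp only: mem_Collect_eq)
    show "norm (h (of_real r * v)) \<le> (4 * T) / (sqrt r * (1 + r))"
    proof (rule hr[OF r])
      show "norm v \<ge> 1/2" using abs_Re_le_cmod[of v] abs_Im_le_cmod[of v] v' s by linarith
    qed (use v' s in \<open>auto simp: up_slit_def\<close>)
  qed
  have shift2: "- \<i> * (LBINT r:{0<..}. h (of_real r * (- \<i>))) = - 1 * (LBINT r:{0<..}. h (of_real r * (- 1)))"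
  proof (rule ray_integral_shift)
    let ?S = "{w. - Re w - Im w > 0}"
    have eq: "?S = {w. Complex (- 1) (- 1) \<bullet> w > 0}" by (auto simp: inner_complex_def)
    show "open ?S" "convex ?S" unfolding eq by (rule open_halfspace_gt convex_halfspace_gt)+
    show "h holomorphic_on ?S" by (rule holomorphic_on_subset[OF hh]) (auto simp: up_slit_def)
    fix r :: real and v assume r: "r > 0" and v: "v \<in> closed_segment (- \<i>) (- 1)"
    then obtain s where s: "0 \<le> s" "s \<le> 1" "v = (1 - s) *\<^sub>R (- \<i>) + s *\<^sub>R (- 1)" by (auto simp: in_segment)
    have v': "Re v = - s" "Im v = - (1 - s)" using s by auto
    have "- Re (of_real r * v) - Im (of_real r * v) = r" by (simp add: v' algebra_simps)
    then show "of_real r * v \<in> ?S" using r by (simp only: mem_Collect_eq)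
    show "norm (h (of_real r * v)) \<le> (4 * T) / (sqrt r * (1 + r))"
    proof (rule hr[OF r])
      show "norm v \<ge> 1/2" using abs_Re_le_cmod[of v] abs_Im_le_cmod[of v] v' s by linarith
    qed (use v' s in \<open>auto simp: up_slit_def\<close>)
  qed
  have sum0: "(LBINT r:{0<..}. h (of_real r)) + (LBINT r:{0<..}. h (- of_real r)) = 0"
    using shift1 shift2 by simp
  obtain M where M: "M > 0" "\<And>t. t > 0 \<Longrightarrow> norm (dock_kernel (of_real t)) \<le> M * (1 / (sqrt t * (1 + t)))"
    "\<And>t. t > 0 \<Longrightarrow> norm (dock_kernel (- of_real t)) \<le> M * (1 / (sqrt t * (1 + t)))"
    using dock_kernel_bound by metis
  have pint: "set_integrable lborel {0<..} (\<lambda>r. p * complex_of_real (1 / (1 + r\<^sup>2)))"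
  proof (rule set_integrable_halfline_bound[OF _ _ set_integrable_mult_right[OF inverse_square_weight_integrable, of "norm p"]])
    show "norm (p * complex_of_real (1 / (1 + r\<^sup>2))) \<le> norm p * (1 / (1 + r\<^sup>2))" for r
      by (simp add: norm_mult del: of_real_divide of_real_add)
  qed (auto intro!: continuous_intros)
  have pval: "(LBINT r:{0<..}. p * complex_of_real (1 / (1 + r\<^sup>2))) = p * of_real (pi/2)"
    by (simp only: set_integral_mult_right set_integral_complex_of_real inverse_square_weight_integral)
  have fac: "(1 + \<i> * of_real r) * (1 - \<i> * of_real r) = complex_of_real (1 + r\<^sup>2)" for r
    by (simp add: algebra_simps power2_eq_square)
  have nei: "complex_of_real r \<noteq> - \<i>" "- complex_of_real r \<noteq> - \<i>" for r by (auto simp: complex_eq_iff)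
  have "(LBINT r:{0<..}. h (of_real r)) = (LBINT r:{0<..}. dock_kernel (of_real r) * exp (- of_real r * (\<i> * of_real y)) - p * complex_of_real (1 / (1 + r\<^sup>2)))"
  proof (rule set_lebesgue_integral_cong, simp, intro allI impI)
    fix r :: real assume r: "r \<in> {0<..}"
    have "h (of_real r) = dock_kernel (of_real r) * exp (- \<i> * of_real r * of_real y) - p / complex_of_real (1 + r\<^sup>2)"
      using hq[of "of_real r"] nei[of r] r unfolding fac by (simp add: up_slit_def)
    then show "h (of_real r) = dock_kernel (of_real r) * exp (- of_real r * (\<i> * of_real y)) - p * complex_of_real (1 / (1 + r\<^sup>2))"
      by (simp add: mult_ac)
  qed
  also have "\<dots> = lap_right (\<i> * of_real y) - p * of_real (pi/2)"
    unfolding lap_right_def pval[symmetric]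
    by (rule set_integral_diff(2)[OF Laplace_integral_right_half_plane(2)[OF dock_kernel_continuous(1) M(2)] pint]) auto
  finally have i1: "(LBINT r:{0<..}. h (of_real r)) = lap_right (\<i> * of_real y) - p * of_real (pi/2)" .
  have "(LBINT r:{0<..}. h (- of_real r)) = (LBINT r:{0<..}. dock_kernel (- of_real r) * exp (- of_real r * (- (\<i> * of_real y))) - p * complex_of_real (1 / (1 + r\<^sup>2)))"
  proof (rule set_lebesgue_integral_cong, simp, intro allI impI)
    fix r :: real assume r: "r \<in> {0<..}"
    have "h (- of_real r) = dock_kernel (- of_real r) * exp (\<i> * of_real r * of_real y) - p / complex_of_real (1 + r\<^sup>2)"
      using hq[of "- of_real r"] nei[of r] r fac[of r] by (simp add: up_slit_def mult.commute[of "1 - \<i> * of_real r"])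
    then show "h (- of_real r) = dock_kernel (- of_real r) * exp (- of_real r * (- (\<i> * of_real y))) - p * complex_of_real (1 / (1 + r\<^sup>2))"
      by (simp add: mult_ac)
  qed
  also have "\<dots> = lap_left (\<i> * of_real y) - p * of_real (pi/2)"
  proof -
    have "lap_left (\<i> * of_real y) = (LBINT r:{0<..}. dock_kernel (- of_real r) * exp (- of_real r * (- (\<i> * of_real y))))"
      by (simp add: lap_left_def)
    then show ?thesis unfolding pval[symmetric]
      by (simp only:) (rule set_integral_diff(2)[OF Laplace_integral_right_half_plane(2)[OF dock_kernel_continuous(2) M(3)] pint], auto)
  qed
  finally have i2: "(LBINT r:{0<..}. h (- of_real r)) = lap_left (\<i> * of_real y) - p * of_real (pi/2)" .
  have "lap_right (\<i> * of_real y) + lap_left (\<i> * of_real y) = p * of_real pi"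
    using sum0 unfolding i1 i2 by (simp add: algebra_simps)
  then show ?thesis by (simp add: p_def mult_ac)
qed

definition sol_right :: "complex \<Rightarrow> complex" where
  "sol_right z = exp (\<i> * z + \<i> * of_real (pi / 8)) - of_real (sqrt 2 / (2 * pi)) * lap_right z"

definition sol_left :: "complex \<Rightarrow> complex" where
  "sol_left z = of_real (sqrt 2 / (2 * pi)) * lap_left z"

definition sol :: "complex \<Rightarrow> complex" where
  "sol z = (if Re z \<ge> 0 then sol_right z else sol_left z)"

lemma lap_left_eq: "lap_left z = (LBINT t:{0<..}. dock_kernel (- of_real t) * exp (- of_real t * (- z)))"
  by (simp add: lap_left_def)

lemma lap_right_continuous: "continuous_on {z. Re z \<ge> 0} lap_right"
  and lap_left_continuous: "continuous_on {z. Re z \<le> 0} lap_left"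
  and lap_bounded: "\<exists>B. \<forall>z. (Re z \<ge> 0 \<longrightarrow> norm (lap_right z) \<le> B) \<and> (Re z \<le> 0 \<longrightarrow> norm (lap_left z) \<le> B)"
  and lap_right_DERIV: "Re z > 0 \<Longrightarrow> (lap_right has_field_derivative
            (LBINT t:{0<..}. - of_real t * (dock_kernel (of_real t) * exp (- of_real t * z)))) (at z)"
  and lap_right_DERIV_integrable: "Re z > 0 \<Longrightarrow> set_integrable lborel {0<..} (\<lambda>t. - of_real t * (dock_kernel (of_real t) * exp (- of_real t * z)))"
  and lap_right_integrable: "Re z \<ge> 0 \<Longrightarrow> set_integrable lborel {0<..} (\<lambda>t. dock_kernel (of_real t) * exp (- of_real t * z))"
  and lap_left_integrable: "Re z \<le> 0 \<Longrightarrow> set_integrable lborel {0<..} (\<lambda>t. dock_kernel (- of_real t) * exp (of_real t * z))"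
  and lap_left_holomorphic: "lap_left holomorphic_on {z. Re z < 0}"
proof -
  obtain M where M: "M > 0" "\<And>t. t > 0 \<Longrightarrow> norm (dock_kernel (of_real t)) \<le> M * (1 / (sqrt t * (1 + t)))"
    "\<And>t. t > 0 \<Longrightarrow> norm (dock_kernel (- of_real t)) \<le> M * (1 / (sqrt t * (1 + t)))"
    using dock_kernel_bound by metis
  note R = Laplace_integral_right_half_plane[OF dock_kernel_continuous(1) M(2)]
  note L = Laplace_integral_right_half_plane[OF dock_kernel_continuous(2) M(3)]
  have Req: "lap_right = (\<lambda>z. LBINT t:{0<..}. dock_kernel (of_real t) * exp (- of_real t * z))"
    by (simp add: lap_right_def fun_eq_iff)
  have Leq: "lap_left = (\<lambda>z. (\<lambda>z. LBINT t:{0<..}. dock_kernel (- of_real t) * exp (- of_real t * z)) (- z))"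
    by (simp add: lap_left_def fun_eq_iff)
  show "continuous_on {z. Re z \<ge> 0} lap_right" unfolding Req by (rule R(1))
  show "continuous_on {z. Re z \<le> 0} lap_left" unfolding Leq
    by (rule continuous_on_compose2[OF L(1)]) (auto intro!: continuous_intros)
  show "\<exists>B. \<forall>z. (Re z \<ge> 0 \<longrightarrow> norm (lap_right z) \<le> B) \<and> (Re z \<le> 0 \<longrightarrow> norm (lap_left z) \<le> B)"
    unfolding lap_right_def lap_left_eq
    by (intro exI[of _ "LBINT t:{0<..}. M * (1 / (sqrt t * (1 + t)))"] allI conjI impI R(3) L(3)) auto
  show "Re z > 0 \<Longrightarrow> (lap_right has_field_derivative
            (LBINT t:{0<..}. - of_real t * (dock_kernel (of_real t) * exp (- of_real t * z)))) (at z)"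
    unfolding Req by (rule R(4))
  show "Re z > 0 \<Longrightarrow> set_integrable lborel {0<..} (\<lambda>t. - of_real t * (dock_kernel (of_real t) * exp (- of_real t * z)))"
    by (rule R(5))
  show "Re z \<ge> 0 \<Longrightarrow> set_integrable lborel {0<..} (\<lambda>t. dock_kernel (of_real t) * exp (- of_real t * z))" by (rule R(2))
  show "Re z \<le> 0 \<Longrightarrow> set_integrable lborel {0<..} (\<lambda>t. dock_kernel (- of_real t) * exp (of_real t * z))"
    using L(2)[of "- z"] by simp
  have "(\<lambda>z. LBINT t:{0<..}. dock_kernel (- of_real t) * exp (- of_real t * z)) holomorphic_on {z. Re z > 0}"
    using L(4) by (intro holomorphic_onI) (auto simp: field_differentiable_def intro: has_field_derivative_at_within)
  then have "((\<lambda>z. LBINT t:{0<..}. dock_kernel (- of_real t) * exp (- of_real t * z)) \<circ> uminus) holomorphic_on {z. Re z < 0}"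
    by (rule holomorphic_on_compose_gen[rotated]) (auto intro!: holomorphic_intros)
  then show "lap_left holomorphic_on {z. Re z < 0}" unfolding Leq o_def .
qed

text \<open>This determines the constants of the formula: \<open>\<surd>2 / (2 \<pi>)\<close> compensates the factor \<open>2 \<pi>\<close> of the residue and
  the modulus \<open>1 / \<surd>2\<close> of the factor at \<open>- \<i>\<close>.\<close>

lemma sol_agree:
  assumes "y \<ge> 0" shows "sol_right (\<i> * of_real y) = sol_left (\<i> * of_real y)"
proof -
  have "of_real (sqrt 2 / (2 * pi)) * (lap_right (\<i> * of_real y) + lap_left (\<i> * of_real y))
      = complex_of_real (sqrt 2 / (2 * pi) * (2 * pi)) * (wh_factor (- \<i>) * exp (- of_real y))"
    unfolding kernel_residue_identity[OF assms] by (simp only: of_real_mult mult.assoc)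
  also have "sqrt 2 / (2 * pi) * (2 * pi) = sqrt 2" by simp
  also have "complex_of_real (sqrt 2) * (wh_factor (- \<i>) * exp (- of_real y)) = exp (\<i> * of_real (pi/8)) * exp (- of_real y)"
    unfolding wh_factor_minus_i by simp
  also have "\<dots> = exp (\<i> * (\<i> * of_real y) + \<i> * of_real (pi / 8))"
    by (simp add: mult_exp_exp algebra_simps flip: mult.assoc)
  finally have "exp (\<i> * (\<i> * of_real y) + \<i> * of_real (pi / 8)) = of_real (sqrt 2 / (2 * pi)) * lap_right (\<i> * of_real y)
      + of_real (sqrt 2 / (2 * pi)) * lap_left (\<i> * of_real y)" by (simp only: distrib_left)
  then show ?thesis unfolding sol_right_def sol_left_def by (simp only: add_diff_cancel_left')
qed

lemma sol_right_continuous: "continuous_on {z. Re z \<ge> 0} sol_right"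
  unfolding sol_right_def by (intro continuous_intros lap_right_continuous)

lemma sol_left_continuous: "continuous_on {z. Re z \<le> 0} sol_left"
  unfolding sol_left_def by (intro continuous_intros lap_left_continuous)

lemma sol_left_eq: "Re z \<le> 0 \<Longrightarrow> Im z \<ge> 0 \<Longrightarrow> sol z = sol_left z"
proof (cases "Re z = 0")
  assume "Im z \<ge> 0" "Re z = 0"
  then have "z = \<i> * of_real (Im z)" by (simp add: complex_eq_iff)
  then show ?thesis using sol_agree[OF \<open>Im z \<ge> 0\<close>] \<open>Re z = 0\<close> by (simp add: sol_def)
qed (simp add: sol_def)

lemma sol_continuous: "continuous_on {z. Im z \<ge> 0} sol"
proof -
  have "continuous_on ({z. Re z \<ge> 0 \<and> Im z \<ge> 0} \<union> {z. Re z \<le> 0 \<and> Im z \<ge> 0}) sol"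
  proof (rule continuous_on_closed_Un)
    show "closed {z. Re z \<ge> 0 \<and> Im z \<ge> 0}" "closed {z. Re z \<le> 0 \<and> Im z \<ge> 0}"
      by (auto simp: Collect_conj_eq intro!: closed_Int closed_halfspace_Re_ge closed_halfspace_Re_le closed_halfspace_Im_ge)
    have "continuous_on {z. Re z \<ge> 0 \<and> Im z \<ge> 0} sol_right"
      by (rule continuous_on_subset[OF sol_right_continuous]) auto
    then show "continuous_on {z. Re z \<ge> 0 \<and> Im z \<ge> 0} sol"
      by (rule continuous_on_eq) (simp add: sol_def)
    have "continuous_on {z. Re z \<le> 0 \<and> Im z \<ge> 0} sol_left"
      by (rule continuous_on_subset[OF sol_left_continuous]) auto
    then show "continuous_on {z. Re z \<le> 0 \<and> Im z \<ge> 0} sol"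
      by (rule continuous_on_eq) (simp add: sol_left_eq)
  qed
  moreover have "{z. Re z \<ge> 0 \<and> Im z \<ge> 0} \<union> {z. Re z \<le> 0 \<and> Im z \<ge> 0} = {z. Im z \<ge> 0}" by auto
  ultimately show ?thesis by simp
qed

lemma sol_right_DERIV:
  assumes "Re z > 0"
  shows "(sol_right has_field_derivative (\<i> * exp (\<i> * z + \<i> * of_real (pi / 8)) -
     of_real (sqrt 2 / (2 * pi)) * (LBINT t:{0<..}. - of_real t * (dock_kernel (of_real t) * exp (- of_real t * z))))) (at z)"
  unfolding sol_right_def[abs_def]
  by (intro DERIV_diff DERIV_cmult lap_right_DERIV assms) (auto intro!: derivative_eq_intros)

text \<open>The two pieces are continuous up to the imaginary axis and agree there, so the union is holomorphic
  across it.\<close>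

lemma sol_holomorphic: "sol holomorphic_on {z. Im z > 0}"
proof (rule holomorphic_on_paste_across_line[where d=1 and k=0])
  have i: "1 \<bullet> z = Re z" for z by (simp add: inner_complex_def)
  show "open {z. Im z > 0}" by (rule open_halfspace_Im_gt)
  show "sol holomorphic_on {z. Im z > 0} \<inter> {z. 1 \<bullet> z < 0}" unfolding i
  proof (rule holomorphic_transform)
    show "sol_left holomorphic_on {z. Im z > 0} \<inter> {z. Re z < 0}" unfolding sol_left_def[abs_def]
      by (intro holomorphic_intros holomorphic_on_subset[OF lap_left_holomorphic]) auto
  qed (auto simp: sol_def)
  show "sol holomorphic_on {z. Im z > 0} \<inter> {z. 0 < 1 \<bullet> z}" unfolding i
  proof (rule holomorphic_transform)
    show "sol_right holomorphic_on {z. Im z > 0} \<inter> {z. 0 < Re z}"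
      using sol_right_DERIV by (intro holomorphic_onI) (auto simp: field_differentiable_def intro: has_field_derivative_at_within)
  qed (auto simp: sol_def)
  show "continuous_on {z. Im z > 0} sol" by (rule continuous_on_subset[OF sol_continuous]) auto
qed auto

lemma sol_bounded: "\<exists>B. \<forall>z. Im z \<ge> 0 \<longrightarrow> norm (sol z) \<le> B"
proof -
  obtain B where B: "\<And>z. Re z \<ge> 0 \<Longrightarrow> norm (lap_right z) \<le> B" "\<And>z. Re z \<le> 0 \<Longrightarrow> norm (lap_left z) \<le> B"
    using lap_bounded by blast
  have c: "norm (complex_of_real (sqrt 2 / (2 * pi))) = sqrt 2 / (2 * pi)"
    by (simp only: norm_of_real abs_of_nonneg[OF divide_nonneg_nonneg[of "sqrt 2" "2*pi"]]) simp
  show ?thesis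
  proof (intro exI allI impI)
    fix z :: complex assume z: "Im z \<ge> 0"
    have B0: "B \<ge> 0" using B(1)[of 0] norm_ge_zero[of "lap_right 0"] by (simp del: norm_ge_zero)
    show "norm (sol z) \<le> 1 + sqrt 2 / (2 * pi) * B"
    proof (cases "Re z \<ge> 0")
      case True
      have "norm (sol_right z) \<le> norm (exp (\<i> * z + \<i> * of_real (pi / 8))) + norm (of_real (sqrt 2 / (2 * pi)) * lap_right z)"
        unfolding sol_right_def by (rule norm_triangle_ineq4)
      also have "\<dots> \<le> 1 + sqrt 2 / (2 * pi) * B"
        unfolding norm_mult c using z B(1)[OF True] by (intro add_mono mult_left_mono) (auto simp: norm_exp_eq_Re)
      finally show ?thesis using True by (simp add: sol_def)
    next
      case False
      have "norm (sol_left z) \<le> sqrt 2 / (2 * pi) * B"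
        unfolding sol_left_def norm_mult c using B(2)[of z] False by (intro mult_left_mono) auto
      then show ?thesis using False by (simp add: sol_def)
    qed
  qed
qed

definition wh_real :: "real \<Rightarrow> real" where
  "wh_real t = exp (- (1 / pi) * (LBINT s:{0<..}. ln (t + s) / (1 + s\<^sup>2)))"

lemma wh_real_pos: "wh_real t > 0" by (simp add: wh_real_def)

lemma dock_kernel_of_real:
  assumes "t > 0"
  shows "dock_kernel (of_real t) = of_real (wh_real t / (1 + t\<^sup>2)) * (1 + \<i> * of_real t)"
    "dock_kernel (- of_real t) = of_real (1 / ((1 + t\<^sup>2) * wh_real t))"
proof -
  have fac: "(1 - \<i> * of_real t) * (1 + \<i> * of_real t) = complex_of_real (1 + t\<^sup>2)"
    by (simp add: algebra_simps power2_eq_square)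
  have b: "wh_factor (of_real t) = of_real (wh_real t)" using wh_factor_of_real[OF assms] by (simp add: wh_real_def)
  have "dock_kernel (of_real t) = of_real (wh_real t) / (1 - \<i> * of_real t)"
    by (simp add: dock_kernel_def wh_cont_of_real assms b)
  also have "\<dots> = of_real (wh_real t) * (1 + \<i> * of_real t) / ((1 - \<i> * of_real t) * (1 + \<i> * of_real t))" by simp
  finally show "dock_kernel (of_real t) = of_real (wh_real t / (1 + t\<^sup>2)) * (1 + \<i> * of_real t)" unfolding fac by simp
  have "dock_kernel (- of_real t) = 1 / (((1 - \<i> * of_real t) * (1 + \<i> * of_real t)) * of_real (wh_real t))"
    by (simp add: dock_kernel_def wh_cont_of_real assms b mult_ac)
  then show "dock_kernel (- of_real t) = of_real (1 / ((1 + t\<^sup>2) * wh_real t))" unfolding fac by simp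
qed

lemma exp_real_axis: "exp (- of_real t * of_real x) = complex_of_real (exp (- t * x))"
  by (metis exp_of_real of_real_minus of_real_mult)

text \<open>\<open>f' - \<i> f\<close> cancels the exponential, and multiplies the density of the Laplace integral by
  \<open>\<i> (1 - \<i> t)\<close>. This removes the denominator and leaves an imaginary integrand.\<close>

lemma sol_Robin:
  assumes x: "x > 0"
  shows "\<exists>D. (sol_right has_field_derivative D) (at (of_real x)) \<and> Re D = - Im (sol_right (of_real x))"
proof -
  let ?z = "complex_of_real x"
  let ?k = "\<lambda>t. dock_kernel (of_real t) * exp (- of_real t * ?z)"
  define D where "D = \<i> * exp (\<i> * ?z + \<i> * of_real (pi / 8)) -
     of_real (sqrt 2 / (2 * pi)) * (LBINT t:{0<..}. - of_real t * ?k t)"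
  have D: "(sol_right has_field_derivative D) (at ?z)" unfolding D_def by (rule sol_right_DERIV) (simp add: x)
  have i1: "set_integrable lborel {0<..} (\<lambda>t. - of_real t * ?k t)" by (rule lap_right_DERIV_integrable) (simp add: x)
  have i2: "set_integrable lborel {0<..} (\<lambda>t. \<i> * ?k t)"
    using lap_right_integrable[of ?z] x by (intro set_integrable_mult_right) auto
  have "D - \<i> * sol_right ?z = - of_real (sqrt 2 / (2 * pi)) * ((LBINT t:{0<..}. - of_real t * ?k t) - (LBINT t:{0<..}. \<i> * ?k t))"
    unfolding D_def sol_right_def lap_right_def set_integral_mult_right by (simp add: algebra_simps)
  also have "\<dots> = - of_real (sqrt 2 / (2 * pi)) * (LBINT t:{0<..}. - of_real t * ?k t - \<i> * ?k t)"
    by (simp only: set_integral_diff(2)[OF i1 i2])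
  also have "(LBINT t:{0<..}. - of_real t * ?k t - \<i> * ?k t) = (LBINT t:{0<..}. \<i> * of_real (- (wh_real t * exp (- t * x))))"
  proof (rule set_lebesgue_integral_cong, simp, intro allI impI)
    fix t :: real assume "t \<in> {0<..}"
    then have t: "t > 0" by simp
    have f: "(of_real t + \<i>) * (1 + \<i> * of_real t) = \<i> * complex_of_real (1 + t\<^sup>2)"
      by (simp add: algebra_simps power2_eq_square)
    have "- of_real t * ?k t - \<i> * ?k t = - (((of_real t + \<i>) * (1 + \<i> * of_real t)) * of_real (wh_real t / (1 + t\<^sup>2)) * exp (- of_real t * ?z))"
    proof -
      have "- T * (K * (1 + \<i> * T) * E) - \<i> * (K * (1 + \<i> * T) * E) = - (((T + \<i>) * (1 + \<i> * T)) * K * E)" for T K E :: complex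
        by (simp add: algebra_simps)
      then show ?thesis unfolding dock_kernel_of_real(1)[OF t] .
    qed
    also have "\<dots> = - (\<i> * (complex_of_real (1 + t\<^sup>2) * of_real (wh_real t / (1 + t\<^sup>2))) * of_real (exp (- t * x)))"
      unfolding f exp_real_axis by (simp only: mult.assoc)
    also have "complex_of_real (1 + t\<^sup>2) * of_real (wh_real t / (1 + t\<^sup>2)) = of_real (wh_real t)"
    proof -
      have "(1 + t\<^sup>2) * (wh_real t / (1 + t\<^sup>2)) = wh_real t" by (simp add: add_nonneg_eq_0_iff)
      then show ?thesis by (metis of_real_mult)
    qed
    finally show "- of_real t * ?k t - \<i> * ?k t = \<i> * of_real (- (wh_real t * exp (- t * x)))" by simp
  qed
  also have "\<dots> = \<i> * of_real (LBINT t:{0<..}. - (wh_real t * exp (- t * x)))"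
    by (simp only: set_integral_mult_right set_integral_complex_of_real)
  finally have "Re (D - \<i> * sol_right ?z) = 0" by simp
  then show ?thesis using D by auto
qed

lemma Im_sol_left_axis: assumes "x \<le> 0" shows "Im (sol (of_real x)) = 0"
proof -
  have "lap_left (of_real x) = (LBINT t:{0<..}. complex_of_real (1 / ((1 + t\<^sup>2) * wh_real t) * exp (t * x)))"
    unfolding lap_left_def
  proof (rule set_lebesgue_integral_cong, simp, intro allI impI)
    fix t :: real assume "t \<in> {0<..}"
    then have t: "t > 0" by simp
    have e: "exp (of_real t * of_real x) = complex_of_real (exp (t * x))" by (metis exp_of_real of_real_mult)
    show "dock_kernel (- of_real t) * exp (of_real t * of_real x) = complex_of_real (1 / ((1 + t\<^sup>2) * wh_real t) * exp (t * x))"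
      unfolding dock_kernel_of_real(2)[OF t] e by (simp only: of_real_mult)
  qed
  then have "lap_left (of_real x) = of_real (LBINT t:{0<..}. (1 / ((1 + t\<^sup>2) * wh_real t) * exp (t * x)))"
    by (simp only: set_integral_complex_of_real)
  then show ?thesis using sol_left_eq[of "of_real x"] assms by (simp add: sol_left_def)
qed

lemma Im_lap_right:
  assumes "x \<ge> 0"
  shows "Im (lap_right (Complex x y)) = (LBINT t:{0<..}. (t * cos (t * y) - sin (t * y)) / (1 + t\<^sup>2) * wh_real t * exp (- t * x))"
proof -
  have "Im (lap_right (Complex x y)) = (LBINT t:{0<..}. Im (dock_kernel (of_real t) * exp (- of_real t * Complex x y)))"
    unfolding lap_right_def by (rule Im_set_integral[OF lap_right_integrable]) (simp add: assms)
  also have "\<dots> = (LBINT t:{0<..}. (t * cos (t * y) - sin (t * y)) / (1 + t\<^sup>2) * wh_real t * exp (- t * x))"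
  proof (rule set_lebesgue_integral_cong, simp, intro allI impI)
    fix t :: real assume "t \<in> {0<..}"
    then have t: "t > 0" by simp
    have "Im (dock_kernel (of_real t) * exp (- of_real t * Complex x y)) = wh_real t / (1 + t\<^sup>2) * Im ((1 + \<i> * of_real t) * exp (- of_real t * Complex x y))"
      unfolding dock_kernel_of_real(1)[OF t] mult.assoc by (simp only: Im_complex_of_real_mult)
    also have "Im ((1 + \<i> * of_real t) * exp (- of_real t * Complex x y)) = exp (- t * x) * (t * cos (t * y) - sin (t * y))"
      by (simp add: Im_exp Re_exp algebra_simps)
    finally show "Im (dock_kernel (of_real t) * exp (- of_real t * Complex x y)) = (t * cos (t * y) - sin (t * y)) / (1 + t\<^sup>2) * wh_real t * exp (- t * x)"
      by (simp add: mult_ac)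
  qed
  finally show ?thesis .
qed

lemma Im_lap_left:
  assumes "x \<le> 0"
  shows "Im (lap_left (Complex x y)) = (LBINT t:{0<..}. sin (t * y) / (1 + t\<^sup>2) * (1 / wh_real t) * exp (t * x))"
proof -
  have "Im (lap_left (Complex x y)) = (LBINT t:{0<..}. Im (dock_kernel (- of_real t) * exp (of_real t * Complex x y)))"
    unfolding lap_left_def by (rule Im_set_integral[OF lap_left_integrable]) (simp add: assms)
  also have "\<dots> = (LBINT t:{0<..}. sin (t * y) / (1 + t\<^sup>2) * (1 / wh_real t) * exp (t * x))"
  proof (rule set_lebesgue_integral_cong, simp, intro allI impI)
    fix t :: real assume "t \<in> {0<..}"
    then have t: "t > 0" by simp
    have "Im (dock_kernel (- of_real t) * exp (of_real t * Complex x y)) = 1 / ((1 + t\<^sup>2) * wh_real t) * Im (exp (of_real t * Complex x y))"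
      unfolding dock_kernel_of_real(2)[OF t] by (simp only: Im_complex_of_real_mult)
    also have "Im (exp (of_real t * Complex x y)) = exp (t * x) * sin (t * y)"
      by (simp add: Im_exp)
    finally show "Im (dock_kernel (- of_real t) * exp (of_real t * Complex x y)) = sin (t * y) / (1 + t\<^sup>2) * (1 / wh_real t) * exp (t * x)"
      by (simp add: mult_ac)
  qed
  finally show ?thesis .
qed

text \<open>At \<open>x = 11 \<pi> / 8\<close> the sine is \<open>- 1\<close>, and on the boundary the integral that is subtracted is nonnegative.\<close>

lemma sol_nonzero: "Im (sol (of_real (11 * pi / 8))) \<noteq> 0"
proof -
  let ?x = "11 * pi / 8"
  have "0 \<le> (LBINT t:{0<..}. (t * cos (t * 0) - sin (t * 0)) / (1 + t\<^sup>2) * wh_real t * exp (- t * ?x))"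
    unfolding set_lebesgue_integral_def
    by (rule integral_nonneg_AE) (auto simp: indicator_def less_imp_le[OF wh_real_pos])
  then have "0 \<le> Im (lap_right (of_real ?x))"
    using Im_lap_right[of ?x 0] by (simp add: complex_of_real_def)
  moreover have "Im (exp (\<i> * of_real ?x + \<i> * of_real (pi / 8))) = - 1"
  proof -
    have "?x + pi / 8 = pi + pi / 2" by (simp add: field_simps)
    then have "sin (?x + pi / 8) = - 1" using sin_periodic_pi2[of "pi/2"] by simp
    moreover have "\<i> * of_real ?x + \<i> * of_real (pi / 8) = \<i> * complex_of_real (?x + pi / 8)"
      by (simp only: of_real_add distrib_left)
    ultimately show ?thesis by (simp only: Im_exp) simp
  qed
  moreover have "sol (of_real ?x) = sol_right (of_real ?x)" by (simp add: sol_def)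
  moreover have "Im (of_real (sqrt 2 / (2 * pi)) * lap_right (of_real ?x)) = sqrt 2 / (2 * pi) * Im (lap_right (of_real ?x))"
    by (simp only: Im_complex_of_real_mult)
  moreover have "0 \<le> sqrt 2 / (2 * pi) * Im (lap_right (of_real ?x))"
    using calculation(1) by (intro mult_nonneg_nonneg) auto
  ultimately show ?thesis unfolding sol_right_def by (simp only: minus_complex.sel)
qed

lemma Im_holomorphic_C1:
  fixes w :: "real \<times> real \<Rightarrow> real"
  assumes g: "g holomorphic_on {z. Im z > 0}"
    and w: "\<And>x y. y > 0 \<Longrightarrow> w (x, y) = Im (g (Complex x y))"
  shows "C1_on upper_half_plane w"
    "\<And>x y. y > 0 \<Longrightarrow> dx w (x, y) = Im (deriv g (Complex x y))"
    "\<And>x y. y > 0 \<Longrightarrow> dy w (x, y) = Im (\<i> * deriv g (Complex x y))"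
proof -
  have o: "open {z. Im z > 0}" by (rule open_halfspace_Im_gt)
  have gd: "(g has_field_derivative deriv g (Complex x y)) (at (Complex x y))" if "y > 0" for x y
    using holomorphic_derivI[OF g o, of "Complex x y"] that by simp
  have X: "((\<lambda>s. w (s, y)) has_real_derivative Im (deriv g (Complex x y))) (at x)" if "y > 0" for x y
  proof -
    have "((\<lambda>s. Complex s y) has_vector_derivative 1) (at x)"
      unfolding Complex_eq by (auto intro!: derivative_eq_intros)
    from field_vector_diff_chain_at[OF this gd[OF that]]
    have "((\<lambda>s. g (Complex s y)) has_vector_derivative deriv g (Complex x y)) (at x)" by (simp add: o_def)
    from bounded_linear.has_vector_derivative[OF bounded_linear_Im this]
    show ?thesis using w[OF that] by (simp add: has_real_derivative_iff_has_vector_derivative)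
  qed
  have Y: "((\<lambda>t. w (x, t)) has_real_derivative Im (\<i> * deriv g (Complex x y))) (at y)" if "y > 0" for x y
  proof -
    have "((\<lambda>t. Complex x t) has_vector_derivative \<i>) (at y)"
      unfolding Complex_eq by (auto intro!: derivative_eq_intros)
    from field_vector_diff_chain_at[OF this gd[OF that]]
    have "((\<lambda>t. g (Complex x t)) has_vector_derivative \<i> * deriv g (Complex x y)) (at y)" by (simp add: o_def)
    from bounded_linear.has_vector_derivative[OF bounded_linear_Im this]
    have "((\<lambda>t. Im (g (Complex x t))) has_real_derivative Im (\<i> * deriv g (Complex x y))) (at y)"
      by (simp only: has_real_derivative_iff_has_vector_derivative)
    then show ?thesis
      by (rule has_field_derivative_transform_within_open[of _ _ _ "{0<..}"]) (use that w in auto)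
  qed
  show dxw: "dx w (x, y) = Im (deriv g (Complex x y))" if "y > 0" for x y
    using X[OF that, of x] by (simp add: dx_def DERIV_imp_deriv)
  show dyw: "dy w (x, y) = Im (\<i> * deriv g (Complex x y))" if "y > 0" for x y
    using Y[OF that, of x] by (simp only: dy_def DERIV_imp_deriv prod.case)
  have c: "continuous_on upper_half_plane (\<lambda>p. deriv g (Complex (fst p) (snd p)))"
    unfolding Complex_eq
    by (rule continuous_on_compose2[OF holomorphic_on_imp_continuous_on[OF holomorphic_deriv[OF g o]]])
       (auto intro!: continuous_intros)
  show "C1_on upper_half_plane w"
    unfolding C1_on_def
  proof (intro conjI)
    show "\<forall>(x, y)\<in>upper_half_plane. (\<lambda>s. w (s, y)) differentiable at x \<and> (\<lambda>t. w (x, t)) differentiable at y"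
      using X Y real_differentiable_def by fastforce
    show "continuous_on upper_half_plane (dx w)"
      by (rule continuous_on_eq[where f="\<lambda>p. Im (deriv g (Complex (fst p) (snd p)))"])
         (use dxw in \<open>auto intro!: continuous_intros c\<close>)
    show "continuous_on upper_half_plane (dy w)"
      by (rule continuous_on_eq[where f="\<lambda>p. Im (\<i> * deriv g (Complex (fst p) (snd p)))"])
         (use dyw in \<open>auto intro!: continuous_intros c\<close>)
  qed
qed

lemma Im_holomorphic_harmonic:
  fixes w :: "real \<times> real \<Rightarrow> real"
  assumes g: "g holomorphic_on {z. Im z > 0}"
    and w: "\<And>x y. y > 0 \<Longrightarrow> w (x, y) = Im (g (Complex x y))"
  shows "C2_on upper_half_plane w" and "\<And>x y. y > 0 \<Longrightarrow> laplacian w (x, y) = 0"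
proof -
  have o: "open {z. Im z > 0}" by (rule open_halfspace_Im_gt)
  have g1: "deriv g holomorphic_on {z. Im z > 0}" by (rule holomorphic_deriv[OF g o])
  have g2: "(\<lambda>z. \<i> * deriv g z) holomorphic_on {z. Im z > 0}" by (intro holomorphic_intros g1)
  have 0: "C1_on upper_half_plane w" "\<And>x y. y > 0 \<Longrightarrow> dx w (x, y) = Im (deriv g (Complex x y))"
     "\<And>x y. y > 0 \<Longrightarrow> dy w (x, y) = Im (\<i> * deriv g (Complex x y))"
    using Im_holomorphic_C1[OF g, of w] w by blast+
  have 1: "C1_on upper_half_plane (dx w)" "\<And>x y. y > 0 \<Longrightarrow> dx (dx w) (x, y) = Im (deriv (deriv g) (Complex x y))"
    using Im_holomorphic_C1(1,2)[OF g1, of "dx w"] 0(2) by blast+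
  have 2: "C1_on upper_half_plane (dy w)" "\<And>x y. y > 0 \<Longrightarrow> dy (dy w) (x, y) = Im (\<i> * deriv (\<lambda>z. \<i> * deriv g z) (Complex x y))"
    using Im_holomorphic_C1(1,3)[OF g2, of "dy w"] 0(3) by blast+
  show "C2_on upper_half_plane w" using 0(1) 1(1) 2(1) by (simp add: C2_on_def)
  show "laplacian w (x, y) = 0" if "y > 0" for x y
  proof -
    have "deriv g field_differentiable at (Complex x y)"
      using g1 o that by (auto intro: holomorphic_on_imp_differentiable_at)
    then show ?thesis unfolding laplacian_def 1(2)[OF that] 2(2)[OF that]
      by (simp add: deriv_cmult)
  qed
qed

definition dock_mode :: "real \<Rightarrow> real \<times> real \<Rightarrow> real" where
  "dock_mode l = (\<lambda>p. Im (sol (Complex (l * fst p) (l * snd p))))"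

lemma explicit_solution:
  fixes l :: real
  assumes l: "l > 0"
  defines "u \<equiv> dock_mode l"
  shows "bounded_mixed_steklov_solution l {0<..} u"
proof -
  have uhol: "(\<lambda>z. sol (of_real l * z)) holomorphic_on {z. Im z > 0}"
  proof -
    have "(sol \<circ> (\<lambda>z. of_real l * z)) holomorphic_on {z. Im z > 0}"
      by (rule holomorphic_on_compose_gen[OF _ sol_holomorphic]) (use l in \<open>auto intro!: holomorphic_intros\<close>)
    then show ?thesis by (simp add: o_def)
  qed
  have sc: "of_real l * Complex x y = Complex (l * x) (l * y)" for x y by (simp add: complex_eq_iff)
  have w: "u (x, y) = Im (sol (of_real l * Complex x y))" for x y by (simp add: u_def dock_mode_def sc)
  note harm = Im_holomorphic_harmonic[OF uhol w]
  obtain B where B: "\<And>z. Im z \<ge> 0 \<Longrightarrow> norm (sol z) \<le> B" using sol_bounded by blast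
  have cont: "continuous_on closed_upper_half_plane u"
    unfolding u_def dock_mode_def Complex_eq
    by (intro continuous_on_Im continuous_on_compose2[OF sol_continuous])
       (use l in \<open>auto intro!: continuous_intros\<close>)
  have bdd: "bounded (u ` closed_upper_half_plane)"
  proof (rule boundedI)
    fix v assume "v \<in> u ` closed_upper_half_plane"
    then obtain x y where xy: "y \<ge> 0" "v = u (x, y)" by auto
    have "\<bar>u (x, y)\<bar> \<le> norm (sol (Complex (l * x) (l * y)))" unfolding u_def dock_mode_def using abs_Im_le_cmod by simp
    also have "\<dots> \<le> B" using xy l by (intro B) simp
    finally show "norm v \<le> B" using xy by simp
  qed
  have rob: "((\<lambda>y. (u (x, y) - u (x, 0)) / y) \<longlongrightarrow> - l * u (x, 0)) (at_right 0)" if x: "x > 0" for x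
  proof -
    obtain D where D: "(sol_right has_field_derivative D) (at (of_real (l * x)))" "Re D = - Im (sol_right (of_real (l * x)))"
      using sol_Robin[of "l * x"] l x by auto
    have c0: "Complex (l * x) (l * 0) = of_real (l * x)" by (simp add: complex_eq_iff)
    have u0: "u (x, y) = Im (sol_right (Complex (l * x) (l * y)))" for y
      using l x by (simp add: u_def dock_mode_def sol_def)
    have "((\<lambda>y. Complex (l * x) (l * y)) has_vector_derivative \<i> * of_real l) (at 0)"
      unfolding Complex_eq by (auto intro!: derivative_eq_intros)
    from field_vector_diff_chain_at[OF this, of sol_right D] D(1)
    have "((\<lambda>y. sol_right (Complex (l * x) (l * y))) has_vector_derivative \<i> * of_real l * D) (at 0)"
      unfolding c0 by (simp add: o_def)
    from bounded_linear.has_vector_derivative[OF bounded_linear_Im this]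
    have "((\<lambda>y. u (x, y)) has_real_derivative Im (\<i> * of_real l * D)) (at 0)"
      unfolding u0 by (simp only: has_real_derivative_iff_has_vector_derivative)
    then have "((\<lambda>y. (u (x, y) - u (x, 0)) / (y - 0)) \<longlongrightarrow> Im (\<i> * of_real l * D)) (at 0)"
      by (simp only: has_field_derivative_iff)
    then have "((\<lambda>y. (u (x, y) - u (x, 0)) / (y - 0)) \<longlongrightarrow> Im (\<i> * of_real l * D)) (at_right 0)"
      by (rule tendsto_within_subset) simp
    moreover have "Im (\<i> * of_real l * D) = - l * u (x, 0)"
      unfolding u0 c0 by (simp add: D(2))
    ultimately show ?thesis by simp
  qed
  have zero: "u (x, 0) = 0" if "x \<notin> {0<..}" for x
  proof -
    have "l * x \<le> 0" using that l by (simp add: mult_nonneg_nonpos)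
    then show ?thesis using Im_sol_left_axis[of "l * x"] by (simp add: u_def dock_mode_def complex_of_real_def)
  qed
  show ?thesis unfolding bounded_mixed_steklov_solution_def mixed_steklov_solution_def
    using cont bdd harm rob zero by simp
qed

lemma explicit_solution_formula:
  fixes l :: real
  assumes l: "l > 0"
  defines "u \<equiv> dock_mode l"
  shows "x \<ge> 0 \<Longrightarrow> u (x, y) =
       exp (- l * y) * sin (l * x + pi / 8)
       - sqrt 2 / (2 * pi) *
         (LBINT t:{0..}. (t * cos (t * l * y) - sin (t * l * y)) / (1 + t\<^sup>2)
            * exp (- (1 / pi) * (LBINT s:{0..}. ln (t + s) / (1 + s\<^sup>2)))
            * exp (- t * l * x))"
    and "x \<le> 0 \<Longrightarrow> y \<ge> 0 \<Longrightarrow> u (x, y) =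
       sqrt 2 / (2 * pi) *
         (LBINT t:{0..}. sin (t * l * y) / (1 + t\<^sup>2)
            * exp (1 / pi * (LBINT s:{0..}. ln (t + s) / (1 + s\<^sup>2)))
            * exp (t * l * x))"
proof -
  have inv: "exp (1 / pi * (LBINT s:{0<..}. ln (t + s) / (1 + s\<^sup>2))) = 1 / wh_real t" for t
    by (simp add: wh_real_def exp_minus inverse_eq_divide)
  show "u (x, y) =
       exp (- l * y) * sin (l * x + pi / 8)
       - sqrt 2 / (2 * pi) *
         (LBINT t:{0..}. (t * cos (t * l * y) - sin (t * l * y)) / (1 + t\<^sup>2)
            * exp (- (1 / pi) * (LBINT s:{0..}. ln (t + s) / (1 + s\<^sup>2)))
            * exp (- t * l * x))" if x: "x \<ge> 0"
  proof -
    have "Im (exp (\<i> * Complex (l * x) (l * y) + \<i> * of_real (pi / 8))) = exp (- l * y) * sin (l * x + pi / 8)"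
      by (simp add: Im_exp)
    moreover have "sol (Complex (l * x) (l * y)) = sol_right (Complex (l * x) (l * y))" using x l by (simp add: sol_def)
    moreover have "0 \<le> l * x" using x l by simp
    ultimately show ?thesis
      unfolding set_integral_atLeast_greaterThan wh_real_def[symmetric] u_def dock_mode_def sol_right_def
      by (simp only: fst_conv snd_conv minus_complex.sel Im_complex_of_real_mult Im_lap_right mult.assoc sol_right_def)
  qed
  show "u (x, y) =
       sqrt 2 / (2 * pi) *
         (LBINT t:{0..}. sin (t * l * y) / (1 + t\<^sup>2)
            * exp (1 / pi * (LBINT s:{0..}. ln (t + s) / (1 + s\<^sup>2)))
            * exp (t * l * x))" if x: "x \<le> 0" and y: "y \<ge> 0"
  proof -
    have "sol (Complex (l * x) (l * y)) = sol_left (Complex (l * x) (l * y))"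
      by (rule sol_left_eq) (use x y l in \<open>auto simp: mult_nonneg_nonpos\<close>)
    moreover have "l * x \<le> 0" using x l by (simp add: mult_nonneg_nonpos)
    ultimately show ?thesis
      unfolding set_integral_atLeast_greaterThan inv u_def dock_mode_def sol_left_def
      by (simp only: fst_conv snd_conv Im_complex_of_real_mult Im_lap_left mult.assoc sol_left_def)
  qed
qed

lemma explicit_solution_nonzero:
  fixes l :: real
  assumes l: "l > 0"
  defines "u \<equiv> dock_mode l"
  shows "u (11 * pi / 8 / l, 0) \<noteq> 0"
  using sol_nonzero l by (simp add: u_def dock_mode_def complex_of_real_def)

section \<open>Harmonic conjugates in the half-plane\<close>

lemma C1_on_DERIV:
  assumes "C1_on S w" "(x, y) \<in> S"
  shows "((\<lambda>s. w (s, y)) has_real_derivative dx w (x, y)) (at x)"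
    "((\<lambda>t. w (x, t)) has_real_derivative dy w (x, y)) (at y)"
proof -
  have "\<forall>p\<in>S. case p of (x, y) \<Rightarrow> (\<lambda>s. w (s, y)) differentiable at x \<and> (\<lambda>t. w (x, t)) differentiable at y"
    using assms(1) unfolding C1_on_def by blast
  from bspec[OF this assms(2)]
  have "(\<lambda>s. w (s, y)) differentiable at x" "(\<lambda>t. w (x, t)) differentiable at y" by auto
  then show "((\<lambda>s. w (s, y)) has_real_derivative dx w (x, y)) (at x)"
    "((\<lambda>t. w (x, t)) has_real_derivative dy w (x, y)) (at y)"
    unfolding dx_def dy_def prod.case by (simp_all only: DERIV_deriv_iff_real_differentiable)
qed

lemma C1_on_upper_has_derivative:
  assumes w: "C1_on upper_half_plane w" and y: "y > 0"
  shows "(w has_derivative (\<lambda>(s, t). dx w (x, y) * s + dy w (x, y) * t)) (at (x, y))"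
proof -
  define F where "F a b = blinfun_mult_right (dy w (a, b))" for a b
  have "((\<lambda>(a, b). w (a, b)) has_derivative (\<lambda>(s, t). (dx w (x, y) * s) + blinfun_apply (F x y) t)) (at (x, y) within UNIV \<times> {0<..})"
  proof (rule has_derivative_partialsI)
    show "((\<lambda>a. w (a, y)) has_derivative (*) (dx w (x, y))) (at x)"
      using C1_on_DERIV(1)[OF w, of x y] y by (simp add: has_field_derivative_def)
    show "((\<lambda>b. w (a, b)) has_derivative blinfun_apply (F a b)) (at b within {0<..})" if "b \<in> {0<..}" for a b
      using C1_on_DERIV(2)[OF w, of a b] that by (simp add: has_field_derivative_def F_def has_derivative_at_withinI)
    have "continuous_on (UNIV \<times> {0<..}) (\<lambda>p. blinfun_mult_right (dy w p))"
      using w unfolding C1_on_def by (intro bounded_linear.continuous_on[OF bounded_linear_blinfun_mult_right]) auto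
    then show "continuous (at (x, y) within UNIV \<times> {0<..}) (\<lambda>(a, b). F a b)"
      using y unfolding F_def case_prod_beta prod.collapse by (simp add: continuous_on_eq_continuous_within)
  qed (use y in auto)
  moreover have "at (x, y) within UNIV \<times> {0<..} = at (x, y)"
    by (rule at_within_open) (use y in \<open>auto intro!: open_Times\<close>)
  ultimately show ?thesis by (simp add: F_def case_prod_beta)
qed

text \<open>Clairaut's theorem: the second difference over a small square is, by the mean value theorem, a value of
  either mixed derivative.\<close>

lemma mixed_partials_commute:
  assumes v: "C2_on upper_half_plane v" and y: "y > 0"
  shows "dy (dx v) (x, y) = dx (dy v) (x, y)"
proof -
  have c: "C1_on upper_half_plane v" "C1_on upper_half_plane (dx v)" "C1_on upper_half_plane (dy v)"
    using v by (auto simp: C2_on_def)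
  have box: "\<exists>p q. dy (dx v) p = dx (dy v) q \<and> dist p (x, y) \<le> 2 * h \<and> dist q (x, y) \<le> 2 * h \<and> p \<in> upper_half_plane \<and> q \<in> upper_half_plane"
    if h: "h > 0" for h
  proof -
    define S where "S = v (x + h, y + h) - v (x + h, y) - (v (x, y + h) - v (x, y))"
    obtain \<xi> where \<xi>: "x < \<xi>" "\<xi> < x + h" "S = h * (dx v (\<xi>, y + h) - dx v (\<xi>, y))"
    proof -
      have "\<exists>z>x. z < x + h \<and> (v (x + h, y + h) - v (x + h, y)) - (v (x, y + h) - v (x, y)) = (x + h - x) * (dx v (z, y + h) - dx v (z, y))"
        by (rule MVT2) (use h y in \<open>auto intro!: DERIV_diff C1_on_DERIV[OF c(1)]\<close>)
      then show ?thesis using that by (auto simp: S_def)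
    qed
    have "\<exists>z>y. z < y + h \<and> dx v (\<xi>, y + h) - dx v (\<xi>, y) = (y + h - y) * dy (dx v) (\<xi>, z)"
      by (rule MVT2) (use h y in \<open>auto intro!: C1_on_DERIV[OF c(2)]\<close>)
    then obtain \<eta> where \<eta>: "y < \<eta>" "\<eta> < y + h" "dx v (\<xi>, y + h) - dx v (\<xi>, y) = h * dy (dx v) (\<xi>, \<eta>)" by auto
    obtain \<eta>' where \<eta>': "y < \<eta>'" "\<eta>' < y + h" "S = h * (dy v (x + h, \<eta>') - dy v (x, \<eta>'))"
    proof -
      have "\<exists>z>y. z < y + h \<and> (v (x + h, y + h) - v (x, y + h)) - (v (x + h, y) - v (x, y)) = (y + h - y) * (dy v (x + h, z) - dy v (x, z))"
        by (rule MVT2) (use h y in \<open>auto intro!: DERIV_diff C1_on_DERIV[OF c(1)]\<close>)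
      then show ?thesis using that by (auto simp: S_def)
    qed
    have "\<exists>z>x. z < x + h \<and> dy v (x + h, \<eta>') - dy v (x, \<eta>') = (x + h - x) * dx (dy v) (z, \<eta>')"
      by (rule MVT2) (use h y \<eta>' in \<open>auto intro!: C1_on_DERIV[OF c(3)]\<close>)
    then obtain \<xi>' where \<xi>': "x < \<xi>'" "\<xi>' < x + h" "dy v (x + h, \<eta>') - dy v (x, \<eta>') = h * dx (dy v) (\<xi>', \<eta>')" by auto
    have "h * (h * dy (dx v) (\<xi>, \<eta>)) = h * (h * dx (dy v) (\<xi>', \<eta>'))"
      using \<xi>(3) \<eta>'(3) unfolding \<eta>(3) \<xi>'(3) by metis
    then have eq: "dy (dx v) (\<xi>, \<eta>) = dx (dy v) (\<xi>', \<eta>')" using h by simp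
    have d: "dist (a, b) (x, y) \<le> 2 * h" if "x < a" "a < x + h" "y < b" "b < y + h" for a b
    proof -
      have "dist (a, b) (x, y) \<le> \<bar>a - x\<bar> + \<bar>b - y\<bar>" unfolding dist_Pair_Pair dist_real_def by (rule sqrt_sum_squares_le_sum) auto
      also have "\<dots> \<le> 2 * h" using that by simp
      finally show ?thesis .
    qed
    show ?thesis
      by (rule exI[of _ "(\<xi>, \<eta>)"], rule exI[of _ "(\<xi>', \<eta>')"]) (use eq d \<xi> \<eta> \<xi>' \<eta>' y in auto)
  qed
  define h where "h n = inverse (real (Suc n))" for n
  have "\<exists>pq. dy (dx v) (fst pq) = dx (dy v) (snd pq) \<and> dist (fst pq) (x, y) \<le> 2 * h n \<and> dist (snd pq) (x, y) \<le> 2 * h n \<and> fst pq \<in> upper_half_plane \<and> snd pq \<in> upper_half_plane" for n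
  proof -
    have "h n > 0" by (simp add: h_def)
    then obtain p q where "dy (dx v) p = dx (dy v) q" "dist p (x, y) \<le> 2 * h n" "dist q (x, y) \<le> 2 * h n"
      "p \<in> upper_half_plane" "q \<in> upper_half_plane" using box by blast
    then show ?thesis by (intro exI[of _ "(p, q)"]) simp
  qed
  then obtain P where P: "\<And>n. dy (dx v) (fst (P n)) = dx (dy v) (snd (P n))"
    "\<And>n. dist (fst (P n)) (x, y) \<le> 2 * h n" "\<And>n. dist (snd (P n)) (x, y) \<le> 2 * h n"
    "\<And>n. fst (P n) \<in> upper_half_plane" "\<And>n. snd (P n) \<in> upper_half_plane"
    by metis
  have z: "(\<lambda>n. 2 * h n) \<longlonglongrightarrow> 0"
    using tendsto_mult_right_zero[OF LIMSEQ_inverse_real_of_nat, of 2] by (simp only: h_def)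
  have "(\<lambda>n. dist (fst (P n)) (x, y)) \<longlonglongrightarrow> 0"
    by (rule Lim_null_comparison[OF _ z]) (simp add: P(2))
  then have lim1: "(\<lambda>n. fst (P n)) \<longlonglongrightarrow> (x, y)" by (subst tendsto_dist_iff)
  have "(\<lambda>n. dist (snd (P n)) (x, y)) \<longlonglongrightarrow> 0"
    by (rule Lim_null_comparison[OF _ z]) (simp add: P(3))
  then have lim2: "(\<lambda>n. snd (P n)) \<longlonglongrightarrow> (x, y)" by (subst tendsto_dist_iff)
  have xy: "(x, y) \<in> upper_half_plane" using y by simp
  have cA: "continuous_on upper_half_plane (dy (dx v))" "continuous_on upper_half_plane (dx (dy v))"
    using c by (auto simp: C1_on_def)
  have "(\<lambda>n. dy (dx v) (fst (P n))) \<longlonglongrightarrow> dy (dx v) (x, y)"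
    by (rule continuous_on_tendsto_compose[OF cA(1) lim1 xy]) (simp only: P eventually_True)
  moreover have "(\<lambda>n. dx (dy v) (snd (P n))) \<longlonglongrightarrow> dx (dy v) (x, y)"
    by (rule continuous_on_tendsto_compose[OF cA(2) lim2 xy]) (simp only: P eventually_True)
  ultimately show ?thesis using P(1) LIMSEQ_unique by auto
qed

text \<open>By Laplace's equation and Clairaut's theorem \<open>v\<^sub>y + \<i> v\<^sub>x\<close> satisfies the Cauchy-Riemann equations. A primitive
  of it has imaginary part \<open>v\<close> up to a constant.\<close>

lemma harmonic_conjugate_exists:
  assumes v: "C2_on upper_half_plane v" and lap: "\<And>x y. y > 0 \<Longrightarrow> laplacian v (x, y) = 0"
  obtains f where "f holomorphic_on {z. Im z > 0}" "\<And>z. Im z > 0 \<Longrightarrow> v (Re z, Im z) = Im (f z)"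
proof -
  let ?U = "{z::complex. Im z > 0}"
  have U: "open ?U" "convex ?U" by (auto simp: open_halfspace_Im_gt convex_halfspace_Im_gt)
  have c: "C1_on upper_half_plane v" "C1_on upper_half_plane (dx v)" "C1_on upper_half_plane (dy v)"
    using v by (auto simp: C2_on_def)
  define \<phi> where "\<phi> z = Complex (dy v (Re z, Im z)) (dx v (Re z, Im z))" for z
  have pd: "((\<lambda>z. (Re z, Im z)) has_derivative (\<lambda>h. (Re h, Im h))) (at z)" for z
    by (auto intro!: derivative_eq_intros)
  have tot: "((\<lambda>z. w (Re z, Im z)) has_derivative (\<lambda>h. dx w (Re z, Im z) * Re h + dy w (Re z, Im z) * Im h)) (at z)"
    if "C1_on upper_half_plane w" "Im z > 0" for w z
    using has_derivative_compose[OF pd[of z], OF C1_on_upper_has_derivative[OF that, of "Re z"]] by simp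
  have \<phi>hol: "\<phi> holomorphic_on ?U"
  proof (rule holomorphic_onI)
    fix z assume z: "z \<in> ?U"
    define a b where "a = dx (dy v) (Re z, Im z)" and "b = dy (dy v) (Re z, Im z)"
    have s: "dx (dx v) (Re z, Im z) = - b" "dy (dx v) (Re z, Im z) = a"
      using lap[of "Im z" "Re z"] mixed_partials_commute[OF v, of "Im z" "Re z"] z by (auto simp: a_def b_def laplacian_def)
    have "(\<phi> has_derivative (\<lambda>h. of_real (a * Re h + b * Im h) + \<i> * of_real (- b * Re h + a * Im h))) (at z)"
      unfolding \<phi>_def Complex_eq
      using tot[OF c(3), of z] tot[OF c(2), of z] z unfolding s a_def[symmetric] b_def[symmetric]
      by (intro has_derivative_add has_derivative_mult_right has_derivative_of_real) auto
    moreover have "(\<lambda>h. of_real (a * Re h + b * Im h) + \<i> * of_real (- b * Re h + a * Im h)) = (*) (Complex a (- b))"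
      by (auto simp: fun_eq_iff complex_eq_iff algebra_simps)
    ultimately have "(\<phi> has_field_derivative Complex a (- b)) (at z)" by (simp add: has_field_derivative_def)
    then show "\<phi> field_differentiable at z within ?U"
      using field_differentiable_def has_field_derivative_at_within by blast
  qed
  obtain F where F: "\<And>z. z \<in> ?U \<Longrightarrow> (F has_field_derivative \<phi> z) (at z within ?U)"
    using holomorphic_convex_primitive'[OF U(2,1) \<phi>hol] by blast
  have "((\<lambda>z. v (Re z, Im z) - Im (F z)) has_derivative (\<lambda>h. 0)) (at z within ?U)" if z: "z \<in> ?U" for z
  proof -
    have "((\<lambda>z. Im (F z)) has_derivative (\<lambda>h. Im (\<phi> z * h))) (at z within ?U)"
      using F[OF z] unfolding has_field_derivative_def by (rule has_derivative_Im)
    from has_derivative_diff[OF has_derivative_at_withinI[OF tot[OF c(1), of z]] this]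
    show ?thesis using z by (simp add: \<phi>_def algebra_simps)
  qed
  from has_derivative_zero_constant[OF U(2) this]
  obtain k where k: "\<And>z. z \<in> ?U \<Longrightarrow> v (Re z, Im z) - Im (F z) = k" by auto
  show ?thesis
  proof
    have "F holomorphic_on ?U" using F by (auto simp: holomorphic_on_def field_differentiable_def)
    then show "(\<lambda>z. F z + \<i> * of_real k) holomorphic_on ?U" by (intro holomorphic_intros)
    show "Im z > 0 \<Longrightarrow> v (Re z, Im z) = Im (F z + \<i> * of_real k)" for z using k[of z] by simp
  qed
qed

section \<open>Reflection across a Neumann boundary\<close>

definition real_poly :: "nat \<Rightarrow> (nat \<Rightarrow> real) \<Rightarrow> complex \<Rightarrow> complex" where
  "real_poly n a z = (\<Sum>k\<le>n. of_real (a k) * z ^ k)"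

lemma real_poly_cnj: "real_poly n a (cnj z) = cnj (real_poly n a z)"
  by (simp add: real_poly_def)

lemma real_poly_holomorphic: "(\<lambda>z. real_poly n a (z - c)) holomorphic_on S"
  unfolding real_poly_def by (intro holomorphic_intros)

text \<open>On the circle \<open>|z| = r\<close> every polynomial in \<open>Re z\<close> is the real part of a polynomial with real coefficients:
  multiplication of \<open>Re (z ^ k)\<close> by \<open>Re z\<close> gives the mean of \<open>Re (z ^ (k + 1))\<close> and \<open>r\<^sup>2 Re (z ^ (k - 1))\<close>.\<close>

lemma Re_power_on_circle:
  assumes r: "r > 0"
  shows "\<exists>n a. \<forall>z. norm z = r \<longrightarrow> Re (\<Sum>k\<le>n. of_real (a k) * z ^ k) = Re z ^ m"
proof (induction m)
  case 0
  show ?case by (rule exI[of _ 0], rule exI[of _ "\<lambda>_. 1"]) simp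
next
  case (Suc m)
  then obtain n a where a: "\<And>z. norm z = r \<Longrightarrow> Re (\<Sum>k\<le>n. of_real (a k) * z ^ k) = Re z ^ m" by blast
  \<comment> \<open>The three terms come from \<open>z ^ (k + 1)\<close>, from \<open>r\<^sup>2 z ^ (k - 1)\<close> and from the constant term, for which \<open>Re (cnj z) = Re z\<close>.\<close>
  define b where "b k = (if k = 0 then 0 else a (k - 1) / 2) + (if k < n then r\<^sup>2 * a (Suc k) / 2 else 0) + (if k = 1 then a 0 / 2 else 0)" for k
  have "Re (\<Sum>k\<le>Suc n. of_real (b k) * z ^ k) = Re z ^ Suc m" if z: "norm z = r" for z
  proof -
    have zz: "Re (cnj z * z ^ Suc k) = r\<^sup>2 * Re (z ^ k)" for k
    proof -
      have "cnj z * z ^ Suc k = of_real (r\<^sup>2) * z ^ k"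
        using complex_norm_square[of z] z by (simp add: mult_ac)
      then have "Re (cnj z * z ^ Suc k) = Re (of_real (r\<^sup>2) * z ^ k)" by (rule arg_cong)
      also have "\<dots> = r\<^sup>2 * Re (z ^ k)" by (simp del: of_real_power)
      finally show ?thesis .
    qed
    have tw: "Re z * Re q = (Re (z * q) + Re (cnj z * q)) / 2" for q by (simp add: field_simps)
    have t: "Re z * (c * Re (z ^ k)) = c / 2 * Re (z ^ Suc k) + c / 2 * Re (cnj z * z ^ k)" for c k
    proof -
      have "Re z * (c * Re (z ^ k)) = c * (Re z * Re (z ^ k))" by (rule mult.left_commute)
      also have "\<dots> = c * ((Re (z ^ Suc k) + Re (cnj z * z ^ k)) / 2)" by (simp only: tw power_Suc)
      also have "\<dots> = c / 2 * Re (z ^ Suc k) + c / 2 * Re (cnj z * z ^ k)"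
        by (simp only: distrib_left add_divide_distrib times_divide_eq_right times_divide_eq_left)
      finally show ?thesis .
    qed
    have "Re z ^ Suc m = Re z * (\<Sum>k\<le>n. a k * Re (z ^ k))" using a[OF z] by simp
    also have "\<dots> = (\<Sum>k\<le>n. a k / 2 * Re (z ^ Suc k)) + (\<Sum>k\<le>n. a k / 2 * Re (cnj z * z ^ k))"
      by (simp only: sum_distrib_left t sum.distrib)
    also have "(\<Sum>k\<le>n. a k / 2 * Re (cnj z * z ^ k)) = a 0 / 2 * Re z + (\<Sum>k<n. r\<^sup>2 * a (Suc k) / 2 * Re (z ^ k))"
    proof -
      have "a 0 / 2 * Re (cnj z * z ^ 0) = a 0 / 2 * Re z" by simp
      moreover have "a (Suc k) / 2 * Re (cnj z * z ^ Suc k) = r\<^sup>2 * a (Suc k) / 2 * Re (z ^ k)" for k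
        unfolding zz by simp
      ultimately show ?thesis unfolding sum.atMost_shift by (simp only:)
    qed
    also have "(\<Sum>k\<le>n. a k / 2 * Re (z ^ Suc k)) = (\<Sum>k\<le>Suc n. (if k = 0 then 0 else a (k - 1) / 2) * Re (z ^ k))"
      unfolding sum.atMost_Suc_shift by (simp del: power_Suc)
    also have "(\<Sum>k<n. r\<^sup>2 * a (Suc k) / 2 * Re (z ^ k)) = (\<Sum>k\<le>Suc n. (if k < n then r\<^sup>2 * a (Suc k) / 2 else 0) * Re (z ^ k))"
      by (rule sum.mono_neutral_cong_left) auto
    also have "a 0 / 2 * Re z = (\<Sum>k\<le>Suc n. (if k = 1 then a 0 / 2 else 0) * Re (z ^ k))"
      by (subst sum.remove[of _ 1]) (auto simp: sum.neutral)
    finally have "Re z ^ Suc m = (\<Sum>k\<le>Suc n. b k * Re (z ^ k))"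
      unfolding b_def by (simp only: distrib_right sum.distrib)
    then show ?thesis by simp
  qed
  then show ?case by blast
qed

text \<open>A maximum principle for the half-disc in which the flat part of the boundary cannot carry the maximum,
  because \<open>e\<close> increases from each of its points into the interior.\<close>

lemma half_disc_maximum:
  fixes ctr r :: real and e :: "complex \<Rightarrow> real"
  defines "\<Omega> \<equiv> {z. norm (z - of_real ctr) \<le> r \<and> Im z \<ge> 0}"
  assumes r: "r > 0" and H: "H holomorphic_on {z. Im z > 0}" and e: "continuous_on \<Omega> e"
    and eH: "\<And>z. z \<in> \<Omega> \<Longrightarrow> Im z > 0 \<Longrightarrow> e z = Im (H z)"
    and arc: "\<And>z. norm (z - of_real ctr) = r \<Longrightarrow> Im z \<ge> 0 \<Longrightarrow> e z \<le> B"
    and flat: "\<And>t \<delta>. \<bar>t - ctr\<bar> < r \<Longrightarrow> \<delta> > 0 \<Longrightarrow> \<exists>y. 0 < y \<and> y < \<delta> \<and> e (of_real t) < e (Complex t y)"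
    and z: "z \<in> \<Omega>"
  shows "e z \<le> B"
proof -
  have \<Omega>: "\<Omega> = cball (of_real ctr) r \<inter> {z. Im z \<ge> 0}"
    by (auto simp: \<Omega>_def dist_norm norm_minus_commute)
  have "compact \<Omega>" unfolding \<Omega> by (intro compact_Int_closed compact_cball closed_halfspace_Im_ge)
  then obtain p where p: "p \<in> \<Omega>" "\<And>w. w \<in> \<Omega> \<Longrightarrow> e w \<le> e p"
    using continuous_attains_sup[of \<Omega> e] e z by blast
  have "e p \<le> B"
  proof (cases "norm (p - of_real ctr) = r")
    case True
    then show ?thesis using arc p by (simp add: \<Omega>_def)
  next
    case False
    then have pr: "norm (p - of_real ctr) < r" using p by (simp add: \<Omega>_def)
    show ?thesis
    proof (cases "Im p = 0")
      case True
      define t where "t = Re p"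
      have pt: "p = of_real t" using True by (simp add: t_def complex_eq_iff)
      have tr: "\<bar>t - ctr\<bar> < r" using pr unfolding pt by (metis norm_of_real of_real_diff)
      obtain y where y: "0 < y" "y < r - \<bar>t - ctr\<bar>" "e (of_real t) < e (Complex t y)"
        using flat[OF tr, of "r - \<bar>t - ctr\<bar>"] tr by auto
      have "norm (Complex t y - of_real ctr) \<le> \<bar>t - ctr\<bar> + \<bar>y\<bar>"
        using cmod_le[of "Complex t y - of_real ctr"] by simp
      then have "Complex t y \<in> \<Omega>" using y by (simp add: \<Omega>_def)
      then show ?thesis using p(2)[of "Complex t y"] y(3) pt by simp
    next
      case False
      let ?W = "ball (of_real ctr) r \<inter> {z. Im z > 0}"
      have W: "open ?W" "connected ?W" "?W \<subseteq> \<Omega>" "p \<in> ?W"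
        using p pr False by (auto simp: \<Omega> dist_norm norm_minus_commute intro!: open_Int open_halfspace_Im_gt convex_connected convex_Int convex_halfspace_Im_gt)
      \<comment> \<open>As \<open>|E| = exp e\<close>, an interior maximum of \<open>e\<close> makes \<open>E\<close> and thus \<open>e\<close> constant.\<close>
      define E where "E z = exp (- \<i> * H z)" for z
      have nE: "norm (E z) = exp (e z)" if "z \<in> ?W" for z
        using eH[of z] W(3) that by (auto simp: E_def norm_exp_eq_Re)
      have "E constant_on ?W"
      proof (rule maximum_modulus_principle[OF _ W(1,2) W(1) order_refl W(4)])
        show "E holomorphic_on ?W" unfolding E_def
          by (intro holomorphic_intros holomorphic_on_subset[OF H]) auto
        show "norm (E z) \<le> norm (E p)" if "z \<in> ?W" for z
          using nE[OF that] nE[OF W(4)] p(2)[of z] W(3) that by auto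
      qed
      then obtain k where k: "\<And>z. z \<in> ?W \<Longrightarrow> E z = k" by (auto simp: constant_on_def)
      have ek: "e z = e p" if "z \<in> ?W" for z
        using nE[OF that] nE[OF W(4)] k[OF that] k[OF W(4)] by simp
      \<comment> \<open>Points that tend to the top of the arc, where the bound by \<open>B\<close> is known.\<close>
      define q where "q n = Complex ctr (r * (1 - inverse (real (Suc (Suc n)))))" for n
      define q0 where "q0 = Complex ctr r"
      have inv: "0 < inverse (real (Suc (Suc n)))" "inverse (real (Suc (Suc n))) < 1" for n
        by (auto simp: inverse_less_1_iff)
      have qW: "q n \<in> ?W" for n
      proof -
        have "0 < r * (1 - inverse (real (Suc (Suc n))))" using inv[of n] r by simp
        moreover have "r * (1 - inverse (real (Suc (Suc n)))) < r * 1" using inv[of n] r by (intro mult_strict_left_mono) auto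
        moreover have "of_real ctr - q n = Complex 0 (- (r * (1 - inverse (real (Suc (Suc n))))))" by (simp add: q_def complex_eq_iff)
        moreover have "norm (Complex 0 a) = \<bar>a\<bar>" for a by (simp add: cmod_def)
        ultimately show ?thesis by (simp add: dist_norm) (simp add: q_def)
      qed
      have q0: "q0 \<in> \<Omega>" "norm (q0 - of_real ctr) = r" "Im q0 \<ge> 0"
        using r by (auto simp: q0_def \<Omega>_def cmod_def)
      have "(\<lambda>n. inverse (real (Suc (Suc n)))) \<longlonglongrightarrow> 0"
        using LIMSEQ_Suc[OF LIMSEQ_inverse_real_of_nat] .
      then have "(\<lambda>n. Complex ctr (r * (1 - inverse (real (Suc (Suc n)))))) \<longlonglongrightarrow> Complex ctr (r * (1 - 0))"
        by (intro tendsto_intros)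
      then have qlim: "q \<longlonglongrightarrow> q0" unfolding q_def[abs_def] q0_def by simp
      have "(\<lambda>n. e (q n)) \<longlonglongrightarrow> e q0"
        using e q0(1) qlim qW W(3) unfolding continuous_on_sequentially comp_def by blast
      moreover have "(\<lambda>n. e (q n)) = (\<lambda>n. e p)" using ek[OF qW] by auto
      ultimately have "e q0 = e p" using LIMSEQ_unique[OF tendsto_const] by metis
      then show ?thesis using arc[OF q0(2,3)] by simp
    qed
  qed
  then show ?thesis using p(2)[OF z] by simp
qed

lemma real_poly_vertical_derivative:
  "((\<lambda>y. (Re (real_poly n a (Complex t y - of_real c)) - Re (real_poly n a (of_real t - of_real c))) / y) \<longlongrightarrow> 0) (at_right 0)"
proof -
  let ?P = "real_poly n a"
  have Pd: "(?P has_field_derivative deriv ?P w) (at w)" for w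
    using real_poly_holomorphic[of n a 0 UNIV] by (auto intro!: holomorphic_derivI[where S=UNIV])
  have real: "deriv ?P (of_real x) = of_real (\<Sum>k\<le>n. a k * (real k * x ^ (k - 1)))" for x
    unfolding real_poly_def by (intro DERIV_imp_deriv) (auto intro!: derivative_eq_intros sum.cong simp: mult_ac)
  have "((\<lambda>y. Complex t y - of_real c) has_vector_derivative \<i>) (at 0)"
    unfolding Complex_eq by (auto intro!: derivative_eq_intros)
  from field_vector_diff_chain_at[OF this Pd]
  have "((\<lambda>y. ?P (Complex t y - of_real c)) has_vector_derivative \<i> * deriv ?P (Complex t 0 - of_real c)) (at 0)"
    by (simp add: o_def)
  from bounded_linear.has_vector_derivative[OF bounded_linear_Re this]
  have "((\<lambda>y. Re (?P (Complex t y - of_real c))) has_real_derivative Re (\<i> * deriv ?P (Complex t 0 - of_real c))) (at 0)"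
    by (simp only: has_real_derivative_iff_has_vector_derivative)
  moreover have "Complex t 0 - of_real c = of_real (t - c)" by (simp add: complex_eq_iff)
  ultimately have "((\<lambda>y. Re (?P (Complex t y - of_real c))) has_real_derivative 0) (at 0)"
    by (simp add: real del: of_real_diff)
  then have "((\<lambda>y. (Re (?P (Complex t y - of_real c)) - Re (?P (Complex t 0 - of_real c))) / (y - 0)) \<longlongrightarrow> 0) (at 0)"
    by (simp only: has_field_derivative_iff)
  then have "((\<lambda>y. (Re (?P (Complex t y - of_real c)) - Re (?P (Complex t 0 - of_real c))) / (y - 0)) \<longlongrightarrow> 0) (at_right 0)"
    by (rule tendsto_within_subset) simp
  then show ?thesis by (simp add: complex_of_real_def)
qed

text \<open>A harmonic function with pointwise vanishing normal derivative on the diameter is a uniform limit of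
  real parts of real polynomials, which have the same property. On the arc such an approximation exists
  by Weierstrass' theorem, as the arc is a graph over the diameter; the maximum principle extends it to the
  half-disc.\<close>

lemma Neumann_approximation:
  fixes ctr r :: real and d :: "complex \<Rightarrow> real"
  defines "\<Omega> \<equiv> {z. norm (z - of_real ctr) \<le> r \<and> Im z \<ge> 0}"
  assumes r: "r > 0" and G: "G holomorphic_on {z. Im z > 0}" and d: "continuous_on \<Omega> d"
    and dG: "\<And>z. z \<in> \<Omega> \<Longrightarrow> Im z > 0 \<Longrightarrow> d z = Im (G z)"
    and N: "\<And>t. \<bar>t - ctr\<bar> < r \<Longrightarrow> ((\<lambda>y. (d (Complex t y) - d (of_real t)) / y) \<longlongrightarrow> 0) (at_right 0)"
    and \<epsilon>: "\<epsilon> > 0"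
  shows "\<exists>n a. \<forall>z\<in>\<Omega>. \<bar>d z - Re (real_poly n a (z - of_real ctr))\<bar> \<le> \<epsilon>"
proof -
  \<comment> \<open>Half of the error is spent on the arc, the other part on the tilt \<open>\<delta> Im z\<close> that makes the normal derivative positive.\<close>
  define \<delta> where "\<delta> = \<epsilon> / (1 + r)"
  have \<delta>: "\<delta> > 0" using \<epsilon> r by (simp add: \<delta>_def)
  define \<psi> where "\<psi> X = d (Complex (ctr + X) (sqrt (r\<^sup>2 - X\<^sup>2)))" for X
  have arcmem: "Complex (ctr + X) (sqrt (r\<^sup>2 - X\<^sup>2)) \<in> \<Omega>" if "X \<in> {-r..r}" for X
  proof -
    have "X\<^sup>2 \<le> r\<^sup>2" using that r by (intro abs_le_square_iff[THEN iffD1]) auto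
    then show ?thesis using r by (simp add: \<Omega>_def cmod_def)
  qed
  have "continuous_on {-r..r} \<psi>" unfolding \<psi>_def Complex_eq
    by (rule continuous_on_compose2[OF d]) (use arcmem in \<open>auto intro!: continuous_intros simp: Complex_eq\<close>)
  then obtain p where p: "real_polynomial_function p" "\<And>X. X \<in> {-r..r} \<Longrightarrow> \<bar>\<psi> X - p X\<bar> < \<delta>"
    using Stone_Weierstrass_real_polynomial_function[OF compact_Icc _ \<delta>] by blast
  obtain c m where pc: "p = (\<lambda>x. \<Sum>i\<le>m. c i * x ^ i)" using p(1) real_polynomial_function_iff_sum by auto
  have "\<forall>i. \<exists>n a. \<forall>z. norm z = r \<longrightarrow> Re (\<Sum>k\<le>n. of_real (a k) * z ^ k) = Re z ^ i"
    using Re_power_on_circle[OF r] by blast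
  then obtain nn aa where na: "\<And>i z. norm z = r \<Longrightarrow> Re (\<Sum>k\<le>nn i. of_real (aa i k) * z ^ k) = Re z ^ i" by metis
  define L where "L = Max (nn ` {..m})"
  define a where "a k = (\<Sum>i\<le>m. c i * (if k \<le> nn i then aa i k else 0))" for k
  have Pcirc: "Re (real_poly L a z) = p (Re z)" if z: "norm z = r" for z
  proof -
    have "Re (real_poly L a z) = (\<Sum>k\<le>L. (\<Sum>i\<le>m. c i * (if k \<le> nn i then aa i k else 0)) * Re (z ^ k))"
      by (simp add: real_poly_def a_def)
    also have "\<dots> = (\<Sum>k\<le>L. \<Sum>i\<le>m. c i * ((if k \<le> nn i then aa i k else 0) * Re (z ^ k)))"
      by (simp add: sum_distrib_right mult.assoc)
    also have "\<dots> = (\<Sum>i\<le>m. \<Sum>k\<le>L. c i * ((if k \<le> nn i then aa i k else 0) * Re (z ^ k)))" by (rule sum.swap)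
    also have "\<dots> = (\<Sum>i\<le>m. c i * (\<Sum>k\<le>L. (if k \<le> nn i then aa i k else 0) * Re (z ^ k)))"
      by (simp add: sum_distrib_left)
    also have "\<dots> = (\<Sum>i\<le>m. c i * Re z ^ i)"
    proof (rule sum.cong[OF refl])
      fix i assume i: "i \<in> {..m}"
      have "nn i \<le> L" unfolding L_def using i by (intro Max_ge) auto
      then have "(\<Sum>k\<le>L. (if k \<le> nn i then aa i k else 0) * Re (z ^ k)) = (\<Sum>k\<le>nn i. aa i k * Re (z ^ k))"
        by (intro sum.mono_neutral_cong_right) auto
      also have "\<dots> = Re (\<Sum>k\<le>nn i. of_real (aa i k) * z ^ k)" by simp
      also have "\<dots> = Re z ^ i" by (rule na[OF z])
      finally show "c i * (\<Sum>k\<le>L. (if k \<le> nn i then aa i k else 0) * Re (z ^ k)) = c i * Re z ^ i" by simp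
    qed
    finally show ?thesis by (simp add: pc)
  qed
  let ?P = "\<lambda>z. real_poly L a (z - of_real ctr)"
  have arcb: "\<bar>d z - Re (?P z)\<bar> \<le> \<delta>" if z: "norm (z - of_real ctr) = r" "Im z \<ge> 0" for z
  proof -
    define X where "X = Re z - ctr"
    have "r\<^sup>2 = X\<^sup>2 + (Im z)\<^sup>2" using z(1) by (simp add: X_def cmod_def flip: z(1))
    then have "sqrt (r\<^sup>2 - X\<^sup>2) = Im z" using z(2) by simp
    then have zc: "z = Complex (ctr + X) (sqrt (r\<^sup>2 - X\<^sup>2))" by (simp add: X_def complex_eq_iff)
    have "\<bar>X\<bar> \<le> r" using abs_Re_le_cmod[of "z - of_real ctr"] z(1) by (simp add: X_def)
    then have X: "X \<in> {-r..r}" by auto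
    have "d z = \<psi> X" unfolding \<psi>_def using zc by simp
    moreover have "Re (?P z) = p X" using Pcirc[OF z(1)] by (simp add: X_def)
    ultimately show ?thesis using p(2)[OF X] by simp
  qed
  have Pc: "continuous_on \<Omega> (\<lambda>z. Re (?P z))"
    by (intro continuous_intros holomorphic_on_imp_continuous_on real_poly_holomorphic)
  have side: "s * (d z - Re (?P z)) \<le> \<epsilon>" if s: "s = 1 \<or> s = - 1" and z: "z \<in> \<Omega>" for s z
  proof -
    define e where "e z = s * (d z - Re (?P z)) + \<delta> * Im z" for z
    have "e z \<le> \<delta> + \<delta> * r"
    proof (rule half_disc_maximum[OF r, where H="\<lambda>z. of_real s * (G z - \<i> * ?P z) + of_real \<delta> * z" and e=e and ctr=ctr])
      show "(\<lambda>z. of_real s * (G z - \<i> * ?P z) + of_real \<delta> * z) holomorphic_on {z. Im z > 0}"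
        by (intro holomorphic_intros G real_poly_holomorphic)
      show "continuous_on {z. norm (z - of_real ctr) \<le> r \<and> 0 \<le> Im z} e"
        unfolding \<Omega>_def[symmetric] e_def
        by (intro continuous_on_add continuous_on_mult_left continuous_on_diff d Pc continuous_on_Im continuous_on_id)
      show "e z = Im (of_real s * (G z - \<i> * ?P z) + of_real \<delta> * z)"
        if "z \<in> {z. norm (z - of_real ctr) \<le> r \<and> 0 \<le> Im z}" "0 < Im z" for z
        using dG[of z] that by (simp add: e_def \<Omega>_def)
      show "e z \<le> \<delta> + \<delta> * r" if "norm (z - of_real ctr) = r" "0 \<le> Im z" for z
      proof -
        have "s * (d z - Re (?P z)) \<le> \<delta>" using arcb[OF that] s by auto
        moreover have "Im z \<le> r" using abs_Im_le_cmod[of "z - of_real ctr"] that by simp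
        then have "\<delta> * Im z \<le> \<delta> * r" using \<delta> by (intro mult_left_mono) auto
        ultimately show ?thesis by (simp add: e_def)
      qed
      show "\<exists>y>0. y < \<delta>' \<and> e (of_real t) < e (Complex t y)" if t: "\<bar>t - ctr\<bar> < r" "0 < \<delta>'" for t \<delta>'
      proof -
        have "((\<lambda>y. s * ((d (Complex t y) - d (of_real t)) / y - (Re (?P (Complex t y)) - Re (?P (of_real t))) / y) + \<delta>) \<longlongrightarrow> s * (0 - 0) + \<delta>) (at_right 0)"
          by (intro tendsto_intros N[OF t(1)] real_poly_vertical_derivative)
        then have "\<forall>\<^sub>F y in at_right 0. 0 < s * ((d (Complex t y) - d (of_real t)) / y - (Re (?P (Complex t y)) - Re (?P (of_real t))) / y) + \<delta>"
          using \<delta> by (intro order_tendstoD) auto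
        moreover have "\<forall>\<^sub>F y in at_right 0. y < \<delta>' \<and> 0 < y"
          using eventually_at_right_real[OF t(2)] by (rule eventually_mono) auto
        ultimately have "\<forall>\<^sub>F y in at_right 0. 0 < y \<and> y < \<delta>' \<and> e (of_real t) < e (Complex t y)"
        proof eventually_elim
          case (elim y)
          have "0 < y * (s * ((d (Complex t y) - d (of_real t)) / y - (Re (?P (Complex t y)) - Re (?P (of_real t))) / y) + \<delta>)"
            using elim by (intro mult_pos_pos) auto
          also have "\<dots> = s * (y * ((d (Complex t y) - d (of_real t)) / y) - y * ((Re (?P (Complex t y)) - Re (?P (of_real t))) / y)) + \<delta> * y"
            by (simp only: distrib_left right_diff_distrib mult.left_commute[of y s] mult.commute[of y \<delta>])
          also have "\<dots> = s * ((d (Complex t y) - d (of_real t)) - (Re (?P (Complex t y)) - Re (?P (of_real t)))) + \<delta> * y"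
            using elim by simp
          also have "\<dots> = e (Complex t y) - e (of_real t)" by (simp add: e_def algebra_simps)
          finally show ?case using elim by simp
        qed
        then show ?thesis using eventually_happens'[OF trivial_limit_at_right_real] by auto
      qed
      show "z \<in> {z. norm (z - of_real ctr) \<le> r \<and> 0 \<le> Im z}" using z by (simp add: \<Omega>_def)
    qed
    also have "\<delta> + \<delta> * r = \<epsilon>"
    proof -
      have "\<delta> * (1 + r) = \<epsilon>" using r by (simp add: \<delta>_def)
      then show ?thesis by (simp only: distrib_left mult_1_right)
    qed
    finally have "s * (d z - Re (?P z)) + \<delta> * Im z \<le> \<epsilon>" by (simp add: e_def)
    moreover have "0 \<le> \<delta> * Im z" using z \<delta> by (simp add: \<Omega>_def)
    ultimately show ?thesis by linarith
  qed
  have "\<forall>z\<in>\<Omega>. \<bar>d z - Re (?P z)\<bar> \<le> \<epsilon>"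
  proof
    fix z assume z: "z \<in> \<Omega>"
    show "\<bar>d z - Re (?P z)\<bar> \<le> \<epsilon>" using side[of 1 z] side[of "- 1" z] z by (simp add: abs_le_iff)
  qed
  then show ?thesis by blast
qed

lemma real_poly_cnj_sum: "real_poly n a (cnj z - of_real c) = cnj (real_poly n a (z - of_real c))"
  using real_poly_cnj[of n a "z - of_real c"] by simp

text \<open>Gradient estimates up to the diameter. The approximating polynomials are symmetric under conjugation,
  hence bounded on the full disc, and interior estimates apply to them; their derivatives are real on
  the diameter.\<close>

lemma Neumann_gradient_estimate:
  fixes ctr r A :: real and d :: "complex \<Rightarrow> real"
  defines "\<Omega> \<equiv> {z. norm (z - of_real ctr) \<le> r \<and> Im z \<ge> 0}"
  assumes r: "r > 0" and G: "G holomorphic_on {z. Im z > 0}" and d: "continuous_on \<Omega> d"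
    and dG: "\<And>z. z \<in> \<Omega> \<Longrightarrow> Im z > 0 \<Longrightarrow> d z = Im (G z)"
    and N: "\<And>t. \<bar>t - ctr\<bar> < r \<Longrightarrow> ((\<lambda>y. (d (Complex t y) - d (of_real t)) / y) \<longlongrightarrow> 0) (at_right 0)"
    and A: "A > 0" "\<And>z. z \<in> \<Omega> \<Longrightarrow> \<bar>d z\<bar> \<le> A"
    and z: "norm (z - of_real ctr) < r / 4" "Im z > 0"
  shows "norm (deriv G z) \<le> 8 * exp 2 * A / r"
    and "\<bar>Re (deriv G z)\<bar> \<le> 32 * exp 2 * A / r\<^sup>2 * Im z"
proof -
  define \<rho> where "\<rho> = min (Im z) (r / 2)"
  have \<rho>: "\<rho> > 0" using z r by (simp add: \<rho>_def)
  have key: "\<exists>Q. norm Q \<le> 8 * exp 2 * A / r \<and> \<bar>Re Q\<bar> \<le> 32 * exp 2 * A / r\<^sup>2 * Im z \<and>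
       norm (deriv G z - Q) \<le> 2 * exp 2 * \<epsilon> / \<rho>" if \<epsilon>: "0 < \<epsilon>" "\<epsilon> < A" for \<epsilon>
  proof -
    obtain n a where na: "\<And>w. w \<in> \<Omega> \<Longrightarrow> \<bar>d w - Re (real_poly n a (w - of_real ctr))\<bar> \<le> \<epsilon>"
      using Neumann_approximation[OF r G d[unfolded \<Omega>_def] dG[unfolded \<Omega>_def] N \<epsilon>(1)] unfolding \<Omega>_def by blast
    define P where "P w = real_poly n a (w - of_real ctr)" for w
    have Ph: "P holomorphic_on S" for S unfolding P_def[abs_def] by (rule real_poly_holomorphic)
    have Pd: "(P has_field_derivative deriv P w) (at w)" for w
      by (rule holomorphic_derivI[OF Ph[of UNIV]]) auto
    have Pc: "P (cnj w) = cnj (P w)" for w unfolding P_def by (rule real_poly_cnj_sum)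
    have Pb1: "\<bar>Re (P w)\<bar> \<le> 2 * A" if "w \<in> \<Omega>" for w
      using na[OF that] A(2)[OF that] \<epsilon> unfolding P_def by linarith
    have Pb: "\<bar>Re (P w)\<bar> \<le> 2 * A" if "norm (w - of_real ctr) \<le> r" for w
    proof (cases "Im w \<ge> 0")
      case True
      then show ?thesis using Pb1[of w] that by (simp add: \<Omega>_def)
    next
      case False
      have "norm (cnj w - of_real ctr) \<le> r" using that by (metis complex_cnj_complex_of_real complex_cnj_diff complex_mod_cnj)
      then have "\<bar>Re (P (cnj w))\<bar> \<le> 2 * A" using False by (intro Pb1) (simp add: \<Omega>_def)
      then show ?thesis by (simp add: Pc)
    qed
    have P1: "norm (deriv P w) \<le> 8 * exp 2 * A / r" if w: "norm (w - of_real ctr) \<le> r / 2" for w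
    proof -
      have "norm (deriv (\<lambda>w. \<i> * P w) w) \<le> 2 * exp 2 * (2 * A) / (r / 2)"
      proof (rule norm_deriv_le_Im_bound)
        show "(\<lambda>w. \<i> * P w) holomorphic_on ball w (r / 2)" by (intro holomorphic_intros Ph)
        show "\<bar>Im (\<i> * P v)\<bar> \<le> 2 * A" if "v \<in> ball w (r / 2)" for v
        proof -
          have "norm (v - of_real ctr) \<le> norm (v - w) + norm (w - of_real ctr)"
            using norm_triangle_ineq[of "v - w" "w - of_real ctr"] by simp
          then have "norm (v - of_real ctr) \<le> r" using that w by (simp add: dist_norm norm_minus_commute)
          from Pb[OF this] show ?thesis by simp
        qed
      qed (use r A in auto)
      moreover have "deriv (\<lambda>w. \<i> * P w) w = \<i> * deriv P w" by (intro DERIV_imp_deriv DERIV_cmult Pd)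
      ultimately show ?thesis by (simp add: norm_mult)
    qed
    have P2: "norm (deriv (deriv P) w) \<le> 32 * exp 2 * A / r\<^sup>2" if w: "norm (w - of_real ctr) \<le> r / 4" for w
    proof -
      have dPh: "deriv P holomorphic_on S" for S
        by (rule holomorphic_on_subset[OF holomorphic_deriv[OF Ph[of UNIV] open_UNIV]]) simp
      have "norm ((deriv ^^ 1) (deriv P) w) \<le> fact 1 * (8 * exp 2 * A / r) / (r / 4) ^ 1"
      proof (rule Cauchy_inequality)
        show "norm (deriv P v) \<le> 8 * exp 2 * A / r" if "norm (w - v) = r / 4" for v
        proof (rule P1)
          have "norm (v - of_real ctr) \<le> norm (v - w) + norm (w - of_real ctr)"
            using norm_triangle_ineq[of "v - w" "w - of_real ctr"] by simp
          then show "norm (v - of_real ctr) \<le> r / 2" using that w by (simp add: norm_minus_commute)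
        qed
      qed (use r dPh in \<open>auto intro: holomorphic_on_imp_continuous_on\<close>)
      then show ?thesis by (simp add: power2_eq_square)
    qed
    have real: "Im (deriv P (of_real x)) = 0" for x
    proof -
      have "deriv P (of_real x) = of_real (\<Sum>k\<le>n. a k * (real k * (x - ctr) ^ (k - 1)))"
        unfolding P_def real_poly_def by (intro DERIV_imp_deriv) (auto intro!: derivative_eq_intros sum.cong simp: mult_ac)
      then show ?thesis by (simp only: Im_complex_of_real)
    qed
    \<comment> \<open>\<open>d\<close> is close to \<open>Re P = Im (\<i> P)\<close>, so that \<open>\<i> P\<close> approximates \<open>G\<close> up to a real constant.\<close>
    define Q where "Q = \<i> * deriv P z"
    have "\<bar>Re Q\<bar> \<le> 32 * exp 2 * A / r\<^sup>2 * Im z"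
    proof -
      let ?z0 = "complex_of_real (Re z)"
      have "norm (deriv P z - deriv P ?z0) \<le> 32 * exp 2 * A / r\<^sup>2 * norm (z - ?z0)"
      proof (rule field_differentiable_bound[where S="cball (of_real ctr) (r / 4)" and f'="deriv (deriv P)"])
        show "(deriv P has_field_derivative deriv (deriv P) v) (at v within cball (of_real ctr) (r / 4))" for v
          by (rule has_field_derivative_at_within, rule holomorphic_derivI[OF holomorphic_deriv[OF Ph[of UNIV] open_UNIV]]) auto
        show "norm (deriv (deriv P) v) \<le> 32 * exp 2 * A / r\<^sup>2" if "v \<in> cball (of_real ctr) (r / 4)" for v
          by (rule P2) (use that in \<open>simp add: dist_norm norm_minus_commute\<close>)
        show "z \<in> cball (of_real ctr) (r / 4)" using z by (simp add: dist_norm norm_minus_commute)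
        have "\<bar>ctr - Re z\<bar> \<le> norm (z - of_real ctr)"
          using abs_Re_le_cmod[of "of_real ctr - z"] by (simp add: norm_minus_commute)
        then show "?z0 \<in> cball (of_real ctr) (r / 4)" using z
          by (simp add: dist_norm norm_minus_commute flip: of_real_diff)
      qed auto
      also have "norm (z - ?z0) = Im z"
      proof -
        have "z - ?z0 = \<i> * of_real (Im z)" by (simp add: complex_eq_iff)
        then show ?thesis using z(2) by (simp add: norm_mult)
      qed
      finally have "\<bar>Im (deriv P z - deriv P ?z0)\<bar> \<le> 32 * exp 2 * A / r\<^sup>2 * Im z"
        using abs_Im_le_cmod order_trans by blast
      then show ?thesis by (simp add: Q_def real)
    qed
    moreover have "norm Q \<le> 8 * exp 2 * A / r"
      using P1[of z] z r by (simp add: Q_def norm_mult)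
    moreover have "norm (deriv G z - Q) \<le> 2 * exp 2 * \<epsilon> / \<rho>"
    proof -
      have Gd: "(G has_field_derivative deriv G z) (at z)"
        by (rule holomorphic_derivI[OF G open_halfspace_Im_gt]) (use z in simp)
      have bs: "v \<in> \<Omega> \<and> Im v > 0" if "v \<in> ball z \<rho>" for v
      proof -
        have v: "norm (v - z) < Im z" "norm (v - z) < r / 2" using that by (auto simp: \<rho>_def dist_norm norm_minus_commute)
        have "norm (v - of_real ctr) \<le> norm (v - z) + norm (z - of_real ctr)"
          using norm_triangle_ineq[of "v - z" "z - of_real ctr"] by simp
        then have "norm (v - of_real ctr) \<le> r" using v z r by linarith
        moreover have "Im v > 0" using abs_Im_le_cmod[of "v - z"] v(1) by simp
        ultimately show ?thesis by (simp add: \<Omega>_def)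
      qed
      have "norm (deriv (\<lambda>w. G w - \<i> * P w) z) \<le> 2 * exp 2 * \<epsilon> / \<rho>"
      proof (rule norm_deriv_le_Im_bound[OF _ \<rho> \<epsilon>(1)])
        show "(\<lambda>w. G w - \<i> * P w) holomorphic_on ball z \<rho>"
          by (intro holomorphic_intros Ph holomorphic_on_subset[OF G]) (use bs in auto)
        show "\<bar>Im (G w - \<i> * P w)\<bar> \<le> \<epsilon>" if "w \<in> ball z \<rho>" for w
          using na[of w] dG[of w] bs[OF that] by (simp add: P_def)
      qed
      moreover have "deriv (\<lambda>w. G w - \<i> * P w) z = deriv G z - Q"
        unfolding Q_def by (intro DERIV_imp_deriv DERIV_diff DERIV_cmult Pd Gd)
      ultimately show ?thesis by simp
    qed
    ultimately show ?thesis by blast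
  qed
  have lim: "x \<le> B" if "\<And>\<epsilon>. 0 < \<epsilon> \<Longrightarrow> \<epsilon> < A \<Longrightarrow> x \<le> B + 2 * exp 2 * \<epsilon> / \<rho>" for x B :: real
  proof (rule field_le_epsilon)
    fix e :: real assume e: "e > 0"
    define \<epsilon> where "\<epsilon> = min (A / 2) (e * \<rho> / (2 * exp 2))"
    have \<epsilon>: "0 < \<epsilon>" "\<epsilon> < A" using A e \<rho> by (auto simp: \<epsilon>_def)
    have "\<epsilon> \<le> e * \<rho> / (2 * exp 2)" by (simp add: \<epsilon>_def)
    then have "2 * exp 2 * \<epsilon> / \<rho> \<le> e" using \<rho> by (simp add: field_simps)
    then show "x \<le> B + e" using that[OF \<epsilon>] by linarith
  qed
  show "norm (deriv G z) \<le> 8 * exp 2 * A / r"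
  proof (rule lim)
    fix \<epsilon> :: real assume "0 < \<epsilon>" "\<epsilon> < A"
    then obtain Q where Q: "norm Q \<le> 8 * exp 2 * A / r" "norm (deriv G z - Q) \<le> 2 * exp 2 * \<epsilon> / \<rho>"
      using key by blast
    have "norm (deriv G z) \<le> norm Q + norm (deriv G z - Q)" using norm_triangle_ineq[of Q "deriv G z - Q"] by simp
    then show "norm (deriv G z) \<le> 8 * exp 2 * A / r + 2 * exp 2 * \<epsilon> / \<rho>" using Q by linarith
  qed
  show "\<bar>Re (deriv G z)\<bar> \<le> 32 * exp 2 * A / r\<^sup>2 * Im z"
  proof (rule lim)
    fix \<epsilon> :: real assume "0 < \<epsilon>" "\<epsilon> < A"
    then obtain Q where Q: "\<bar>Re Q\<bar> \<le> 32 * exp 2 * A / r\<^sup>2 * Im z" "norm (deriv G z - Q) \<le> 2 * exp 2 * \<epsilon> / \<rho>"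
      using key by blast
    have "\<bar>Re (deriv G z)\<bar> \<le> \<bar>Re Q\<bar> + norm (deriv G z - Q)" using abs_Re_le_cmod[of "deriv G z - Q"] by simp
    then show "\<bar>Re (deriv G z)\<bar> \<le> 32 * exp 2 * A / r\<^sup>2 * Im z + 2 * exp 2 * \<epsilon> / \<rho>" using Q by linarith
  qed
qed

section \<open>Bounded solutions near the boundary\<close>

text \<open>\<open>V\<close> is a bounded solution for \<open>\<lambda> = 1\<close> in a complex variable. It stands beside \<open>f\<close>, and not as \<open>Im f\<close>,
  because \<open>f\<close> is not assumed to extend to the boundary, where the conditions are imposed.\<close>

locale dock_solution =
  fixes f :: "complex \<Rightarrow> complex" and V :: "complex \<Rightarrow> real" and M :: real
  assumes M: "M > 0"
    and f_hol: "f holomorphic_on {z. Im z > 0}"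
    and V_cont: "continuous_on {z. Im z \<ge> 0} V"
    and V_f: "\<And>z. Im z > 0 \<Longrightarrow> V z = Im (f z)"
    and V_bound: "\<And>z. Im z \<ge> 0 \<Longrightarrow> \<bar>V z\<bar> \<le> M"
    and V_zero: "\<And>x. x \<le> 0 \<Longrightarrow> V (of_real x) = 0"
    and V_Robin: "\<And>x. x > 0 \<Longrightarrow> ((\<lambda>y. (V (Complex x y) - V (of_real x)) / y) \<longlongrightarrow> - V (of_real x)) (at_right 0)"
begin

definition "K = 2 * exp 2 * M"

lemma K_pos: "K > 0" using M by (simp add: K_def)

lemma f_DERIV: "Im z > 0 \<Longrightarrow> (f has_field_derivative deriv f z) (at z)"
  by (rule holomorphic_derivI[OF f_hol open_halfspace_Im_gt]) simp

lemma deriv_bound: assumes "Im z > 0" shows "norm (deriv f z) \<le> K / Im z"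
  unfolding K_def
proof (rule norm_deriv_le_Im_bound)
  have sub: "Im w > 0" if "w \<in> ball z (Im z)" for w
    using that abs_Im_le_cmod[of "z - w"] by (auto simp: dist_norm)
  show "f holomorphic_on ball z (Im z)" by (rule holomorphic_on_subset[OF f_hol]) (use sub in auto)
  show "\<bar>Im (f w)\<bar> \<le> M" if "w \<in> ball z (Im z)" for w
    using V_f[OF sub[OF that]] V_bound[of w] sub[OF that] by simp
qed (use assms M in auto)

text \<open>Integrate the bound \<open>K / y\<close> for \<open>f'\<close> along a vertical line; in the variable \<open>ln y\<close> it becomes a Lipschitz
  bound.\<close>

lemma vertical_growth:
  assumes "y1 > 0" "y2 > 0"
  shows "norm (f (Complex x y1) - f (Complex x y2)) \<le> K * \<bar>ln y1 - ln y2\<bar>"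
proof -
  define q where "q \<zeta> = f (of_real x + \<i> * exp \<zeta>)" for \<zeta>
  let ?S = "{\<zeta>::complex. Im \<zeta> = 0}"
  have e: "exp \<zeta> = of_real (exp (Re \<zeta>))" if "\<zeta> \<in> ?S" for \<zeta>
    using that by (simp add: exp_eq_polar)
  have "norm (q (of_real (ln y1)) - q (of_real (ln y2))) \<le> K * norm (complex_of_real (ln y1) - of_real (ln y2))"
  proof (rule field_differentiable_bound[where S="?S" and f'="\<lambda>\<zeta>. deriv f (of_real x + \<i> * exp \<zeta>) * (\<i> * exp \<zeta>)"])
    show "convex ?S" by (auto simp: convex_def)
    fix \<zeta> assume z: "\<zeta> \<in> ?S"
    have im: "Im (of_real x + \<i> * exp \<zeta>) = exp (Re \<zeta>)" using e[OF z] by simp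
    have "(q has_field_derivative deriv f (of_real x + \<i> * exp \<zeta>) * (\<i> * exp \<zeta>)) (at \<zeta>)"
      unfolding q_def by (rule DERIV_chain2[OF f_DERIV]) (use im in \<open>auto intro!: derivative_eq_intros\<close>)
    then show "(q has_field_derivative deriv f (of_real x + \<i> * exp \<zeta>) * (\<i> * exp \<zeta>)) (at \<zeta> within ?S)"
      by (rule has_field_derivative_at_within)
    have "norm (deriv f (of_real x + \<i> * exp \<zeta>)) \<le> K / exp (Re \<zeta>)"
      using deriv_bound[of "of_real x + \<i> * exp \<zeta>"] im by simp
    then have "norm (deriv f (of_real x + \<i> * exp \<zeta>)) * exp (Re \<zeta>) \<le> K" by (simp add: field_simps)
    then show "norm (deriv f (of_real x + \<i> * exp \<zeta>) * (\<i> * exp \<zeta>)) \<le> K" by (simp add: norm_mult)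
  qed auto
  moreover have "q (of_real (ln y)) = f (Complex x y)" if "y > 0" for y
    using that by (simp add: q_def exp_of_real Complex_eq)
  ultimately show ?thesis using assms by (simp flip: of_real_diff)
qed

lemma horizontal_growth:
  assumes "y > 0" shows "norm (f (Complex a y) - f (Complex b y)) \<le> K / y * \<bar>a - b\<bar>"
proof -
  have "norm (f (Complex a y) - f (Complex b y)) \<le> K / y * norm (Complex a y - Complex b y)"
  proof (rule field_differentiable_bound[where S="{z. Im z = y}" and f'="deriv f"])
    show "convex {z. Im z = y}" by (auto simp: convex_def algebra_simps simp flip: distrib_right)
    show "(f has_field_derivative deriv f z) (at z within {z. Im z = y})" if "z \<in> {z. Im z = y}" for z
      using f_DERIV[of z] that assms by (auto intro: has_field_derivative_at_within)
    show "norm (deriv f z) \<le> K / y" if "z \<in> {z. Im z = y}" for z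
      using deriv_bound[of z] that assms by auto
  qed auto
  also have "Complex a y - Complex b y = of_real (a - b)" by (simp add: complex_eq_iff)
  finally show ?thesis by (simp only: norm_of_real)
qed

lemma growth:
  assumes "y > 0" shows "norm (f (Complex x y)) \<le> norm (f \<i>) + K * \<bar>ln y\<bar> + K * \<bar>x\<bar> / y"
proof -
  have "norm (f (Complex 0 y) - f \<i>) \<le> K * \<bar>ln y\<bar>"
    using vertical_growth[OF assms zero_less_one, of 0] by (simp add: i_complex_of_real flip: imaginary_unit.code)
  moreover have "norm (f (Complex x y) - f (Complex 0 y)) \<le> K * \<bar>x\<bar> / y"
    using horizontal_growth[OF assms, of x 0] by simp
  moreover have "norm (f (Complex x y)) \<le> norm (f \<i>) + norm (f (Complex 0 y) - f \<i>) + norm (f (Complex x y) - f (Complex 0 y))"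
    using norm_triangle_ineq[of "f (Complex x y) - f (Complex 0 y)" "f (Complex 0 y)"] norm_triangle_ineq[of "f (Complex 0 y) - f \<i>" "f \<i>"]
    by simp
  ultimately show ?thesis by linarith
qed

lemma growth_near_axis:
  assumes "0 < y" "y \<le> \<bar>x\<bar>"
  shows "norm (f (Complex x y)) \<le> norm (f \<i>) + K + K * \<bar>ln \<bar>x\<bar>\<bar> + K * (ln \<bar>x\<bar> - ln y)"
proof -
  have x: "\<bar>x\<bar> > 0" using assms by linarith
  have "norm (f (Complex x \<bar>x\<bar>)) \<le> norm (f \<i>) + K * \<bar>ln \<bar>x\<bar>\<bar> + K" using growth[OF x, of x] x by simp
  moreover have "norm (f (Complex x y) - f (Complex x \<bar>x\<bar>)) \<le> K * (ln \<bar>x\<bar> - ln y)"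
  proof -
    have "ln y \<le> ln \<bar>x\<bar>" using assms by (intro ln_mono) auto
    then show ?thesis using vertical_growth[OF assms(1) x, of x] by simp
  qed
  moreover have "norm (f (Complex x y)) \<le> norm (f (Complex x \<bar>x\<bar>)) + norm (f (Complex x y) - f (Complex x \<bar>x\<bar>))"
    using norm_triangle_ineq[of "f (Complex x y) - f (Complex x \<bar>x\<bar>)" "f (Complex x \<bar>x\<bar>)"] by simp
  ultimately show ?thesis by linarith
qed

definition "prim = (SOME k. \<forall>z. Im z > 0 \<longrightarrow> (k has_field_derivative f z) (at z))"

lemma prim_DERIV: "Im z > 0 \<Longrightarrow> (prim has_field_derivative f z) (at z)"
proof -
  have o: "open {z. Im z > 0}" "convex {z. Im z > 0}" by (auto simp: open_halfspace_Im_gt convex_halfspace_Im_gt)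
  obtain k where k: "\<And>z. z \<in> {z. Im z > 0} \<Longrightarrow> (k has_field_derivative f z) (at z within {z. Im z > 0})"
    using holomorphic_convex_primitive'[OF o(2,1) f_hol] by blast
  then have "\<exists>k. \<forall>z. Im z > 0 \<longrightarrow> (k has_field_derivative f z) (at z)"
    using at_within_open[OF _ o(1)] by (metis mem_Collect_eq)
  from someI_ex[OF this] have "\<forall>z. Im z > 0 \<longrightarrow> (prim has_field_derivative f z) (at z)"
    unfolding prim_def .
  then show "Im z > 0 \<Longrightarrow> (prim has_field_derivative f z) (at z)" by blast
qed

text \<open>\<open>Re prim\<close>, continued to the boundary: it is recovered from its values at height \<open>1\<close> by integrating its
  vertical derivative \<open>- V\<close>, which is continuous on the closed half-plane.\<close>

definition "pot z = Re (prim (Complex (Re z) 1)) + (1 - Im z) * integral {0..1} (\<lambda>\<tau>. V (Complex (Re z) (Im z + \<tau> * (1 - Im z))))"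

lemma Re_prim_vertical_DERIV:
  assumes "y > 0" shows "((\<lambda>y. Re (prim (Complex x y))) has_real_derivative - V (Complex x y)) (at y)"
proof -
  have "((\<lambda>y. Complex x y) has_vector_derivative \<i>) (at y)"
    unfolding Complex_eq by (auto intro!: derivative_eq_intros)
  from field_vector_diff_chain_at[OF this prim_DERIV[of "Complex x y"]]
  have "((\<lambda>y. prim (Complex x y)) has_vector_derivative \<i> * f (Complex x y)) (at y)" using assms by (simp add: o_def)
  from bounded_linear.has_vector_derivative[OF bounded_linear_Re this]
  show ?thesis using V_f[of "Complex x y"] assms by (simp add: has_real_derivative_iff_has_vector_derivative)
qed

lemma segment_height_nonneg: "\<tau> \<in> {0..1} \<Longrightarrow> (y::real) \<ge> 0 \<Longrightarrow> 0 \<le> y + \<tau> * (1 - y)"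
proof -
  assume "\<tau> \<in> {0..1}" "y \<ge> 0"
  then have "0 \<le> (1 - \<tau>) * y + \<tau>" by (intro add_nonneg_nonneg mult_nonneg_nonneg) auto
  then show ?thesis by (simp add: algebra_simps)
qed

lemma V_segment_cont: "y \<ge> 0 \<Longrightarrow> continuous_on {0..1} (\<lambda>\<tau>. V (Complex x (y + \<tau> * (1 - y))))"
  unfolding Complex_eq
  by (rule continuous_on_compose2[OF V_cont]) (use segment_height_nonneg[of _ y] in \<open>auto intro!: continuous_intros\<close>)

lemma pot_eq: assumes "Im z > 0" shows "pot z = Re (prim z)"
proof -
  define x y where "x = Re z" and "y = Im z"
  have y: "y > 0" using assms by (simp add: y_def)
  define h where "h \<tau> = Re (prim (Complex x (y + \<tau> * (1 - y))))" for \<tau>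
  have "((\<lambda>\<tau>. - ((1 - y) * V (Complex x (y + \<tau> * (1 - y))))) has_integral h 1 - h 0) {0..1}"
  proof (rule fundamental_theorem_of_calculus)
    fix \<tau> :: real assume \<tau>: "\<tau> \<in> {0..1}"
    have p: "y + \<tau> * (1 - y) > 0"
    proof (cases "\<tau> = 1")
      case False
      then have "0 < (1 - \<tau>) * y + \<tau>" using \<tau> y by (intro add_pos_nonneg mult_pos_pos) auto
      then show ?thesis by (simp add: algebra_simps)
    qed simp
    have "(h has_real_derivative - V (Complex x (y + \<tau> * (1 - y))) * (1 - y)) (at \<tau>)"
      unfolding h_def by (rule DERIV_chain2[where f="\<lambda>y. Re (prim (Complex x y))" and g="\<lambda>\<tau>. y + \<tau> * (1 - y)", OF Re_prim_vertical_DERIV[OF p]]) (auto intro!: derivative_eq_intros)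
    then have "(h has_vector_derivative - ((1 - y) * V (Complex x (y + \<tau> * (1 - y))))) (at \<tau>)"
      by (simp add: has_real_derivative_iff_has_vector_derivative mult.commute)
    then show "(h has_vector_derivative - ((1 - y) * V (Complex x (y + \<tau> * (1 - y))))) (at \<tau> within {0..1})"
      by (rule has_vector_derivative_at_within)
  qed simp
  then have "integral {0..1} (\<lambda>\<tau>. - ((1 - y) * V (Complex x (y + \<tau> * (1 - y))))) = h 1 - h 0" by (rule integral_unique)
  then have "(1 - y) * integral {0..1} (\<lambda>\<tau>. V (Complex x (y + \<tau> * (1 - y)))) = h 0 - h 1" by simp
  then show ?thesis by (simp add: pot_def h_def x_def y_def)
qed

lemma pot_cont: "continuous_on {z. Im z \<ge> 0} pot"
proof -
  have "continuous_on {z. Im z > 0} prim"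
    using prim_DERIV by (auto intro!: continuous_at_imp_continuous_on dest: DERIV_isCont)
  then have 1: "continuous_on {z. Im z \<ge> 0} (\<lambda>z. prim (Complex (Re z) 1))"
    by (rule continuous_on_compose2) (auto intro!: continuous_intros simp: Complex_eq)
  have "continuous_on ({z. Im z \<ge> 0} \<times> cbox 0 1) (\<lambda>(z, \<tau>). V (Complex (Re z) (Im z + \<tau> * (1 - Im z))))"
    unfolding case_prod_beta Complex_eq
    by (rule continuous_on_compose2[OF V_cont]) (use segment_height_nonneg in \<open>auto intro!: continuous_intros\<close>)
  from integral_continuous_on_param[OF this]
  have 2: "continuous_on {z. Im z \<ge> 0} (\<lambda>z. integral {0..1} (\<lambda>\<tau>. V (Complex (Re z) (Im z + \<tau> * (1 - Im z)))))" by simp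
  show ?thesis unfolding pot_def[abs_def] by (intro continuous_intros 1 2)
qed

text \<open>The vertical derivative \<open>- V\<close> extends continuously to the boundary, so by the mean value theorem it is also
  the one-sided derivative there.\<close>

lemma pot_Neumann: "((\<lambda>y. (pot (Complex x y) - pot (of_real x)) / y) \<longlongrightarrow> - V (of_real x)) (at_right 0)"
proof (rule tendstoI)
  fix e :: real assume e: "e > 0"
  have "continuous_on {0..} (\<lambda>y. V (Complex x y))" unfolding Complex_eq
    by (rule continuous_on_compose2[OF V_cont]) (auto intro!: continuous_intros)
  then obtain \<delta> where \<delta>: "\<delta> > 0" "\<And>y. y \<ge> 0 \<Longrightarrow> y < \<delta> \<Longrightarrow> \<bar>V (Complex x y) - V (Complex x 0)\<bar> < e"
    using e unfolding continuous_on_iff dist_real_def by (metis abs_of_nonneg atLeast_iff diff_zero order_refl)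
  have x0: "complex_of_real x = Complex x 0" by (simp add: complex_eq_iff)
  have "dist ((pot (Complex x y) - pot (of_real x)) / y) (- V (of_real x)) < e" if y: "y \<in> {0<..<\<delta>}" for y
  proof -
    have c: "continuous_on {0..y} (\<lambda>y. pot (Complex x y))" unfolding Complex_eq
      by (rule continuous_on_compose2[OF pot_cont]) (auto intro!: continuous_intros)
    have D: "((\<lambda>y. pot (Complex x y)) has_real_derivative - V (Complex x t)) (at t)" if "t > 0" for t
      by (rule has_field_derivative_transform_within_open[OF Re_prim_vertical_DERIV[OF that], of "{0<..}"])
         (use that pot_eq in auto)
    obtain l t where t: "0 < t" "t < y" "((\<lambda>y. pot (Complex x y)) has_real_derivative l) (at t)"
      "pot (Complex x y) - pot (Complex x 0) = (y - 0) * l"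
      using MVT[OF _ c] D y unfolding real_differentiable_def by (metis greaterThanLessThan_iff)
    have "l = - V (Complex x t)" using DERIV_unique[OF t(3) D[OF t(1)]] .
    then have "(pot (Complex x y) - pot (of_real x)) / y = - V (Complex x t)" using t(4) y by (simp add: x0)
    then show ?thesis using \<delta>(2)[of t] t y by (simp add: dist_real_def x0 abs_minus_commute)
  qed
  then show "\<forall>\<^sub>F y in at_right 0. dist ((pot (Complex x y) - pot (of_real x)) / y) (- V (of_real x)) < e"
    using eventually_at_right_real[OF \<delta>(1)] by (rule eventually_mono[rotated]) auto
qed

text \<open>\<open>defect\<close> is \<open>Im robin_prim\<close> continued to the boundary, and \<open>robin\<close> is the derivative of
  \<open>robin_prim\<close>. Since \<open>pot\<close> and \<open>V\<close> have the same normal derivative on the positive half-axis, the Steklov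
  condition for \<open>V\<close> becomes a Neumann condition for \<open>defect\<close>.\<close>

definition "defect z = V z - pot z"

definition "robin_prim z = f z - \<i> * prim z"

definition "robin z = deriv f z - \<i> * f z"

lemma robin_prim_DERIV: "Im z > 0 \<Longrightarrow> (robin_prim has_field_derivative robin z) (at z)"
  unfolding robin_prim_def[abs_def] robin_def by (intro DERIV_diff DERIV_cmult f_DERIV prim_DERIV)

lemma defect_eq_Im: "Im z > 0 \<Longrightarrow> defect z = Im (robin_prim z)" by (simp add: defect_def robin_prim_def V_f pot_eq)

lemma defect_Neumann: assumes "x > 0" shows "((\<lambda>y. (defect (Complex x y) - defect (of_real x)) / y) \<longlongrightarrow> 0) (at_right 0)"
proof -
  have "(defect (Complex x y) - defect (of_real x)) / y = (V (Complex x y) - V (of_real x)) / y - (pot (Complex x y) - pot (of_real x)) / y" for y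
    by (simp add: defect_def diff_divide_distrib)
  then show ?thesis using tendsto_diff[OF V_Robin[OF assms] pot_Neumann[of x]] by simp
qed

definition "defect_const = 2 * M + norm (prim \<i>) + norm (f \<i>) + K"

lemma defect_const_pos: "defect_const > 0" using M K_pos by (simp add: defect_const_def add_pos_nonneg add_nonneg_pos)

lemma defect_bound: assumes "0 \<le> Im z" "Im z \<le> 1" shows "\<bar>defect z\<bar> \<le> defect_const * (1 + \<bar>Re z\<bar>)\<^sup>2"
proof -
  define x where "x = Re z"
  let ?S = "{w. Im w = 1 \<and> \<bar>Re w\<bar> \<le> \<bar>x\<bar>}"
  have "norm (prim (Complex x 1) - prim (Complex 0 1)) \<le> (norm (f \<i>) + K * \<bar>x\<bar>) * norm (Complex x 1 - Complex 0 1)"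
  proof (rule field_differentiable_bound[where S="?S" and f'=f])
    have S: "?S = (cbox (Complex (- \<bar>x\<bar>) 1) (Complex \<bar>x\<bar> 1))"
      by (auto simp: in_cbox_complex_iff)
    show "convex ?S" unfolding S by (rule convex_box)
    show "(prim has_field_derivative f w) (at w within ?S)" if "w \<in> ?S" for w
      using prim_DERIV[of w] that by (auto intro: has_field_derivative_at_within)
    show "norm (f w) \<le> norm (f \<i>) + K * \<bar>x\<bar>" if "w \<in> ?S" for w
    proof -
      have "norm (f (Complex (Re w) 1)) \<le> norm (f \<i>) + K * \<bar>Re w\<bar>" using growth[of 1 "Re w"] by simp
      moreover have "Complex (Re w) 1 = w" using that by (simp add: complex_eq_iff)
      moreover have "K * \<bar>Re w\<bar> \<le> K * \<bar>x\<bar>" using that K_pos by (intro mult_left_mono) auto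
      ultimately show ?thesis by simp
    qed
  qed auto
  also have "Complex x 1 - Complex 0 1 = of_real x" by (simp add: complex_eq_iff)
  also have "Complex 0 1 = \<i>" by (simp add: complex_eq_iff)
  finally have "norm (prim (Complex x 1) - prim \<i>) \<le> (norm (f \<i>) + K * \<bar>x\<bar>) * \<bar>x\<bar>" by simp
  then have p: "norm (prim (Complex x 1)) \<le> norm (prim \<i>) + (norm (f \<i>) + K * \<bar>x\<bar>) * \<bar>x\<bar>"
    using norm_triangle_ineq[of "prim (Complex x 1) - prim \<i>" "prim \<i>"] by simp
  have "norm (integral {0..1} (\<lambda>\<tau>. V (Complex x (Im z + \<tau> * (1 - Im z))))) \<le> M * (1 - 0)"
    by (rule integral_bound[OF _ V_segment_cont]) (use assms segment_height_nonneg V_bound in auto)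
  then have "\<bar>1 - Im z\<bar> * \<bar>integral {0..1} (\<lambda>\<tau>. V (Complex x (Im z + \<tau> * (1 - Im z))))\<bar> \<le> 1 * M"
    using assms by (intro mult_mono) auto
  then have "\<bar>pot z\<bar> \<le> norm (prim (Complex x 1)) + M"
    unfolding pot_def x_def[symmetric] abs_mult[symmetric] using abs_Re_le_cmod[of "prim (Complex x 1)"] by linarith
  then have "\<bar>defect z\<bar> \<le> 2 * M + norm (prim \<i>) + (norm (f \<i>) + K * \<bar>x\<bar>) * \<bar>x\<bar>"
    unfolding defect_def using p V_bound[OF assms(1)] by linarith
  also have "\<dots> \<le> defect_const * (1 + \<bar>x\<bar>)\<^sup>2"
  proof -
    have "0 \<le> (2 * M + norm (prim \<i>)) * (2 * \<bar>x\<bar> + \<bar>x\<bar>\<^sup>2) + norm (f \<i>) * (1 + \<bar>x\<bar> + \<bar>x\<bar>\<^sup>2) + K * (1 + 2 * \<bar>x\<bar>)"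
      using M K_pos by (intro add_nonneg_nonneg mult_nonneg_nonneg) auto
    moreover have "defect_const * (1 + \<bar>x\<bar>)\<^sup>2 - (2 * M + norm (prim \<i>) + (norm (f \<i>) + K * \<bar>x\<bar>) * \<bar>x\<bar>) =
       (2 * M + norm (prim \<i>)) * (2 * \<bar>x\<bar> + \<bar>x\<bar>\<^sup>2) + norm (f \<i>) * (1 + \<bar>x\<bar> + \<bar>x\<bar>\<^sup>2) + K * (1 + 2 * \<bar>x\<bar>)"
      unfolding defect_const_def power2_eq_square by algebra
    ultimately show ?thesis by linarith
  qed
  finally show ?thesis by (simp add: x_def)
qed

text \<open>The gradient estimate in the half-disc of radius \<open>x / (1 + x)\<close> about \<open>x\<close>, which has radius at most \<open>1\<close> and
  touches only the positive half-axis.\<close>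

lemma local_estimate:
  assumes x: "x > 0" and y: "0 < y" "y < x / (1 + x) / 4"
  shows "norm (robin (Complex x y)) \<le> 8 * exp 2 * (defect_const * (2 + x)\<^sup>2) / (x / (1 + x))"
    "\<bar>Re (robin (Complex x y))\<bar> \<le> 32 * exp 2 * (defect_const * (2 + x)\<^sup>2) / (x / (1 + x))\<^sup>2 * y"
proof -
  \<comment> \<open>A radius that is at most \<open>1\<close> and at most \<open>x\<close>.\<close>
  define r where "r = x / (1 + x)"
  have r: "r > 0" "r \<le> 1" "r \<le> x" using x by (auto simp: r_def field_simps)
  let ?\<Omega> = "{z. norm (z - of_real x) \<le> r \<and> 0 \<le> Im z}"
  have Gh: "robin_prim holomorphic_on {z. Im z > 0}"
    using robin_prim_DERIV by (intro holomorphic_onI) (auto simp: field_differentiable_def intro: has_field_derivative_at_within)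
  have dc: "continuous_on ?\<Omega> defect"
    unfolding defect_def[abs_def] by (intro continuous_intros continuous_on_subset[OF V_cont] continuous_on_subset[OF pot_cont]) auto
  have N: "((\<lambda>y. (defect (Complex t y) - defect (of_real t)) / y) \<longlongrightarrow> 0) (at_right 0)" if "\<bar>t - x\<bar> < r" for t
    by (rule defect_Neumann) (use that r in linarith)
  have A: "defect_const * (2 + x)\<^sup>2 > 0" using defect_const_pos x by simp
  have b: "\<bar>defect z\<bar> \<le> defect_const * (2 + x)\<^sup>2" if "z \<in> ?\<Omega>" for z
  proof -
    have z: "\<bar>Re z - x\<bar> \<le> r" "\<bar>Im z\<bar> \<le> r" "0 \<le> Im z"
      using that abs_Re_le_cmod[of "z - of_real x"] abs_Im_le_cmod[of "z - of_real x"] by auto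
    have "\<bar>defect z\<bar> \<le> defect_const * (1 + \<bar>Re z\<bar>)\<^sup>2" by (rule defect_bound) (use z r in auto)
    also have "\<dots> \<le> defect_const * (2 + x)\<^sup>2" using z r x defect_const_pos by (intro mult_left_mono power_mono) auto
    finally show ?thesis .
  qed
  have "norm (Complex x y - of_real x) = y"
  proof -
    have "Complex x y - of_real x = \<i> * of_real y" by (simp add: complex_eq_iff)
    then show ?thesis using y by (simp add: norm_mult)
  qed
  then have z: "norm (Complex x y - of_real x) < r / 4" "Im (Complex x y) > 0" using y by (auto simp: r_def)
  have dG: "deriv robin_prim (Complex x y) = robin (Complex x y)" using robin_prim_DERIV[of "Complex x y"] y by (intro DERIV_imp_deriv) auto
  note est = Neumann_gradient_estimate[OF r(1) Gh dc _ N A b z, unfolded dG]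
  show "norm (robin (Complex x y)) \<le> 8 * exp 2 * (defect_const * (2 + x)\<^sup>2) / (x / (1 + x))"
    using est(1) defect_eq_Im unfolding r_def by simp
  show "\<bar>Re (robin (Complex x y))\<bar> \<le> 32 * exp 2 * (defect_const * (2 + x)\<^sup>2) / (x / (1 + x))\<^sup>2 * y"
    using est(2) defect_eq_Im unfolding r_def by simp
qed

lemma Re_robin_tendsto: assumes x: "x > 0" shows "((\<lambda>y. Re (robin (Complex x y))) \<longlongrightarrow> 0) (at_right 0)"
proof (rule Lim_null_comparison)
  have "0 < x / (1 + x) / 4" using x by simp
  from eventually_at_right_real[OF this]
  show "\<forall>\<^sub>F y in at_right 0. norm (Re (robin (Complex x y))) \<le> 32 * exp 2 * (defect_const * (2 + x)\<^sup>2) / (x / (1 + x))\<^sup>2 * y"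
    by (rule eventually_mono) (use local_estimate(2)[OF x] in auto)
  show "((\<lambda>y. 32 * exp 2 * (defect_const * (2 + x)\<^sup>2) / (x / (1 + x))\<^sup>2 * y) \<longlongrightarrow> 0) (at_right 0)"
    by (rule tendsto_eq_intros refl)+ simp
qed

text \<open>Close to the axis this is the Neumann estimate; away from it, where \<open>y\<close> is at least a multiple of
  \<open>x / (1 + x)\<close>, the bound \<open>K / y\<close> for \<open>f'\<close> suffices.\<close>

lemma robin_bound:
  obtains C where "C > 0" "\<And>x y. 0 < y \<Longrightarrow> y \<le> x \<Longrightarrow> x * norm (robin (Complex x y)) \<le> C * (1 + x) ^ 3"
proof -
  define C where "C = 32 * exp 2 * defect_const + norm (f \<i>) + 13 * K"
  show ?thesis
  proof
    show "C > 0" unfolding C_def using defect_const_pos K_pos by (intro add_pos_pos add_pos_nonneg) auto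
    fix x y :: real assume y: "0 < y" "y \<le> x"
    then have x: "x > 0" by simp
    define P where "P = 1 + x"
    have P: "P \<ge> 1" "x \<le> P" "x > 0" "P > 0" using x by (auto simp: P_def)
    have P3: "P \<le> P ^ 3" "P\<^sup>2 \<le> P ^ 3" using P power_increasing[of 1 3 P] power_increasing[of 2 3 P] by auto
    show "x * norm (robin (Complex x y)) \<le> C * (1 + x) ^ 3"
    proof (cases "y < x / (1 + x) / 4")
      case True
      have "x * norm (robin (Complex x y)) \<le> x * (8 * exp 2 * (defect_const * (2 + x)\<^sup>2) / (x / (1 + x)))"
        using local_estimate(1)[OF x y(1) True] x by (intro mult_left_mono) auto
      also have "\<dots> = 8 * exp 2 * defect_const * ((2 + x)\<^sup>2 * P)" using x by (simp add: P_def)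
      also have "\<dots> \<le> 8 * exp 2 * defect_const * ((2 * P)\<^sup>2 * P)" using x P defect_const_pos
        by (intro mult_left_mono mult_right_mono power_mono) (auto simp: P_def)
      also have "\<dots> = 32 * exp 2 * defect_const * P ^ 3" by (simp add: power_mult_distrib power2_eq_square power3_eq_cube)
      also have "\<dots> \<le> C * P ^ 3" unfolding C_def using K_pos P by (intro mult_right_mono) auto
      finally show ?thesis by (simp add: P_def)
    next
      case False
      moreover have "\<not> y < q / 4 \<Longrightarrow> q \<le> 4 * y" for q by simp
      ultimately have "x / P \<le> 4 * y" unfolding P_def by blast
      then have xy: "x / y \<le> 4 * P" using P y by (simp add: field_simps)
      have "1 / y \<le> 4 * P / x" using xy x y by (simp add: field_simps)
      have lny: "\<bar>ln y\<bar> \<le> y + 1 / y"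
      proof -
        have "ln y \<le> y - 1" using y by (intro ln_le_minus_one) auto
        moreover have "- ln y \<le> 1 / y - 1" using ln_le_minus_one[of "1 / y"] y by (simp add: ln_div)
        moreover have "1 / y > 0" using y by simp
        ultimately show ?thesis using y by linarith
      qed
      have "x * \<bar>ln y\<bar> \<le> x * (y + 1 / y)" using lny x by (intro mult_left_mono) auto
      also have "\<dots> = x * y + x / y" by (simp add: distrib_left)
      also have "x * y \<le> P * P" using P y by (intro mult_mono) auto
      finally have t1: "x * \<bar>ln y\<bar> \<le> P ^ 3 + 4 * P ^ 3" using xy P3 by (simp add: power2_eq_square)
      have t2: "x * (x / y) \<le> 4 * P ^ 3"
      proof -
        have "x * (x / y) \<le> P * (4 * P)" using xy P y by (intro mult_mono) auto
        then show ?thesis using P3 by (simp add: power2_eq_square)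
      qed
      have n1: "norm (deriv f (Complex x y)) \<le> K / y" using deriv_bound[of "Complex x y"] y by simp
      have n2: "norm (f (Complex x y)) \<le> norm (f \<i>) + K * \<bar>ln y\<bar> + K * x / y" using growth[OF y(1), of x] x by simp
      have "norm (robin (Complex x y)) \<le> K / y + (norm (f \<i>) + K * \<bar>ln y\<bar> + K * x / y)"
        unfolding robin_def using norm_triangle_ineq4[of "deriv f (Complex x y)" "\<i> * f (Complex x y)"] n1 n2 by (simp add: norm_mult)
      then have "x * norm (robin (Complex x y)) \<le> x * (K / y + (norm (f \<i>) + K * \<bar>ln y\<bar> + K * x / y))"
        using x by (intro mult_left_mono) auto
      also have "\<dots> = K * (x / y) + norm (f \<i>) * x + K * (x * \<bar>ln y\<bar>) + K * (x * (x / y))"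
        by (simp add: algebra_simps)
      also have "\<dots> \<le> K * (4 * P ^ 3) + norm (f \<i>) * P ^ 3 + K * (P ^ 3 + 4 * P ^ 3) + K * (4 * P ^ 3)"
        using xy P P3 t1 t2 K_pos by (intro add_mono mult_left_mono) auto
      also have "\<dots> \<le> C * P ^ 3" unfolding C_def using defect_const_pos P by (simp add: algebra_simps)
      finally show ?thesis by (simp add: P_def)
    qed
  qed
qed
end

section \<open>The Laplace transform of a bounded solution\<close>

context dock_solution begin

text \<open>\<open>Lg r\<close> bounds \<open>|f|\<close> at distance of order \<open>r\<close> from the origin in the sector around the imaginary axis.\<close>

definition "Lg r = norm (f \<i>) + K + K * \<bar>ln r\<bar>"

definition "sector_const = norm (f \<i>) + 3 * K"

lemma Lg_nonneg: "Lg r \<ge> 0" unfolding Lg_def using K_pos by (intro add_nonneg_nonneg mult_nonneg_nonneg) auto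

lemma sector_const_pos: "sector_const > 0" unfolding sector_const_def using K_pos by (intro add_nonneg_pos) auto

lemma Lg_le: assumes "r > 0" shows "Lg r \<le> sector_const * (sqrt r + 1 / sqrt r)"
proof -
  define P where "P = sqrt r + 1 / sqrt r"
  have P: "1 \<le> P" "\<bar>ln r\<bar> \<le> 2 * P" using one_le_log_weight[OF assms] abs_ln_le_log_weight[OF assms] by (auto simp: P_def)
  have "K * \<bar>ln r\<bar> \<le> K * (2 * P)" using P K_pos by (intro mult_left_mono) auto
  moreover have "(norm (f \<i>) + K) * 1 \<le> (norm (f \<i>) + K) * P" using P K_pos by (intro mult_left_mono) auto
  ultimately show ?thesis unfolding Lg_def sector_const_def P_def[symmetric] by (simp add: algebra_simps)
qed

lemma f_sector: assumes "r > 0" "\<bar>a\<bar> \<le> 1" shows "norm (f (of_real r * Complex a 1)) \<le> Lg r"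
proof -
  have "of_real r * Complex a 1 = Complex (r * a) r" by (simp add: complex_eq_iff)
  moreover have "norm (f (Complex (r * a) r)) \<le> norm (f \<i>) + K * \<bar>ln r\<bar> + K * \<bar>r * a\<bar> / r" by (rule growth[OF assms(1)])
  moreover have "K * \<bar>r * a\<bar> / r = K * \<bar>a\<bar>" using assms by (simp add: abs_mult)
  moreover have "K * \<bar>a\<bar> \<le> K" using assms K_pos by (simp add: mult_left_le)
  ultimately show ?thesis unfolding Lg_def by simp
qed

lemma f_flat: assumes "r > 0" "0 < \<tau>" "\<tau> \<le> 1" "\<bar>a\<bar> = 1"
  shows "norm (f (of_real r * Complex a \<tau>)) \<le> Lg r - K * ln \<tau>"
proof -
  have "of_real r * Complex a \<tau> = Complex (r * a) (r * \<tau>)" by (simp add: complex_eq_iff)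
  moreover have ra: "\<bar>r * a\<bar> = r" using assms by (simp add: abs_mult)
  moreover have "r * \<tau> \<le> r" using assms by simp
  ultimately have "norm (f (of_real r * Complex a \<tau>)) \<le> norm (f \<i>) + K + K * \<bar>ln r\<bar> + K * (ln r - ln (r * \<tau>))"
    using growth_near_axis[of "r * \<tau>" "r * a"] assms by simp
  also have "ln (r * \<tau>) = ln r + ln \<tau>" using assms by (intro ln_mult_pos) auto
  finally show ?thesis unfolding Lg_def by simp
qed

lemma f_ray_continuous: assumes "Im u > 0" shows "continuous_on {0<..} (\<lambda>r. f (of_real r * u))"
  by (rule continuous_on_compose2[OF holomorphic_on_imp_continuous_on[OF f_hol]]) (use assms in \<open>auto intro!: continuous_intros\<close>)

definition ray_Laplace :: "complex \<Rightarrow> complex \<Rightarrow> complex" where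
  "ray_Laplace u w = u * (LBINT r:{0<..}. f (of_real r * u) * exp (- (w * (of_real r * u))))"

lemma norm_exp_ray: "norm (exp (- (w * (of_real r * u)))) = exp (- Re (w * u) * r)"
proof -
  have "Re (- (w * (of_real r * u))) = - Re (w * u) * r" by (simp add: algebra_simps)
  then show ?thesis by (simp only: norm_exp_eq_Re)
qed

lemma ray_Laplace_integrand_bound:
  assumes "r > 0" "\<bar>a\<bar> \<le> 1" "0 < \<kappa>" "\<kappa> \<le> Re (w * Complex a 1)"
  shows "norm (f (of_real r * Complex a 1) * exp (- (w * (of_real r * Complex a 1)))) \<le> sector_const * ((sqrt r + 1 / sqrt r) * exp (- \<kappa> * r))"
proof -
  have "norm (f (of_real r * Complex a 1)) \<le> sector_const * (sqrt r + 1 / sqrt r)"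
    using f_sector[OF assms(1,2)] Lg_le[OF assms(1)] by linarith
  moreover have "norm (exp (- (w * (of_real r * Complex a 1)))) \<le> exp (- \<kappa> * r)"
  proof -
    have "\<kappa> * r \<le> Re (w * Complex a 1) * r" using assms by (intro mult_right_mono) auto
    then show ?thesis unfolding norm_exp_ray by (simp only: exp_le_cancel_iff minus_mult_left[symmetric] neg_le_iff_le)
  qed
  ultimately have "norm (f (of_real r * Complex a 1)) * norm (exp (- (w * (of_real r * Complex a 1)))) \<le> sector_const * (sqrt r + 1 / sqrt r) * exp (- \<kappa> * r)"
    using sector_const_pos assms(1) by (intro mult_mono) auto
  then show ?thesis by (simp add: norm_mult mult.assoc)
qed

lemma ray_Laplace_shift:
  assumes a: "\<bar>a\<bar> \<le> 1" "\<bar>b\<bar> \<le> 1" and \<kappa>: "\<kappa> > 0"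
    and re: "\<And>t. \<bar>t\<bar> \<le> 1 \<Longrightarrow> t \<in> closed_segment a b \<Longrightarrow> \<kappa> \<le> Re (w * Complex t 1)"
  shows "ray_Laplace (Complex a 1) w = ray_Laplace (Complex b 1) w"
  unfolding ray_Laplace_def
proof (rule ray_integral_shift[where h="\<lambda>z. f z * exp (- (w * z))"])
  show "open {z. Im z > 0}" "convex {z. Im z > 0}" by (auto simp: open_halfspace_Im_gt convex_halfspace_Im_gt)
  show "(\<lambda>z. f z * exp (- (w * z))) holomorphic_on {z. Im z > 0}" by (intro holomorphic_intros f_hol)
  fix r :: real and v assume r: "r > 0" and v: "v \<in> closed_segment (Complex a 1) (Complex b 1)"
  then obtain s where s: "0 \<le> s" "s \<le> 1" "v = (1 - s) *\<^sub>R Complex a 1 + s *\<^sub>R Complex b 1" by (auto simp: in_segment)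
  define t where "t = (1 - s) * a + s * b"
  have vt: "v = Complex t 1" using s by (simp add: t_def complex_eq_iff)
  have "\<bar>t\<bar> \<le> \<bar>(1 - s) * a\<bar> + \<bar>s * b\<bar>" unfolding t_def by (rule abs_triangle_ineq)
  also have "\<dots> \<le> (1 - s) * 1 + s * 1" unfolding abs_mult using s a by (intro add_mono mult_mono) auto
  finally have t1: "\<bar>t\<bar> \<le> 1" by simp
  have t2: "t \<in> closed_segment a b" using s by (auto simp: in_segment t_def)
  show "of_real r * v \<in> {z. Im z > 0}" using r by (simp add: vt)
  have "norm (f (of_real r * v) * exp (- (w * (of_real r * v)))) \<le> sector_const * ((sqrt r + 1 / sqrt r) * exp (- \<kappa> * r))"
    unfolding vt by (rule ray_Laplace_integrand_bound[OF r t1 \<kappa> re[OF t1 t2]])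
  also have "\<dots> \<le> sector_const * ((1 + 2/\<kappa> + 2/\<kappa>^2) * (1 / (sqrt r * (1 + r))))"
    using exp_decay_weight[OF r \<kappa>] sector_const_pos by (intro mult_left_mono) auto
  finally show "norm (f (of_real r * v) * exp (- (w * (of_real r * v)))) \<le> (sector_const * (1 + 2/\<kappa> + 2/\<kappa>^2)) / (sqrt r * (1 + r))" by simp
qed

lemma ray_Laplace_integrable:
  assumes a: "\<bar>a\<bar> \<le> 1" and w: "Re (w * Complex a 1) > 0"
  shows "set_integrable lborel {0<..} (\<lambda>r. f (of_real r * Complex a 1) * exp (- (w * (of_real r * Complex a 1))))"
  by (rule set_integrable_halfline_bound[OF _ ray_Laplace_integrand_bound[OF _ a w order_refl] set_integrable_mult_right[OF exp_decay_weight_integrable[OF w]]])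
     (auto intro!: continuous_intros f_ray_continuous)

lemma ray_Laplace_DERIV:
  assumes a: "\<bar>a\<bar> \<le> 1" and w: "Re (w * Complex a 1) > 0"
  defines "u \<equiv> Complex a 1"
  shows "(ray_Laplace u has_field_derivative u * (LBINT r:{0<..}. - (of_real r * u) * (f (of_real r * u) * exp (- (w * (of_real r * u)))))) (at w)"
proof -
  define \<kappa> where "\<kappa> = Re (w * u) / 2"
  have \<kappa>: "\<kappa> > 0" using w by (simp add: \<kappa>_def u_def)
  have u: "u \<noteq> 0" "norm u > 0" by (auto simp: u_def complex_eq_iff)
  define e where "e = \<kappa> / norm u"
  have e: "e > 0" using \<kappa> u by (simp add: e_def)
  have near: "\<kappa> \<le> Re (v * u)" if "v \<in> ball w e" for v
  proof -
    have "Re (w * u) - Re (v * u) \<le> norm ((w - v) * u)" using complex_Re_le_cmod[of "(w - v) * u"] by (simp add: algebra_simps)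
    also have "\<dots> \<le> e * norm u" using that by (simp add: norm_mult dist_norm mult_right_mono)
    also have "\<dots> = \<kappa>" using u by (simp add: e_def)
    finally show ?thesis unfolding \<kappa>_def by linarith
  qed
  have "((\<lambda>w. LBINT r:{0<..}. f (of_real r * u) * exp (- (w * (of_real r * u)))) has_field_derivative
     (LBINT r:{0<..}. - (of_real r * u) * (f (of_real r * u) * exp (- (w * (of_real r * u)))))) (at w)"
  proof (rule halfline_integral_has_field_derivative[OF e])
    show "continuous_on {0<..} (\<lambda>r. f (of_real r * u) * exp (- (z * (of_real r * u))))" for z
      by (intro continuous_intros f_ray_continuous) (simp add: u_def)
    show "norm (f (of_real r * u) * exp (- (z * (of_real r * u)))) \<le> sector_const * ((sqrt r + 1 / sqrt r) * exp (- \<kappa> * r))"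
      if "0 < r" "z \<in> ball w e" for r z
      unfolding u_def by (rule ray_Laplace_integrand_bound[OF that(1) a \<kappa>]) (use near[OF that(2)] in \<open>simp only: u_def\<close>)
    show "set_integrable lborel {0<..} (\<lambda>r. sector_const * ((sqrt r + 1 / sqrt r) * exp (- \<kappa> * r)))"
      by (rule set_integrable_mult_right[OF exp_decay_weight_integrable[OF \<kappa>]])
  qed (auto intro!: derivative_eq_intros)
  then show ?thesis unfolding ray_Laplace_def[abs_def] by (rule DERIV_cmult)
qed

definition "sector_mass = (LBINT r:{0<..}. Lg r * exp (- r))"

lemma Lg_exp_integrable: assumes "\<kappa> > 0" shows "set_integrable lborel {0<..} (\<lambda>r. Lg r * exp (- \<kappa> * r))"
proof (rule set_integrable_halfline_bound[OF _ _ set_integrable_mult_right[OF exp_decay_weight_integrable[OF assms], of sector_const]])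
  show "norm (Lg r * exp (- \<kappa> * r)) \<le> sector_const * ((sqrt r + 1 / sqrt r) * exp (- \<kappa> * r))" if "r > 0" for r
    using mult_right_mono[OF Lg_le[OF that], of "exp (- \<kappa> * r)"] Lg_nonneg[of r] by (simp add: abs_mult mult.assoc)
  show "continuous_on {0<..} (\<lambda>r. Lg r * exp (- \<kappa> * r))" unfolding Lg_def by (auto intro!: continuous_intros)
qed

lemma sector_mass_nonneg: "sector_mass \<ge> 0"
  unfolding sector_mass_def set_lebesgue_integral_def by (rule integral_nonneg_AE) (auto simp: indicator_def Lg_nonneg)

text \<open>By the substitution \<open>r \<rightarrow> r / \<kappa>\<close>, under which the logarithm in \<open>Lg\<close> changes by at most \<open>|ln \<kappa>|\<close>.\<close>

lemma Lg_exp_scaled: assumes \<kappa>: "\<kappa> > 0"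
  shows "(LBINT r:{0<..}. Lg r * exp (- \<kappa> * r)) \<le> (sector_mass + K * \<bar>ln \<kappa>\<bar>) / \<kappa>"
proof -
  have "(LBINT r:{0<..}. Lg r * exp (- \<kappa> * r)) = \<bar>1/\<kappa>\<bar> *\<^sub>R (LBINT r. indicat_real {0<..} (0 + 1/\<kappa> * r) *\<^sub>R (Lg (0 + 1/\<kappa> * r) * exp (- \<kappa> * (0 + 1/\<kappa> * r))))"
    unfolding set_lebesgue_integral_def using \<kappa> by (intro lborel_integral_real_affine) auto
  also have "\<dots> = (LBINT r:{0<..}. Lg (r / \<kappa>) * exp (- r)) / \<kappa>"
  proof -
    have "indicat_real {0<..} (0 + 1/\<kappa> * r) *\<^sub>R (Lg (0 + 1/\<kappa> * r) * exp (- \<kappa> * (0 + 1/\<kappa> * r))) = indicat_real {0<..} r *\<^sub>R (Lg (r / \<kappa>) * exp (- r))" for r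
      using \<kappa> by (auto simp: indicator_def zero_less_divide_iff)
    then show ?thesis unfolding set_lebesgue_integral_def using \<kappa> by (simp only:) simp
  qed
  also have "(LBINT r:{0<..}. Lg (r / \<kappa>) * exp (- r)) \<le> sector_mass + K * \<bar>ln \<kappa>\<bar>"
  proof -
    have e1: "set_integrable lborel {0<..} (\<lambda>r::real. exp (- r))" "(LBINT r:{0<..}. exp (- r)) = (1::real)"
      using exp_decay_integral[of 1] by simp_all
    have i: "set_integrable lborel {0<..} (\<lambda>r. Lg r * exp (- r))" using Lg_exp_integrable[of 1] by simp
    have i2: "set_integrable lborel {0<..} (\<lambda>r. K * \<bar>ln \<kappa>\<bar> * exp (- r))" using e1(1) by simp
    have b: "norm (Lg (r / \<kappa>) * exp (- r)) \<le> Lg r * exp (- r) + K * \<bar>ln \<kappa>\<bar> * exp (- r)" if "r > 0" for r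
    proof -
      have "\<bar>ln (r / \<kappa>)\<bar> \<le> \<bar>ln r\<bar> + \<bar>ln \<kappa>\<bar>" using that \<kappa> by (simp add: ln_div)
      then have "K * \<bar>ln (r / \<kappa>)\<bar> \<le> K * (\<bar>ln r\<bar> + \<bar>ln \<kappa>\<bar>)" using K_pos by (intro mult_left_mono) auto
      then have "Lg (r / \<kappa>) \<le> Lg r + K * \<bar>ln \<kappa>\<bar>" by (simp add: Lg_def distrib_left)
      then have "Lg (r / \<kappa>) * exp (- r) \<le> (Lg r + K * \<bar>ln \<kappa>\<bar>) * exp (- r)" by (intro mult_right_mono) auto
      then show ?thesis using Lg_nonneg[of "r / \<kappa>"] by (simp add: abs_mult distrib_right)
    qed
    have "norm (LBINT r:{0<..}. Lg (r / \<kappa>) * exp (- r)) \<le> (LBINT r:{0<..}. Lg r * exp (- r) + K * \<bar>ln \<kappa>\<bar> * exp (- r))"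
    proof (rule halfline_integral_norm_bound[OF _ b set_integral_add(1)[OF i i2]])
      show "continuous_on {0<..} (\<lambda>r. Lg (r / \<kappa>) * exp (- r))" unfolding Lg_def using \<kappa> by (auto intro!: continuous_intros)
    qed
    also have "\<dots> = sector_mass + K * \<bar>ln \<kappa>\<bar>" unfolding set_integral_add(2)[OF i i2] sector_mass_def using e1(2) by simp
    finally show ?thesis by simp
  qed
  finally show ?thesis using \<kappa> by (simp add: divide_right_mono)
qed

lemma ray_Laplace_bound:
  assumes a: "\<bar>a\<bar> \<le> 1" and w: "Re (w * Complex a 1) > 0"
  shows "norm (ray_Laplace (Complex a 1) w) \<le> 2 * ((sector_mass + K * \<bar>ln (Re (w * Complex a 1))\<bar>) / Re (w * Complex a 1))"
proof -
  have "norm (LBINT r:{0<..}. f (of_real r * Complex a 1) * exp (- (w * (of_real r * Complex a 1)))) \<le> (LBINT r:{0<..}. Lg r * exp (- Re (w * Complex a 1) * r))"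
  proof (rule halfline_integral_norm_bound[OF _ _ Lg_exp_integrable[OF w]])
    show "continuous_on {0<..} (\<lambda>r. f (of_real r * Complex a 1) * exp (- (w * (of_real r * Complex a 1))))"
      by (intro continuous_intros f_ray_continuous) simp
    show "norm (f (of_real r * Complex a 1) * exp (- (w * (of_real r * Complex a 1)))) \<le> Lg r * exp (- Re (w * Complex a 1) * r)" if "r > 0" for r
      unfolding norm_mult norm_exp_ray by (intro mult_right_mono f_sector[OF that a]) auto
  qed
  also have "\<dots> \<le> (sector_mass + K * \<bar>ln (Re (w * Complex a 1))\<bar>) / Re (w * Complex a 1)" by (rule Lg_exp_scaled[OF w])
  finally have b: "norm (LBINT r:{0<..}. f (of_real r * Complex a 1) * exp (- (w * (of_real r * Complex a 1)))) \<le> \<dots>" .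
  have "norm (Complex a 1) \<le> 2" using cmod_le[of "Complex a 1"] a by simp
  then show ?thesis unfolding ray_Laplace_def norm_mult using b by (intro mult_mono) auto
qed

text \<open>Two rays suffice: each transform is holomorphic in a half-plane, the two half-planes cover the closed
  lower half-plane except for the origin, and on their intersection the transforms agree.\<close>

definition Phi :: "complex \<Rightarrow> complex" where
  "Phi w = (if Re w \<ge> 0 then ray_Laplace (Complex 1 1) w else ray_Laplace (Complex (- 1) 1) w)"

definition "phi_region = {w::complex. Im w < \<bar>Re w\<bar>}"

lemma ray_Laplace_agree: assumes "Im w < - \<bar>Re w\<bar>" shows "ray_Laplace (Complex 1 1) w = ray_Laplace (Complex (- 1) 1) w"
proof (rule ray_Laplace_shift[where \<kappa>="- Im w - \<bar>Re w\<bar>"])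
  fix t :: real assume t: "\<bar>t\<bar> \<le> 1"
  have "\<bar>t * Re w\<bar> \<le> 1 * \<bar>Re w\<bar>" unfolding abs_mult using t by (intro mult_right_mono) auto
  then show "- Im w - \<bar>Re w\<bar> \<le> Re (w * Complex t 1)" by (simp add: mult.commute)
qed (use assms in auto)

lemma Phi_right: "Re w - Im w > 0 \<Longrightarrow> Phi w = ray_Laplace (Complex 1 1) w"
  using ray_Laplace_agree[of w] by (cases "Re w \<ge> 0") (auto simp: Phi_def)

lemma Phi_left: "- Re w - Im w > 0 \<Longrightarrow> Phi w = ray_Laplace (Complex (- 1) 1) w"
  using ray_Laplace_agree[of w] by (cases "Re w \<ge> 0") (auto simp: Phi_def)

lemma Phi_hol: "Phi holomorphic_on phi_region"
proof -
  have e: "phi_region = {w. Re w - Im w > 0} \<union> {w. - Re w - Im w > 0}" by (auto simp: phi_region_def)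
  have eq: "{w. Re w - Im w > 0} = {w. Complex 1 (- 1) \<bullet> w > 0}" "{w. - Re w - Im w > 0} = {w. Complex (- 1) (- 1) \<bullet> w > 0}"
    by (auto simp: inner_complex_def)
  have o: "open {w. Re w - Im w > 0}" "open {w. - Re w - Im w > 0}" unfolding eq by (rule open_halfspace_gt)+
  have 1: "Phi holomorphic_on {w. Re w - Im w > 0}"
  proof (rule holomorphic_transform[of "ray_Laplace (Complex 1 1)"])
    show "ray_Laplace (Complex 1 1) holomorphic_on {w. Re w - Im w > 0}"
    proof (rule holomorphic_onI)
      fix w assume "w \<in> {w. Re w - Im w > 0}"
      then have "Re (w * Complex 1 1) > 0" by simp
      from ray_Laplace_DERIV[OF _ this] show "ray_Laplace (Complex 1 1) field_differentiable at w within {w. Re w - Im w > 0}"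
        by (auto simp: field_differentiable_def intro: has_field_derivative_at_within)
    qed
  qed (simp add: Phi_right)
  have 2: "Phi holomorphic_on {w. - Re w - Im w > 0}"
  proof (rule holomorphic_transform[of "ray_Laplace (Complex (- 1) 1)"])
    show "ray_Laplace (Complex (- 1) 1) holomorphic_on {w. - Re w - Im w > 0}"
    proof (rule holomorphic_onI)
      fix w assume "w \<in> {w. - Re w - Im w > 0}"
      then have "Re (w * Complex (- 1) 1) > 0" by simp
      from ray_Laplace_DERIV[OF _ this] show "ray_Laplace (Complex (- 1) 1) field_differentiable at w within {w. - Re w - Im w > 0}"
        by (auto simp: field_differentiable_def intro: has_field_derivative_at_within)
    qed
  qed (simp add: Phi_left)
  show ?thesis unfolding e using 1 2 o by (rule holomorphic_on_Un)
qed

text \<open>For each \<open>w\<close> the ray can be chosen such that \<open>Re (w u)\<close> is comparable to \<open>|w|\<close>; the bound is therefore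
  uniform up to the real axis.\<close>

lemma Phi_bound:
  obtains C where "C > 0" "\<And>w. Im w \<le> 0 \<Longrightarrow> w \<noteq> 0 \<Longrightarrow> norm (Phi w) \<le> C * (1 + \<bar>ln (norm w)\<bar>) / norm w"
proof -
  define C where "C = 2 * (sector_mass + 2 * K)"
  have *: "norm (ray_Laplace (Complex a 1) w) \<le> C * (1 + \<bar>ln (norm w)\<bar>) / norm w"
    if a: "\<bar>a\<bar> \<le> 1" and w: "w \<noteq> 0" and k: "Re (w * Complex a 1) = \<bar>Re w\<bar> + \<bar>Im w\<bar>" for a w
  proof -
    define \<kappa> where "\<kappa> = \<bar>Re w\<bar> + \<bar>Im w\<bar>"
    define n where "n = norm w"
    have n: "n > 0" using w by (simp add: n_def)
    have \<kappa>: "n \<le> \<kappa>" "\<kappa> \<le> 2 * n" using cmod_le[of w] abs_Re_le_cmod[of w] abs_Im_le_cmod[of w] by (auto simp: n_def \<kappa>_def)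
    have "ln \<kappa> \<le> ln (2 * n)" using \<kappa> n by (intro ln_mono) auto
    also have "\<dots> = ln 2 + ln n" using n by (intro ln_mult_pos) auto
    also have "ln 2 \<le> (1::real)" using ln_le_minus_one[of "2::real"] by simp
    finally have "ln \<kappa> \<le> 1 + ln n" by simp
    moreover have "ln n \<le> ln \<kappa>" using \<kappa> n by (intro ln_mono) auto
    ultimately have l: "\<bar>ln \<kappa>\<bar> \<le> 1 + \<bar>ln n\<bar>" by linarith
    have "norm (ray_Laplace (Complex a 1) w) \<le> 2 * ((sector_mass + K * \<bar>ln \<kappa>\<bar>) / \<kappa>)"
      using ray_Laplace_bound[OF a, of w] n \<kappa> unfolding k \<kappa>_def[symmetric] by simp
    also have "\<dots> \<le> 2 * ((sector_mass + K * (1 + \<bar>ln n\<bar>)) / n)"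
      using l \<kappa> n K_pos sector_mass_nonneg by (intro mult_left_mono frac_le add_left_mono) auto
    also have "\<dots> \<le> C * (1 + \<bar>ln n\<bar>) / n"
    proof -
      have "sector_mass * 1 \<le> sector_mass * (1 + \<bar>ln n\<bar>)" using sector_mass_nonneg by (intro mult_left_mono) auto
      moreover have "0 \<le> K * (1 + \<bar>ln n\<bar>)" using K_pos by simp
      ultimately have "2 * (sector_mass + K * (1 + \<bar>ln n\<bar>)) \<le> C * (1 + \<bar>ln n\<bar>)" unfolding C_def by (simp add: algebra_simps)
      then have "2 * (sector_mass + K * (1 + \<bar>ln n\<bar>)) / n \<le> C * (1 + \<bar>ln n\<bar>) / n" using n by (intro divide_right_mono) auto
      then show ?thesis by simp
    qed
    finally show ?thesis by (simp add: n_def)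
  qed
  show ?thesis
  proof
    show "C > 0" using K_pos sector_mass_nonneg by (simp add: C_def)
    show "norm (Phi w) \<le> C * (1 + \<bar>ln (norm w)\<bar>) / norm w" if "Im w \<le> 0" "w \<noteq> 0" for w
      unfolding Phi_def using *[of 1 w] *[of "- 1" w] that by auto
  qed
qed

lemma Phi_imaginary_axis:
  assumes s: "s > 0"
  shows "Phi (- \<i> * of_real s) = \<i> * (LBINT r:{0<..}. f (\<i> * of_real r) * of_real (exp (- s * r)))"
proof -
  let ?w = "- \<i> * complex_of_real s"
  have "Phi ?w = ray_Laplace (Complex 1 1) ?w" using s by (intro Phi_right) simp
  also have "\<dots> = ray_Laplace (Complex 0 1) ?w" by (rule ray_Laplace_shift[where \<kappa>=s]) (use s in auto)
  also have "\<dots> = \<i> * (LBINT r:{0<..}. f (\<i> * of_real r) * of_real (exp (- s * r)))"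
  proof -
    have c: "Complex 0 1 = \<i>" by (simp add: complex_eq_iff)
    have "exp (- (?w * (of_real r * \<i>))) = complex_of_real (exp (- s * r))" for r
    proof -
      have "- (?w * (of_real r * \<i>)) = complex_of_real (- s * r)" by (simp add: complex_eq_iff)
      then show ?thesis by (simp only: exp_of_real)
    qed
    then show ?thesis unfolding ray_Laplace_def c by (simp only: mult.commute[of _ \<i>])
  qed
  finally show ?thesis .
qed

lemma f_imaginary_integrable:
  assumes s: "s > 0" shows "set_integrable lborel {0<..} (\<lambda>r. f (\<i> * of_real r) * of_real (exp (- s * r)))"
proof (rule set_integrable_halfline_bound[OF _ _ Lg_exp_integrable[OF s]])
  show "continuous_on {0<..} (\<lambda>r. f (\<i> * of_real r) * of_real (exp (- s * r)))"
    using f_ray_continuous[of \<i>] by (intro continuous_intros) (simp add: mult.commute)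
  show "norm (f (\<i> * of_real r) * of_real (exp (- s * r))) \<le> Lg r * exp (- s * r)" if "r > 0" for r
  proof -
    have "of_real r * Complex 0 1 = \<i> * complex_of_real r" by (simp add: complex_eq_iff)
    then have "norm (f (\<i> * of_real r)) \<le> Lg r" using f_sector[OF that, of 0] by (simp only: abs_zero zero_le_one)
    then have "norm (f (\<i> * of_real r)) * exp (- s * r) \<le> Lg r * exp (- s * r)" by (intro mult_right_mono) auto
    then show ?thesis by (simp add: norm_mult norm_of_real del: of_real_exp)
  qed
qed
end

section \<open>The boundary relations on the two half-axes\<close>

definition "eps n = 1 / (real n + 1)"

lemma eps: "0 < eps n" "eps n \<le> 1" by (auto simp: eps_def)

lemma eps_tendsto: "eps \<longlonglongrightarrow> 0" "(\<lambda>n. - (eps n * ln (eps n))) \<longlonglongrightarrow> 0"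
  unfolding eps_def[abs_def] by real_asymp+

lemma eps_ln: "0 \<le> - (eps n * ln (eps n))" "- (eps n * ln (eps n)) \<le> 1"
proof -
  have "ln (eps n) \<le> 0" using eps by simp
  then show "0 \<le> - (eps n * ln (eps n))" using eps[of n] by (simp add: mult_nonneg_nonpos)
  have "- ln (eps n) \<le> 1 / eps n - 1" using ln_le_minus_one[of "1 / eps n"] eps[of n] by (simp add: ln_div)
  then have "eps n * (- ln (eps n)) \<le> eps n * (1 / eps n - 1)" using eps[of n] by (intro mult_left_mono) auto
  also have "\<dots> \<le> 1" using eps[of n] by (simp add: right_diff_distrib)
  finally show "- (eps n * ln (eps n)) \<le> 1" by simp
qed

lemma eps_filterlim: assumes "r > 0" shows "filterlim (\<lambda>n. r * eps n) (at_right 0) sequentially"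
proof -
  have "(\<lambda>n. r * eps n) \<longlonglongrightarrow> r * 0" by (intro tendsto_intros eps_tendsto)
  then show ?thesis using assms eps by (intro tendsto_imp_filterlim_at_right) auto
qed

context dock_solution begin

text \<open>Turn the ray towards the negative half-axis. There the imaginary part of \<open>f\<close> tends to zero, and \<open>Re f\<close>
  grows at most like \<open>ln (1 / \<epsilon>)\<close> at slope \<open>\<epsilon>\<close>, while the imaginary part of its cofactor is \<open>O(\<epsilon>)\<close>.\<close>

lemma Phi_real_negative_axis:
  assumes s: "s > 0"
  shows "Im (Phi (- of_real s)) = 0"
proof -
  define u where "u n = Complex (- 1) (eps n)" for n
  define q where "q n r = u n * exp (of_real s * (of_real r * u n))" for n and r :: real
  define I where "I n r = Im (f (of_real r * u n) * q n r)" for n r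
  have P1: "Phi (- of_real s) = u n * (LBINT r:{0<..}. f (of_real r * u n) * exp (of_real s * (of_real r * u n)))" for n
  proof -
    have "Phi (- of_real s) = Complex (- 1) 1 * (LBINT r:{0<..}. f (of_real r * Complex (- 1) 1) * exp (of_real s * (of_real r * Complex (- 1) 1)))"
      using s by (simp add: Phi_left ray_Laplace_def)
    also have "\<dots> = u n * (LBINT r:{0<..}. f (of_real r * u n) * exp (of_real s * (of_real r * u n)))"
    proof (rule ray_integral_shift[where h="\<lambda>z. f z * exp (of_real s * z)"])
      show "open {z. Im z > 0}" "convex {z. Im z > 0}" by (auto simp: open_halfspace_Im_gt convex_halfspace_Im_gt)
      show "(\<lambda>z. f z * exp (of_real s * z)) holomorphic_on {z. Im z > 0}" by (intro holomorphic_intros f_hol)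
      fix r :: real and v assume r: "r > 0" and v: "v \<in> closed_segment (Complex (- 1) 1) (u n)"
      then obtain t where t: "0 \<le> t" "t \<le> 1" "v = (1 - t) *\<^sub>R Complex (- 1) 1 + t *\<^sub>R u n" by (auto simp: in_segment)
      define \<tau> where "\<tau> = (1 - t) + t * eps n"
      have vt: "v = Complex (- 1) \<tau>" using t by (simp add: \<tau>_def u_def complex_eq_iff)
      have "eps n * 1 \<le> (1 - t) * (1 - eps n) + eps n" using t eps[of n] by simp
      then have "eps n \<le> \<tau>" by (simp add: \<tau>_def algebra_simps)
      moreover have "t * eps n \<le> t * 1" using t eps[of n] by (intro mult_left_mono) auto
      ultimately have \<tau>: "eps n \<le> \<tau>" "\<tau> \<le> 1" "0 < \<tau>" using eps[of n] by (auto simp: \<tau>_def)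
      show "of_real r * v \<in> {z. Im z > 0}" using r \<tau> by (simp add: vt)
      define P where "P = sqrt r + 1 / sqrt r"
      have P: "P \<ge> 1" using one_le_log_weight[OF r] by (simp add: P_def)
      have "ln (eps n) \<le> ln \<tau>" using \<tau> eps[of n] by (intro ln_mono) auto
      then have "- (K * ln \<tau>) \<le> - (K * ln (eps n))" using K_pos by simp
      then have "norm (f (of_real r * v)) \<le> Lg r - K * ln (eps n)"
        unfolding vt using f_flat[OF r \<tau>(3,2), of "- 1"] by simp
      also have "\<dots> \<le> sector_const * P + - (K * ln (eps n)) * P"
      proof -
        have "0 \<le> - (K * ln (eps n))" using eps[of n] K_pos by (simp add: mult_nonneg_nonpos)
        then have "- (K * ln (eps n)) * 1 \<le> - (K * ln (eps n)) * P" using P by (intro mult_left_mono) auto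
        then show ?thesis using Lg_le[OF r] by (simp add: P_def)
      qed
      finally have fb: "norm (f (of_real r * v)) \<le> (sector_const - K * ln (eps n)) * P" by (simp add: algebra_simps)
      have "norm (exp (of_real s * (of_real r * v))) = exp (- s * r)" unfolding norm_exp_eq_Re vt by simp
      then have "norm (f (of_real r * v) * exp (of_real s * (of_real r * v))) \<le> (sector_const - K * ln (eps n)) * P * exp (- s * r)"
        unfolding norm_mult using fb order_trans[OF norm_ge_zero fb] by (intro mult_mono) auto
      also have "\<dots> = (sector_const - K * ln (eps n)) * (P * exp (- s * r))" by simp
      also have "\<dots> \<le> (sector_const - K * ln (eps n)) * ((1 + 2/s + 2/s^2) * (1 / (sqrt r * (1 + r))))"
      proof (rule mult_left_mono)
        show "P * exp (- s * r) \<le> (1 + 2/s + 2/s^2) * (1 / (sqrt r * (1 + r)))" unfolding P_def by (rule exp_decay_weight[OF r s])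
        have "0 \<le> - (K * ln (eps n))" using eps[of n] K_pos by (simp add: mult_nonneg_nonpos)
        then show "0 \<le> sector_const - K * ln (eps n)" using sector_const_pos by linarith
      qed
      finally show "norm (f (of_real r * v) * exp (of_real s * (of_real r * v))) \<le> ((sector_const - K * ln (eps n)) * (1 + 2/s + 2/s^2)) / (sqrt r * (1 + r))"
        by simp
    qed
    finally show ?thesis .
  qed
  have uIm: "Im (u n) > 0" for n using eps by (simp add: u_def)
  have fcont: "continuous_on {0<..} (\<lambda>r. f (of_real r * u n) * q n r)" for n
    unfolding q_def by (intro continuous_intros f_ray_continuous uIm)
  have qform: "q n r = of_real (exp (- s * r)) * (u n * cis (s * r * eps n))" for n r
  proof -
    have "of_real s * (of_real r * u n) = Complex (- s * r) (s * r * eps n)" by (simp add: u_def complex_eq_iff)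
    then show ?thesis unfolding q_def by (simp add: exp_eq_polar mult_ac)
  qed
  have nu: "norm (u n) \<le> 2" for n using cmod_le[of "u n"] eps[of n] by (simp add: u_def)
  have Req: "\<bar>Re (q n r)\<bar> \<le> 2 * exp (- s * r)" for n r
  proof -
    have "norm (q n r) = exp (- s * r) * norm (u n)" unfolding qform norm_mult by simp
    also have "\<dots> \<le> exp (- s * r) * 2" using nu by (intro mult_left_mono) auto
    finally show ?thesis using abs_Re_le_cmod[of "q n r"] by simp
  qed
  have Imq: "\<bar>Im (q n r)\<bar> \<le> exp (- s * r) * (eps n * (1 + s * r))" if "r > 0" for n r
  proof -
    define \<theta> where "\<theta> = s * r * eps n"
    have \<theta>: "\<theta> > 0" using s that eps[of n] by (simp add: \<theta>_def)
    have "\<bar>Im (u n * cis \<theta>)\<bar> = \<bar>eps n * cos \<theta> - sin \<theta>\<bar>" by (simp add: u_def)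
    also have "\<dots> \<le> \<bar>eps n * cos \<theta>\<bar> + \<bar>sin \<theta>\<bar>" by (rule abs_triangle_ineq4)
    also have "\<bar>eps n * cos \<theta>\<bar> \<le> eps n * 1" unfolding abs_mult using eps[of n] by (intro mult_mono) auto
    also have "\<bar>sin \<theta>\<bar> \<le> \<theta>" using abs_sin_le_one abs_sin_x_le_abs_x[of \<theta>] \<theta> by simp
    finally have "\<bar>Im (u n * cis \<theta>)\<bar> \<le> eps n * (1 + s * r)" by (simp add: \<theta>_def algebra_simps)
    moreover have "Im (q n r) = exp (- s * r) * Im (u n * cis \<theta>)" unfolding qform \<theta>_def by simp
    ultimately show ?thesis by (simp add: abs_mult)
  qed
  have IV: "I n r = Re (f (of_real r * u n)) * Im (q n r) + V (of_real r * u n) * Re (q n r)" if "r > 0" for n r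
    using V_f[of "of_real r * u n"] that uIm[of n] by (simp add: I_def)
  have fb: "\<bar>Re (f (of_real r * u n))\<bar> \<le> Lg r - K * ln (eps n)" if "r > 0" for n r
    using f_flat[OF that eps, of "- 1" n] abs_Re_le_cmod[of "f (of_real r * u n)"] by (simp add: u_def)
  have t1: "\<bar>Re (f (of_real r * u n)) * Im (q n r)\<bar> \<le> (eps n * Lg r + K * (- (eps n * ln (eps n)))) * ((1 + s * r) * exp (- s * r))" if r: "r > 0" for n r
  proof -
    have "\<bar>Re (f (of_real r * u n))\<bar> * \<bar>Im (q n r)\<bar> \<le> (Lg r - K * ln (eps n)) * (exp (- s * r) * (eps n * (1 + s * r)))"
      using fb[OF r, of n] Imq[OF r, of n] by (intro mult_mono) auto
    then show ?thesis by (simp add: abs_mult algebra_simps)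
  qed
  have poly: "(1 + s * r) * exp (- s * r) \<le> 2 * exp (- (s / 2) * r)" if "r > 0" for r
  proof -
    have "1 + s * r \<le> 2 * (1 + s / 2 * r)" by simp
    also have "\<dots> \<le> 2 * exp (s / 2 * r)" by (intro mult_left_mono exp_ge_add_one_self) simp
    finally have "(1 + s * r) * exp (- s * r) \<le> 2 * exp (s / 2 * r) * exp (- s * r)" by (intro mult_right_mono) auto
    also have "\<dots> = 2 * exp (- (s / 2) * r)" by (simp add: mult.assoc mult_exp_exp)
    finally show ?thesis .
  qed
  have expmono: "exp (- s * r) \<le> exp (- (s / 2) * r)" if "r > 0" for r using s that by simp
  define m where "m r = (2 * (sector_const + K) + 2 * M) * ((sqrt r + 1 / sqrt r) * exp (- (s / 2) * r))" for r
  have mint: "set_integrable lborel {0<..} m" unfolding m_def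
    by (rule set_integrable_mult_right[OF exp_decay_weight_integrable]) (use s in simp)
  have bd: "norm (I n r) \<le> m r" if r: "r > 0" for n r
  proof -
    define P E where "P = sqrt r + 1 / sqrt r" and "E = exp (- (s / 2) * r)"
    have P: "P \<ge> 1" and E: "E > 0" using one_le_log_weight[OF r] by (auto simp: P_def E_def)
    have "eps n * Lg r + K * (- (eps n * ln (eps n))) \<le> 1 * (sector_const * P) + K * 1"
      using eps[of n] Lg_le[OF r] Lg_nonneg[of r] eps_ln[of n] K_pos by (intro add_mono mult_mono mult_left_mono) (auto simp: P_def)
    also have "\<dots> \<le> (sector_const + K) * P"
    proof -
      have "K * 1 \<le> K * P" using P K_pos by (intro mult_left_mono) auto
      then show ?thesis by (simp add: algebra_simps)
    qed
    finally have a: "eps n * Lg r + K * (- (eps n * ln (eps n))) \<le> (sector_const + K) * P" .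
    have "(eps n * Lg r + K * (- (eps n * ln (eps n)))) * ((1 + s * r) * exp (- s * r)) \<le> ((sector_const + K) * P) * (2 * E)"
    proof (rule mult_mono[OF a])
      show "(1 + s * r) * exp (- s * r) \<le> 2 * E" unfolding E_def by (rule poly[OF r])
      show "0 \<le> (sector_const + K) * P" using sector_const_pos K_pos P by (intro mult_nonneg_nonneg) auto
      show "0 \<le> (1 + s * r) * exp (- s * r)" using s r by simp
    qed
    moreover have "\<bar>V (of_real r * u n) * Re (q n r)\<bar> \<le> M * (2 * E)"
    proof -
      have "\<bar>V (of_real r * u n)\<bar> \<le> M" using r uIm[of n] by (intro V_bound) simp
      moreover have "\<bar>Re (q n r)\<bar> \<le> 2 * E" using Req[of n r] expmono[OF r] unfolding E_def by linarith
      ultimately show ?thesis unfolding abs_mult using M by (intro mult_mono) auto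
    qed
    moreover have "M * (2 * E) \<le> M * (2 * E) * P" using mult_left_mono[of 1 P "M * (2 * E)"] P M E by simp
    ultimately have "\<bar>I n r\<bar> \<le> ((sector_const + K) * P) * (2 * E) + M * (2 * E) * P"
      unfolding IV[OF r] using t1[OF r, of n] by linarith
    then show ?thesis unfolding m_def P_def[symmetric] E_def[symmetric] by (simp add: algebra_simps)
  qed
  have lim: "(\<lambda>n. I n r) \<longlonglongrightarrow> 0" if r: "r > 0" for r
  proof -
    have "(\<lambda>n. (eps n * Lg r + K * (- (eps n * ln (eps n)))) * ((1 + s * r) * exp (- s * r))) \<longlonglongrightarrow> (0 * Lg r + K * 0) * ((1 + s * r) * exp (- s * r))"
      by (intro tendsto_intros eps_tendsto)
    then have z: "(\<lambda>n. (eps n * Lg r + K * (- (eps n * ln (eps n)))) * ((1 + s * r) * exp (- s * r))) \<longlonglongrightarrow> 0" by simp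
    have 1: "(\<lambda>n. Re (f (of_real r * u n)) * Im (q n r)) \<longlonglongrightarrow> 0"
      by (rule Lim_null_comparison[OF _ z]) (use t1[OF r] in auto)
    have "(\<lambda>n. of_real r * u n) \<longlonglongrightarrow> of_real r * Complex (- 1) 0" unfolding u_def
      by (intro tendsto_intros eps_tendsto)
    then have "(\<lambda>n. V (of_real r * u n)) \<longlonglongrightarrow> V (of_real r * Complex (- 1) 0)"
      by (rule continuous_on_tendsto_compose[OF V_cont]) (use r uIm in \<open>auto intro!: always_eventually less_imp_le mult_pos_pos\<close>)
    moreover have "of_real r * Complex (- 1) 0 = of_real (- r)" by (simp add: complex_eq_iff)
    ultimately have Vl: "(\<lambda>n. V (of_real r * u n)) \<longlonglongrightarrow> 0" using V_zero[of "- r"] r by simp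
    have 2: "(\<lambda>n. V (of_real r * u n) * Re (q n r)) \<longlonglongrightarrow> 0"
    proof (rule Lim_null_comparison)
      show "(\<lambda>n. \<bar>V (of_real r * u n)\<bar> * (2 * exp (- s * r))) \<longlonglongrightarrow> 0"
        using tendsto_mult_left_zero[OF tendsto_rabs_zero[OF Vl]] .
      show "\<forall>\<^sub>F n in sequentially. norm (V (of_real r * u n) * Re (q n r)) \<le> \<bar>V (of_real r * u n)\<bar> * (2 * exp (- s * r))"
        using Req[of _ r] by (auto simp: abs_mult intro!: always_eventually mult_left_mono)
    qed
    show ?thesis unfolding IV[OF r] using tendsto_add[OF 1 2] by simp
  qed
  have int: "set_integrable lborel {0<..} (\<lambda>r. f (of_real r * u n) * exp (of_real s * (of_real r * u n)))" for n
  proof (rule set_integrable_halfline_bound[OF _ _ set_integrable_mult_right[OF exp_decay_weight_integrable[OF s], of "sector_const - K * ln (eps n)"]])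
    show "continuous_on {0<..} (\<lambda>r. f (of_real r * u n) * exp (of_real s * (of_real r * u n)))"
      by (intro continuous_intros f_ray_continuous uIm)
    show "norm (f (of_real r * u n) * exp (of_real s * (of_real r * u n))) \<le> (sector_const - K * ln (eps n)) * ((sqrt r + 1 / sqrt r) * exp (- s * r))" if r: "r > 0" for r
    proof -
      have "0 \<le> - (K * ln (eps n))" using eps[of n] K_pos by (simp add: mult_nonneg_nonpos)
      then have "- (K * ln (eps n)) * 1 \<le> - (K * ln (eps n)) * (sqrt r + 1 / sqrt r)" using one_le_log_weight[OF r] by (intro mult_left_mono) auto
      then have "Lg r - K * ln (eps n) \<le> (sector_const - K * ln (eps n)) * (sqrt r + 1 / sqrt r)"
        using add_mono[OF Lg_le[OF r], of "- (K * ln (eps n)) * 1" "- (K * ln (eps n)) * (sqrt r + 1 / sqrt r)"]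
        by (simp add: algebra_simps)
      moreover have "norm (f (of_real r * u n)) \<le> Lg r - K * ln (eps n)" unfolding u_def using f_flat[OF r eps, of "- 1" n] by simp
      ultimately have fu: "norm (f (of_real r * u n)) \<le> (sector_const - K * ln (eps n)) * (sqrt r + 1 / sqrt r)" by linarith
      moreover have "norm (exp (of_real s * (of_real r * u n))) = exp (- s * r)" unfolding norm_exp_eq_Re u_def by simp
      ultimately show ?thesis unfolding norm_mult mult.assoc[symmetric]
        using order_trans[OF norm_ge_zero fu] by (intro mult_mono) auto
    qed
  qed
  have ImPhi: "Im (Phi (- of_real s)) = (LBINT r:{0<..}. I n r)" for n
  proof -
    have "Phi (- of_real s) = (LBINT r:{0<..}. u n * (f (of_real r * u n) * exp (of_real s * (of_real r * u n))))"
      unfolding P1[of n] by (simp only: set_integral_mult_right)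
    also have "\<dots> = (LBINT r:{0<..}. f (of_real r * u n) * q n r)" unfolding q_def by (simp only: mult.left_commute)
    finally have e: "Phi (- of_real s) = (LBINT r:{0<..}. f (of_real r * u n) * q n r)" .
    have "set_integrable lborel {0<..} (\<lambda>r. u n * (f (of_real r * u n) * exp (of_real s * (of_real r * u n))))"
      by (rule set_integrable_mult_right[OF int])
    then have "set_integrable lborel {0<..} (\<lambda>r. f (of_real r * u n) * q n r)" unfolding q_def by (simp only: mult.left_commute)
    then show ?thesis unfolding e I_def
      using integral_Im[of lborel "\<lambda>r. indicator {0<..} r *\<^sub>R (f (of_real r * u n) * q n r)"]
      unfolding set_integrable_def set_lebesgue_integral_def by simp
  qed
  have "(\<lambda>n. LBINT r:{0<..}. I n r) \<longlonglongrightarrow> (LBINT r:{0::real<..}. (0::real))"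
  proof (rule halfline_dominated_convergence[OF _ bd mint lim])
    show "continuous_on {0<..} (I n)" for n unfolding I_def by (intro continuous_intros fcont)
  qed
  then have "(\<lambda>n. Im (Phi (- of_real s))) \<longlonglongrightarrow> 0" unfolding ImPhi[symmetric] by simp
  then show ?thesis by (simp add: LIMSEQ_const_iff)
qed

lemma robin_hol: "robin holomorphic_on {z. Im z > 0}"
  unfolding robin_def[abs_def] by (intro holomorphic_intros f_hol holomorphic_deriv open_halfspace_Im_gt)

text \<open>Turn the ray towards the positive half-axis, where \<open>Re robin\<close> tends to zero. The factor \<open>z\<close> compensates
  the possible singularity \<open>1 / z\<close> of \<open>robin\<close> at the origin.\<close>

lemma Gamma_integral_real_part:
  assumes s: "s > 0"
  shows "Re (Complex 1 1 * (LBINT r:{0<..}. (of_real r * Complex 1 1) * robin (of_real r * Complex 1 1) * exp (- (of_real s * (of_real r * Complex 1 1))))) = 0"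
proof -
  obtain C where C: "C > 0" "\<And>x y. 0 < y \<Longrightarrow> y \<le> x \<Longrightarrow> x * norm (robin (Complex x y)) \<le> C * (1 + x) ^ 3"
    by (rule robin_bound) blast
  define h where "h z = z * robin z * exp (- (of_real s * z))" for z
  define B where "B = 2 * C * (1 + 6 / s) ^ 3"
  have hh: "h holomorphic_on {z. Im z > 0}" unfolding h_def[abs_def] by (intro holomorphic_intros robin_hol)
  have s2: "s / 2 > 0" using s by simp
  have hb: "norm (h (of_real r * Complex 1 \<tau>)) \<le> B * ((sqrt r + 1 / sqrt r) * exp (- (s / 2) * r))" if r: "r > 0" and \<tau>: "0 < \<tau>" "\<tau> \<le> 1" for r \<tau>
  proof -
    define P E where "P = sqrt r + 1 / sqrt r" and "E = exp (- (s / 2) * r)"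
    have P: "P \<ge> 1" and E: "E > 0" using one_le_log_weight[OF r] by (auto simp: P_def E_def)
    have z: "of_real r * Complex 1 \<tau> = Complex r (r * \<tau>)" by (simp add: complex_eq_iff)
    have "norm (Complex 1 \<tau>) \<le> 2" using cmod_le[of "Complex 1 \<tau>"] \<tau> by simp
    then have n: "norm (of_real r * Complex 1 \<tau>) \<le> 2 * r" using r by (simp add: norm_mult)
    have "norm (h (of_real r * Complex 1 \<tau>)) = norm (of_real r * Complex 1 \<tau>) * norm (robin (Complex r (r * \<tau>))) * exp (- s * r)"
      unfolding h_def norm_mult z norm_exp_eq_Re by simp
    also have "\<dots> \<le> (2 * r) * norm (robin (Complex r (r * \<tau>))) * exp (- s * r)" using n by (intro mult_right_mono) auto
    also have "\<dots> = 2 * (r * norm (robin (Complex r (r * \<tau>)))) * exp (- s * r)" by simp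
    also have "\<dots> \<le> 2 * (C * (1 + r) ^ 3) * exp (- s * r)"
      using C(2)[of "r * \<tau>" r] r \<tau> by (intro mult_right_mono mult_left_mono) auto
    also have "\<dots> = 2 * C * ((1 + r) ^ 3 * exp (- s * r))" by simp
    also have "\<dots> \<le> 2 * C * ((1 + 6 / s) ^ 3 * E)" unfolding E_def using cubic_exp_bound[of r s] r s C(1) by (intro mult_left_mono) auto
    also have "\<dots> = B * (1 * E)" by (simp add: B_def)
    also have "\<dots> \<le> B * (P * E)" using P E C(1) s by (intro mult_left_mono mult_right_mono) (auto simp: B_def)
    finally show ?thesis by (simp add: P_def E_def)
  qed
  have Bp: "B > 0" using C(1) s by (simp add: B_def add_pos_pos)
  define u where "u n = Complex 1 (eps n)" for n
  have shift: "Complex 1 1 * (LBINT r:{0<..}. h (of_real r * Complex 1 1)) = u n * (LBINT r:{0<..}. h (of_real r * u n))" for n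
  proof (rule ray_integral_shift)
    show "open {z. Im z > 0}" "convex {z. Im z > 0}" by (auto simp: open_halfspace_Im_gt convex_halfspace_Im_gt)
    show "h holomorphic_on {z. Im z > 0}" by (rule hh)
    fix r :: real and v assume r: "r > 0" and v: "v \<in> closed_segment (Complex 1 1) (u n)"
    then obtain t where t: "0 \<le> t" "t \<le> 1" "v = (1 - t) *\<^sub>R Complex 1 1 + t *\<^sub>R u n" by (auto simp: in_segment)
    define \<tau> where "\<tau> = (1 - t) + t * eps n"
    have vt: "v = Complex 1 \<tau>" using t by (simp add: \<tau>_def u_def complex_eq_iff)
    have "eps n * 1 \<le> (1 - t) * (1 - eps n) + eps n" using t eps[of n] by simp
    then have "eps n \<le> \<tau>" by (simp add: \<tau>_def algebra_simps)
    moreover have "t * eps n \<le> t * 1" using t eps[of n] by (intro mult_left_mono) auto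
    ultimately have \<tau>: "0 < \<tau>" "\<tau> \<le> 1" using eps[of n] by (auto simp: \<tau>_def)
    show "of_real r * v \<in> {z. Im z > 0}" using r \<tau> by (simp add: vt)
    have "norm (h (of_real r * v)) \<le> B * ((sqrt r + 1 / sqrt r) * exp (- (s / 2) * r))" unfolding vt by (rule hb[OF r \<tau>])
    also have "\<dots> \<le> B * ((1 + 2/(s/2) + 2/(s/2)^2) * (1 / (sqrt r * (1 + r))))"
      using exp_decay_weight[OF r s2] Bp by (intro mult_left_mono) auto
    finally show "norm (h (of_real r * v)) \<le> (B * (1 + 2/(s/2) + 2/(s/2)^2)) / (sqrt r * (1 + r))" by simp
  qed
  have uIm: "Im (u n) > 0" for n using eps by (simp add: u_def)
  have hc: "continuous_on {0<..} (\<lambda>r. h (of_real r * u n))" for n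
    by (rule continuous_on_compose2[OF holomorphic_on_imp_continuous_on[OF hh]]) (use uIm in \<open>auto intro!: continuous_intros\<close>)
  define I where "I n r = Re (u n * h (of_real r * u n))" for n r
  have mint: "set_integrable lborel {0<..} (\<lambda>r. 2 * (B * ((sqrt r + 1 / sqrt r) * exp (- (s / 2) * r))))"
    by (intro set_integrable_mult_right exp_decay_weight_integrable s2)
  have nu: "norm (u n) \<le> 2" for n using cmod_le[of "u n"] eps[of n] by (simp add: u_def)
  have ub: "norm (u n * h (of_real r * u n)) \<le> 2 * (B * ((sqrt r + 1 / sqrt r) * exp (- (s / 2) * r)))" if "r > 0" for n r
    unfolding norm_mult using nu hb[OF that eps] by (intro mult_mono) (auto simp: u_def)
  have lim: "(\<lambda>n. I n r) \<longlonglongrightarrow> 0" if r: "r > 0" for r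
  proof -
    define q where "q n = u n * (of_real r * u n) * exp (- (of_real s * (of_real r * u n)))" for n
    have ul: "u \<longlonglongrightarrow> Complex 1 0" unfolding u_def by (intro tendsto_intros eps_tendsto)
    have one: "Complex 1 0 = 1" by (simp add: complex_eq_iff)
    have "q \<longlonglongrightarrow> 1 * (of_real r * 1) * exp (- (of_real s * (of_real r * 1)))"
      unfolding q_def[abs_def] using ul[unfolded one] by (intro tendsto_intros)
    also have "1 * (of_real r * 1) * exp (- (of_real s * (of_real r * 1))) = complex_of_real (r * exp (- (s * r)))"
      by (simp add: exp_of_real[symmetric])
    finally have ql: "q \<longlonglongrightarrow> complex_of_real (r * exp (- (s * r)))" .
    have Imq: "(\<lambda>n. Im (q n)) \<longlonglongrightarrow> 0" using tendsto_Im[OF ql] by simp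
    have Req: "(\<lambda>n. Re (q n)) \<longlonglongrightarrow> r * exp (- (s * r))" using tendsto_Re[OF ql] by simp
    have z: "of_real r * u n = Complex r (r * eps n)" for n by (simp add: u_def complex_eq_iff)
    have Reg: "(\<lambda>n. Re (robin (of_real r * u n))) \<longlonglongrightarrow> 0" unfolding z
      by (rule filterlim_compose[OF Re_robin_tendsto[OF r] eps_filterlim[OF r]])
    have Img: "\<bar>Im (robin (of_real r * u n))\<bar> \<le> C * (1 + r) ^ 3 / r" for n
    proof -
      have "r * norm (robin (Complex r (r * eps n))) \<le> C * (1 + r) ^ 3" using eps[of n] r by (intro C(2)) auto
      then have "norm (robin (of_real r * u n)) \<le> C * (1 + r) ^ 3 / r" unfolding z using r by (simp add: field_simps)
      then show ?thesis using abs_Im_le_cmod order_trans by blast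
    qed
    have 1: "(\<lambda>n. Re (q n) * Re (robin (of_real r * u n))) \<longlonglongrightarrow> r * exp (- (s * r)) * 0" by (intro tendsto_intros Req Reg)
    have 2: "(\<lambda>n. Im (q n) * Im (robin (of_real r * u n))) \<longlonglongrightarrow> 0"
    proof (rule Lim_null_comparison)
      show "(\<lambda>n. \<bar>Im (q n)\<bar> * (C * (1 + r) ^ 3 / r)) \<longlonglongrightarrow> 0" using tendsto_mult_left_zero[OF tendsto_rabs_zero[OF Imq]] .
      have "norm (Im (q n) * Im (robin (of_real r * u n))) \<le> \<bar>Im (q n)\<bar> * (C * (1 + r) ^ 3 / r)" for n
        unfolding real_norm_def abs_mult by (rule mult_left_mono[OF Img abs_ge_zero])
      then show "\<forall>\<^sub>F n in sequentially. norm (Im (q n) * Im (robin (of_real r * u n))) \<le> \<bar>Im (q n)\<bar> * (C * (1 + r) ^ 3 / r)"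
        by (intro always_eventually allI)
    qed
    have "I n r = Re (q n) * Re (robin (of_real r * u n)) - Im (q n) * Im (robin (of_real r * u n))" for n
    proof -
      have "u n * h (of_real r * u n) = q n * robin (of_real r * u n)" by (simp add: h_def q_def mult_ac)
      then show ?thesis unfolding I_def by simp
    qed
    then show ?thesis using tendsto_diff[OF 1 2] by simp
  qed
  have J: "Re (Complex 1 1 * (LBINT r:{0<..}. h (of_real r * Complex 1 1))) = (LBINT r:{0<..}. I n r)" for n
  proof -
    have "set_integrable lborel {0<..} (\<lambda>r. u n * h (of_real r * u n))"
      by (rule set_integrable_halfline_bound[OF _ ub mint]) (intro continuous_intros hc)
    from Re_set_integral[OF this] show ?thesis unfolding shift[of n] I_def by (simp only: set_integral_mult_right)
  qed
  have "(\<lambda>n. LBINT r:{0<..}. I n r) \<longlonglongrightarrow> (LBINT r:{0::real<..}. (0::real))"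
  proof (rule halfline_dominated_convergence[OF _ _ mint lim])
    show "continuous_on {0<..} (I n)" for n unfolding I_def by (intro continuous_intros hc)
    show "norm (I n r) \<le> 2 * (B * ((sqrt r + 1 / sqrt r) * exp (- (s / 2) * r)))" if "r > 0" for n r
      unfolding I_def using ub[OF that, of n] abs_Re_le_cmod[of "u n * h (of_real r * u n)"] by simp
  qed
  then have "(\<lambda>n. Re (Complex 1 1 * (LBINT r:{0<..}. h (of_real r * Complex 1 1)))) \<longlonglongrightarrow> 0" unfolding J[symmetric] by simp
  then show ?thesis by (simp add: LIMSEQ_const_iff h_def)
qed
end

context dock_solution begin

text \<open>Integration by parts identifies the integral of the preceding lemma with minus the derivative of
  \<open>(s - \<i>) \<Phi> s\<close>, whose real part is therefore constant. The constant is due to the freedom of adding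
  a real number to \<open>f\<close>.\<close>

lemma Gamma_constant: "\<exists>\<kappa>. \<forall>s>0. Re ((of_real s - \<i>) * Phi (of_real s)) = \<kappa>"
proof -
  define u where "u = Complex 1 1"
  have uIm: "Im u > 0" by (simp add: u_def)
  have nu: "norm u \<le> 2" using cmod_le[of u] by (simp add: u_def)
  define G where "G s = Re ((of_real s - \<i>) * ray_Laplace u (of_real s))" for s
  have "(G has_real_derivative 0) (at s)" if s: "s > 0" for s
  proof -
    define E where "E r = exp (- (of_real s * (of_real r * u)))" for r
    define F where "F r = f (of_real r * u)" for r
    define D where "D r = deriv f (of_real r * u)" for r
    have ReE: "Re (of_real s * u) = s" by (simp add: u_def)
    have nE: "norm (E r) = exp (- s * r)" for r unfolding E_def norm_exp_ray ReE ..
    have Fc: "continuous_on {0<..} F" unfolding F_def by (rule f_ray_continuous[OF uIm])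
    have Ec: "continuous_on {0<..} E" unfolding E_def by (intro continuous_intros)
    have Dc: "continuous_on {0<..} D" unfolding D_def
      by (rule continuous_on_compose2[OF holomorphic_on_imp_continuous_on[OF holomorphic_deriv[OF f_hol open_halfspace_Im_gt]]])
         (use uIm in \<open>auto intro!: continuous_intros\<close>)
    have nF: "norm (F r) \<le> Lg r" if "r > 0" for r unfolding F_def u_def by (rule f_sector[OF that]) simp
    have nD: "norm (D r) \<le> K / r" if "r > 0" for r
      using deriv_bound[of "of_real r * u"] that by (simp add: D_def u_def)
    have nru: "norm (of_real r * u) \<le> 2 * r" if "r > 0" for r using nu that by (simp add: norm_mult)
    define L0 where "L0 = (LBINT r:{0<..}. F r * E r)"
    define L1 where "L1 = (LBINT r:{0<..}. - (of_real r * u) * (F r * E r))"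
    define X where "X = (LBINT r:{0<..}. (of_real r * u) * D r * E r)"
    have w: "Re (of_real s * Complex 1 1) > 0" using s by simp
    have i0: "set_integrable lborel {0<..} (\<lambda>r. F r * E r)"
      using ray_Laplace_integrable[OF _ w] unfolding F_def E_def u_def by simp
    have i1: "set_integrable lborel {0<..} (\<lambda>r. - (of_real r * u) * (F r * E r))"
    proof (rule set_integrable_halfline_bound[OF _ _ set_integrable_mult_right[OF Lg_exp_integrable[of "s/2"], of "4 / s"]])
      show "continuous_on {0<..} (\<lambda>r. - (of_real r * u) * (F r * E r))" by (intro continuous_intros Fc Ec)
      show "norm (- (of_real r * u) * (F r * E r)) \<le> 4 / s * (Lg r * exp (- (s / 2) * r))" if r: "r > 0" for r
      proof -
        have "s / 2 * r \<le> exp (s / 2 * r)" using exp_ge_add_one_self[of "s / 2 * r"] by linarith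
        then have "s / 2 * r * exp (- s * r) \<le> exp (s / 2 * r) * exp (- s * r)" by (intro mult_right_mono) auto
        also have "\<dots> = exp (- (s / 2) * r)" by (simp add: mult_exp_exp)
        finally have e: "2 * r * exp (- s * r) \<le> 4 / s * exp (- (s / 2) * r)" using s by (simp add: field_simps)
        have "norm (- (of_real r * u) * (F r * E r)) \<le> (2 * r) * (Lg r * exp (- s * r))"
          unfolding norm_mult[of "- (of_real r * u)"] norm_minus_cancel norm_mult[of "F r"] nE
          using nru[OF r] nF[OF r] r by (intro mult_mono mult_right_mono) auto
        also have "\<dots> = Lg r * (2 * r * exp (- s * r))" by simp
        also have "\<dots> \<le> Lg r * (4 / s * exp (- (s / 2) * r))" using e Lg_nonneg by (intro mult_left_mono) auto
        finally show ?thesis by (simp add: mult_ac)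
      qed
    qed (use s in simp)
    have iX: "set_integrable lborel {0<..} (\<lambda>r. (of_real r * u) * D r * E r)"
    proof (rule set_integrable_halfline_bound[OF _ _ set_integrable_mult_right[OF exp_decay_integral(1)[OF s], of "2 * K"]])
      show "continuous_on {0<..} (\<lambda>r. (of_real r * u) * D r * E r)" by (intro continuous_intros Dc Ec)
      show "norm ((of_real r * u) * D r * E r) \<le> 2 * K * exp (- s * r)" if r: "r > 0" for r
      proof -
        have "norm (of_real r * u) * norm (D r) \<le> (2 * r) * (K / r)"
          using nru[OF r] nD[OF r] r by (intro mult_mono) auto
        then have "norm (of_real r * u) * norm (D r) \<le> 2 * K" using r by simp
        then show ?thesis unfolding norm_mult[of _ "E r"] norm_mult[of "of_real r * u"] nE by (intro mult_right_mono) auto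
      qed
    qed
    define T where "T r = (of_real r * u) * (F r * E r)" for r
    define t where "t r = u * (F r * E r) + (u * ((of_real r * u) * D r * E r) + (of_real s * u) * (- (of_real r * u) * (F r * E r)))" for r
    have Lzero: "(LBINT r:{0<..}. t r) = 0 - 0"
    proof (rule halfline_FTC)
      show "(T has_vector_derivative t r) (at r)" if r: "0 < r" for r
      proof -
        have c: "((\<lambda>r. of_real r * u) has_vector_derivative u) (at r)" by (auto intro!: derivative_eq_intros)
        have "((\<lambda>z. z * (f z * exp (- (of_real s * z)))) has_field_derivative
            1 * (f (of_real r * u) * exp (- (of_real s * (of_real r * u)))) + (deriv f (of_real r * u) * exp (- (of_real s * (of_real r * u)))
              + (exp (- (of_real s * (of_real r * u))) * - (of_real s)) * f (of_real r * u)) * (of_real r * u)) (at (of_real r * u))"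
          by (intro DERIV_mult DERIV_ident f_DERIV) (use r uIm in \<open>auto intro!: derivative_eq_intros\<close>)
        from field_vector_diff_chain_at[OF c this]
        show ?thesis unfolding T_def[abs_def] F_def E_def D_def t_def o_def by (simp add: algebra_simps)
      qed
      show "continuous_on {0<..} t" unfolding t_def by (intro continuous_intros Fc Ec Dc)
      show "set_integrable lborel {0<..} t" unfolding t_def
        by (intro set_integral_add(1) set_integrable_mult_right i0 i1 iX)
      have Tb: "norm (T r) \<le> 2 * sector_const * (r * (sqrt r + 1 / sqrt r) * exp (- s * r))" if r: "r > 0" for r
      proof -
        have "norm (T r) \<le> (2 * r) * ((sector_const * (sqrt r + 1 / sqrt r)) * exp (- s * r))"
          unfolding T_def norm_mult[of "of_real r * u"] norm_mult[of "F r"] nE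
          using nru[OF r] order_trans[OF nF[OF r] Lg_le[OF r]] r sector_const_pos by (intro mult_mono mult_right_mono) auto
        then show ?thesis by (simp only: mult_ac)
      qed
      have l: "((\<lambda>r. r * (sqrt r + 1 / sqrt r) * exp (- s * r)) \<longlongrightarrow> 0) (at_right 0)"
        "((\<lambda>r. r * (sqrt r + 1 / sqrt r) * exp (- s * r)) \<longlongrightarrow> 0) at_top"
        using s by real_asymp+
      show "(T \<longlongrightarrow> 0) (at_right 0)"
        by (rule Lim_null_comparison[OF eventually_mono[OF eventually_at_right_less[of 0] Tb] tendsto_mult_right_zero[OF l(1)]])
      show "(T \<longlongrightarrow> 0) at_top"
        by (rule Lim_null_comparison[OF eventually_mono[OF eventually_gt_at_top[of 0] Tb] tendsto_mult_right_zero[OF l(2)]])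
    qed
    moreover have "(LBINT r:{0<..}. t r) = u * L0 + (u * X + (of_real s * u) * L1)"
    proof -
      have j0: "set_integrable lborel {0<..} (\<lambda>r. u * (F r * E r))" by (rule set_integrable_mult_right[OF i0])
      have jX: "set_integrable lborel {0<..} (\<lambda>r. u * ((of_real r * u) * D r * E r))" by (rule set_integrable_mult_right[OF iX])
      have j1: "set_integrable lborel {0<..} (\<lambda>r. (of_real s * u) * (- (of_real r * u) * (F r * E r)))" by (rule set_integrable_mult_right[OF i1])
      show ?thesis unfolding t_def L0_def L1_def X_def
        by (simp only: set_integral_add(2)[OF j0 set_integral_add(1)[OF jX j1]] set_integral_add(2)[OF jX j1] set_integral_mult_right)
    qed
    ultimately have ftc: "u * L0 + (u * X + (of_real s * u) * L1) = 0" by simp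
    have "(LBINT r:{0<..}. (of_real r * u) * robin (of_real r * u) * E r) = X + \<i> * L1"
    proof -
      have "(of_real r * u) * robin (of_real r * u) * E r = (of_real r * u) * D r * E r + \<i> * (- (of_real r * u) * (F r * E r))" for r
        by (simp add: robin_def D_def F_def algebra_simps)
      then show ?thesis unfolding X_def L1_def
        by (simp only: set_integral_add(2)[OF iX set_integrable_mult_right[OF i1]] set_integral_mult_right)
    qed
    then have J: "Re (u * (X + \<i> * L1)) = 0" using Gamma_integral_real_part[OF s] unfolding u_def[symmetric] E_def by simp
    have LD: "(ray_Laplace u has_field_derivative u * L1) (at (of_real s))"
      using ray_Laplace_DERIV[OF _ w] unfolding u_def L1_def F_def E_def by simp
    have L0: "ray_Laplace u (of_real s) = u * L0" by (simp add: ray_Laplace_def L0_def F_def E_def)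
    have "((\<lambda>w. (w - \<i>) * ray_Laplace u w) has_field_derivative (1 * ray_Laplace u (of_real s) + (u * L1) * (of_real s - \<i>))) (at (of_real s))"
      by (intro DERIV_mult LD) (auto intro!: derivative_eq_intros)
    moreover have "1 * ray_Laplace u (of_real s) + (u * L1) * (of_real s - \<i>) = - (u * (X + \<i> * L1))"
    proof -
      have "1 * (u * L0) + (u * L1) * (of_real s - \<i>) + u * (X + \<i> * L1) = u * L0 + (u * X + (of_real s * u) * L1)"
        by (simp add: algebra_simps)
      then show ?thesis unfolding L0 eq_neg_iff_add_eq_0 using ftc by (simp only:)
    qed
    ultimately have D: "((\<lambda>w. (w - \<i>) * ray_Laplace u w) has_field_derivative (- (u * (X + \<i> * L1)))) (at (of_real s))" by simp
    have "((\<lambda>s. complex_of_real s) has_vector_derivative 1) (at s)" by (auto intro!: derivative_eq_intros)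
    from field_vector_diff_chain_at[OF this D]
    have "((\<lambda>s. (of_real s - \<i>) * ray_Laplace u (of_real s)) has_vector_derivative - (u * (X + \<i> * L1))) (at s)" by (simp add: o_def)
    from bounded_linear.has_vector_derivative[OF bounded_linear_Re this]
    show ?thesis using J unfolding G_def[abs_def] has_real_derivative_iff_has_vector_derivative by simp
  qed
  then have "\<exists>\<kappa>. \<forall>s\<in>{0<..}. G s = \<kappa>"
    by (intro has_field_derivative_zero_constant) (auto intro: has_field_derivative_at_within)
  then obtain \<kappa> where \<kappa>: "\<And>s. s > 0 \<Longrightarrow> G s = \<kappa>" by auto
  show ?thesis
  proof (intro exI allI impI)
    fix s :: real assume "s > 0"
    then show "Re ((of_real s - \<i>) * Phi (of_real s)) = \<kappa>"
      using \<kappa>[of s] Phi_right[of "of_real s"] by (simp add: G_def u_def)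
  qed
qed

text \<open>The product is real on both half-axes: on the positive one because \<open>1 + \<i> s = \<i> (s - \<i>)\<close> and
  \<open>Re ((s - \<i>) (s \<Phi> s - \<kappa>)) = 0\<close>, on the negative one because \<open>1 + \<i> w\<close> cancels the denominator of
  \<open>wh_cont\<close>. Reflection and Liouville's theorem apply to \<open>z\<close> times the reflected function, which has a
  removable singularity at the origin and at most quadratic growth; the quadratic term is then excluded by
  the sharper bound.\<close>

lemma wiener_hopf_constant:
  "\<exists>\<kappa> a :: real. \<forall>w. Im w < 0 \<longrightarrow> (1 + \<i> * w) * wh_cont w * (w * Phi w - of_real \<kappa>) = of_real a"
proof -
  obtain \<kappa> where \<kappa>: "\<And>s. s > 0 \<Longrightarrow> Re ((of_real s - \<i>) * Phi (of_real s)) = \<kappa>" using Gamma_constant by blast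
  define R where "R w = (1 + \<i> * w) * wh_cont w * (w * Phi w - of_real \<kappa>)" for w
  have sub: "phi_region \<subseteq> up_slit" by (auto simp: phi_region_def up_slit_def)
  have Rh: "R holomorphic_on phi_region" unfolding R_def[abs_def]
    by (intro holomorphic_intros Phi_hol holomorphic_on_subset[OF wh_cont_holomorphic sub])
  have lower: "w \<in> phi_region" if "Im w \<le> 0" "w \<noteq> 0" for w
    using that by (auto simp: phi_region_def complex_eq_iff)
  have Rreal: "R (of_real x) \<in> \<real>" if x: "x \<noteq> 0" for x
  proof (cases "x > 0")
    case True
    define b where "b = exp (- (1 / pi) * (LBINT s:{0<..}. ln (x + s) / (1 + s\<^sup>2)))"
    have b: "wh_cont (of_real x) = of_real b" using True by (simp add: wh_cont_of_real wh_factor_of_real b_def)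
    define y where "y = (of_real x - \<i>) * (of_real x * Phi (of_real x) - of_real \<kappa>)"
    have "y = of_real x * ((of_real x - \<i>) * Phi (of_real x)) - of_real \<kappa> * (of_real x - \<i>)" by (simp add: y_def algebra_simps)
    then have "Re y = x * Re ((of_real x - \<i>) * Phi (of_real x)) - \<kappa> * x" by simp
    then have "Re y = 0" unfolding \<kappa>[OF True] by simp
    then have y: "y = \<i> * of_real (Im y)" by (simp add: complex_eq_iff)
    have "R (of_real x) = \<i> * y * of_real b" unfolding R_def b y_def by (simp add: algebra_simps)
    also have "\<dots> = of_real (- Im y * b)" by (subst y) simp
    finally show ?thesis by simp
  next
    case False
    define s where "s = - x"
    have s: "s > 0" "complex_of_real x = - of_real s" using False x by (auto simp: s_def)
    define b where "b = exp (- (1 / pi) * (LBINT r:{0<..}. ln (s + r) / (1 + r\<^sup>2)))"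
    have b: "wh_cont (- of_real s) = 1 / ((1 - \<i> * of_real s) * of_real b)" using s(1) by (simp add: wh_cont_of_real wh_factor_of_real b_def)
    have nz: "1 - \<i> * complex_of_real s \<noteq> 0" by (auto simp: complex_eq_iff)
    have P: "Phi (- of_real s) = of_real (Re (Phi (- of_real s)))" using Phi_real_negative_axis[OF s(1)] by (simp add: complex_eq_iff)
    have "R (of_real x) = 1 / of_real b * (- of_real s * Phi (- of_real s) - of_real \<kappa>)"
      unfolding R_def s(2) b using nz by simp
    also have "\<dots> = of_real (1 / b * (- s * Re (Phi (- of_real s)) - \<kappa>))" by (subst P) simp
    finally show ?thesis by (simp only: Reals_of_real)
  qed
  obtain C1 where C1: "C1 \<ge> 1" "\<And>w. Im w \<le> 0 \<Longrightarrow> w \<noteq> 0 \<Longrightarrow> norm (wh_cont w) \<le> C1 / sqrt (1 + norm w)"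
    by (rule wh_cont_bound) blast
  obtain C2 where C2: "C2 > 0" "\<And>w. Im w \<le> 0 \<Longrightarrow> w \<noteq> 0 \<Longrightarrow> norm (Phi w) \<le> C2 * (1 + \<bar>ln (norm w)\<bar>) / norm w"
    by (rule Phi_bound) blast
  define C where "C = C1 * (C2 + \<bar>\<kappa>\<bar>)"
  have Cp: "C > 0" using C1 C2 by (simp add: C_def add_pos_nonneg)
  have Rb: "norm (R w) \<le> C * sqrt (1 + norm w) * (1 + \<bar>ln (norm w)\<bar>)" if w: "Im w \<le> 0" "w \<noteq> 0" for w
  proof -
    define n l where "n = norm w" and "l = 1 + \<bar>ln (norm w)\<bar>"
    have n: "n > 0" "l \<ge> 1" using w by (auto simp: n_def l_def)
    have 1: "norm (1 + \<i> * w) \<le> 1 + n" using norm_triangle_ineq[of 1 "\<i> * w"] by (simp add: norm_mult n_def)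
    have 2: "norm (wh_cont w) \<le> C1 / sqrt (1 + n)" using C1(2)[OF w] by (simp add: n_def)
    have "norm (w * Phi w - of_real \<kappa>) \<le> norm (w * Phi w) + \<bar>\<kappa>\<bar>" using norm_triangle_ineq4[of "w * Phi w" "of_real \<kappa>"] by simp
    also have "norm (w * Phi w) \<le> n * (C2 * l / n)" unfolding norm_mult n_def l_def by (intro mult_left_mono C2(2)[OF w]) auto
    also have "\<dots> = C2 * l" using n by simp
    also have "\<bar>\<kappa>\<bar> \<le> \<bar>\<kappa>\<bar> * l" using n mult_left_mono[of 1 l "\<bar>\<kappa>\<bar>"] by simp
    finally have 3: "norm (w * Phi w - of_real \<kappa>) \<le> (C2 + \<bar>\<kappa>\<bar>) * l" by (simp add: distrib_right)
    have "norm (R w) \<le> (1 + n) * (C1 / sqrt (1 + n)) * ((C2 + \<bar>\<kappa>\<bar>) * l)"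
      unfolding R_def norm_mult using 1 2 3 n C1(1) by (intro mult_mono) auto
    also have "(1 + n) * (C1 / sqrt (1 + n)) = C1 * ((1 + n) / sqrt (1 + n))" by simp
    also have "(1 + n) / sqrt (1 + n) = sqrt (1 + n)" using n by (intro real_div_sqrt) simp
    finally show ?thesis by (simp add: C_def n_def l_def mult_ac)
  qed
  \<comment> \<open>The reflection principle is applied in the upper half-plane, that is, in the variable \<open>- w\<close>.\<close>
  define R2 where "R2 z = (if 0 \<le> Im z then R (- z) else cnj (R (- cnj z)))" for z
  have R2h: "R2 holomorphic_on - {0}"
  proof -
    have R2eq: "R2 = (\<lambda>z. if 0 \<le> Im z then (\<lambda>z. R (- z)) z else cnj ((\<lambda>z. R (- z)) (cnj z)))" by (simp add: R2_def fun_eq_iff)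
    show ?thesis unfolding R2eq
    proof (rule Schwarz_reflection)
      show "cnj ` (- {0}) \<subseteq> - {0}" by auto
      have "(R \<circ> uminus) holomorphic_on (- {0} \<inter> {z. 0 < Im z})"
        by (rule holomorphic_on_compose_gen[OF _ Rh]) (auto intro!: holomorphic_intros lower)
      then show "(\<lambda>z. R (- z)) holomorphic_on (- {0} \<inter> {z. 0 < Im z})" by (simp add: o_def)
      show "continuous_on (- {0} \<inter> {z. 0 \<le> Im z}) (\<lambda>z. R (- z))"
        by (rule continuous_on_compose2[OF holomorphic_on_imp_continuous_on[OF Rh]]) (auto intro!: continuous_intros lower)
      show "R (- z) \<in> \<real>" if z: "z \<in> - {0}" "z \<in> \<real>" for z
      proof -
        obtain x where "z = of_real x" using z(2) by (rule Reals_cases)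
        then show ?thesis using Rreal[of "- x"] z(1) by simp
      qed
    qed auto
  qed
  have R2b: "norm (R2 z) \<le> C * sqrt (1 + norm z) * (1 + \<bar>ln (norm z)\<bar>)" if "z \<noteq> 0" for z
    using Rb[of "- z"] Rb[of "- cnj z"] that unfolding R2_def by auto
  \<comment> \<open>The factor \<open>z\<close> outweighs the logarithm at the origin.\<close>
  define N where "N z = (if z = 0 then 0 else z * R2 z)" for z
  have Nh: "N holomorphic_on UNIV" unfolding N_def[abs_def]
  proof (rule removable_singularity)
    show "(\<lambda>z. z * R2 z) holomorphic_on UNIV - {0}"
      using R2h by (intro holomorphic_intros) (simp add: Compl_eq_Diff_UNIV)
    have "((\<lambda>n::real. n * sqrt (1 + n) * (1 + \<bar>ln n\<bar>)) \<longlongrightarrow> 0) (at_right 0)" by real_asymp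
    then have l: "((\<lambda>n::real. C * (n * sqrt (1 + n) * (1 + \<bar>ln n\<bar>))) \<longlongrightarrow> 0) (at_right 0)"
      by (rule tendsto_mult_right_zero)
    have "filterlim norm (at_right 0) (at (0::complex))" unfolding filterlim_at
      by (auto intro!: tendsto_eq_intros simp: eventually_at_filter)
    from filterlim_compose[OF l this]
    have l2: "((\<lambda>z::complex. C * (norm z * sqrt (1 + norm z) * (1 + \<bar>ln (norm z)\<bar>))) \<longlongrightarrow> 0) (at 0)" .
    show "(\<lambda>z. z * R2 z) \<midarrow>0\<rightarrow> 0"
    proof (rule Lim_null_comparison[OF _ l2])
      show "\<forall>\<^sub>F z in at 0. norm (z * R2 z) \<le> C * (norm z * sqrt (1 + norm z) * (1 + \<bar>ln (norm z)\<bar>))"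
        unfolding eventually_at_filter
      proof (intro always_eventually allI impI)
        fix z :: complex assume "z \<noteq> 0"
        then have "norm z * norm (R2 z) \<le> norm z * (C * sqrt (1 + norm z) * (1 + \<bar>ln (norm z)\<bar>))"
          using R2b by (intro mult_left_mono) auto
        then show "norm (z * R2 z) \<le> C * (norm z * sqrt (1 + norm z) * (1 + \<bar>ln (norm z)\<bar>))"
          by (simp add: norm_mult mult_ac)
      qed
    qed
  qed auto
  have grow: "sqrt (1 + n) * (1 + \<bar>ln n\<bar>) \<le> 6 * n" if n: "n \<ge> 1" for n :: real
  proof -
    have "sqrt (1 + n) \<le> sqrt (4 * n)" using n by (intro real_sqrt_le_mono) simp
    then have a: "sqrt (1 + n) \<le> 2 * sqrt n" by (simp add: real_sqrt_mult)
    have "ln n = 2 * ln (sqrt n)" using n by (simp add: ln_sqrt)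
    also have "\<dots> \<le> 2 * (sqrt n - 1)" using ln_le_minus_one[of "sqrt n"] n by simp
    finally have "ln n \<le> 2 * sqrt n - 2" by simp
    moreover have "1 \<le> sqrt n" "0 \<le> ln n" using n by auto
    ultimately have "1 + \<bar>ln n\<bar> \<le> 3 * sqrt n" by linarith
    then have "sqrt (1 + n) * (1 + \<bar>ln n\<bar>) \<le> (2 * sqrt n) * (3 * sqrt n)" using a n by (intro mult_mono) auto
    then show ?thesis using n by simp
  qed
  define c where "c k = (deriv ^^ k) N 0 / fact k" for k
  have Npoly: "N \<xi> = (\<Sum>k\<le>2. c k * \<xi> ^ k)" for \<xi> unfolding c_def
  proof (rule Liouville_polynomial[OF Nh, of 1 "6 * C"])
    fix z :: complex assume z: "1 \<le> norm z"
    then have z0: "z \<noteq> 0" by auto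
    have "norm (N z) \<le> norm z * (C * (sqrt (1 + norm z) * (1 + \<bar>ln (norm z)\<bar>)))"
      using R2b[OF z0] z0 by (simp add: N_def norm_mult mult_left_mono mult.assoc)
    also have "\<dots> \<le> norm z * (C * (6 * norm z))" using grow[OF z] Cp by (intro mult_left_mono) auto
    finally show "norm (N z) \<le> 6 * C * norm z ^ 2" by (simp add: power2_eq_square mult_ac)
  qed
  have c0: "c 0 = 0" using Npoly[of 0] by (simp add: N_def numeral_2_eq_2)
  have R2lin: "R2 z = c 1 + c 2 * z" if "z \<noteq> 0" for z
  proof -
    have "z * R2 z = z * (c 1 + c 2 * z)" using Npoly[of z] that c0 by (simp add: N_def numeral_2_eq_2 algebra_simps)
    then show ?thesis using that by simp
  qed
  have c2: "c 2 = 0"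
  proof -
    have b: "norm (c 2) \<le> C * (sqrt (1 + n) * (1 + \<bar>ln n\<bar>)) / n + norm (c 1) / n" if n: "n > 0" for n :: real
    proof -
      have "norm (c 2 * of_real n) \<le> norm (R2 (of_real n)) + norm (c 1)"
        using R2lin[of "of_real n"] n norm_triangle_ineq4[of "R2 (of_real n)" "c 1"] by simp
      also have "\<dots> \<le> C * (sqrt (1 + n) * (1 + \<bar>ln n\<bar>)) + norm (c 1)" using R2b[of "of_real n"] n by (simp add: mult.assoc)
      finally have "norm (c 2) * n \<le> C * (sqrt (1 + n) * (1 + \<bar>ln n\<bar>)) + norm (c 1)" using n by (simp add: norm_mult)
      then have "norm (c 2) \<le> (C * (sqrt (1 + n) * (1 + \<bar>ln n\<bar>)) + norm (c 1)) / n" using n by (simp add: pos_le_divide_eq)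
      then show ?thesis by (simp only: add_divide_distrib)
    qed
    have "((\<lambda>n::real. sqrt (1 + n) * (1 + \<bar>ln n\<bar>) / n) \<longlongrightarrow> 0) at_top" by real_asymp
    moreover have "((\<lambda>n::real. norm (c 1) / n) \<longlongrightarrow> 0) at_top" by real_asymp
    ultimately have "((\<lambda>n::real. C * (sqrt (1 + n) * (1 + \<bar>ln n\<bar>) / n) + norm (c 1) / n) \<longlongrightarrow> C * 0 + 0) at_top" by (intro tendsto_intros)
    then have l: "((\<lambda>n::real. C * (sqrt (1 + n) * (1 + \<bar>ln n\<bar>)) / n + norm (c 1) / n) \<longlongrightarrow> 0) at_top" by simp
    have "norm (c 2) \<le> 0"
      by (rule tendsto_lowerbound[OF l eventually_mono[OF eventually_gt_at_top[of 0] b]]) auto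
    then show ?thesis by simp
  qed
  have "c 1 = R (of_real (- 1))" using R2lin[of 1] c2 by (simp add: R2_def)
  then have "c 1 \<in> \<real>" using Rreal[of "- 1"] by simp
  then obtain a where a: "c 1 = of_real a" by (auto elim: Reals_cases)
  have "R w = of_real a" if "Im w < 0" for w
  proof -
    have "w \<noteq> 0" using that by auto
    then show ?thesis using R2lin[of "- w"] that c2 a by (auto simp: R2_def)
  qed
  then show ?thesis unfolding R_def by blast
qed

text \<open>Up to the real numbers \<open>\<kappa>\<close> and \<open>a\<close> this is the same for all bounded solutions. The imaginary axis suffices,
  since a holomorphic function is determined by its values there.\<close>

lemma Laplace_transform_on_imaginary_axis:
  "\<exists>\<kappa> a :: real. \<forall>s>0. (LBINT r:{0<..}. (f (\<i> * of_real r) - of_real \<kappa>) * of_real (exp (- s * r)))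
      = of_real a / (of_real (s * (1 + s)) * wh_factor (- \<i> * of_real s))"
proof -
  obtain \<kappa> a where a: "\<And>w. Im w < 0 \<Longrightarrow> (1 + \<i> * w) * wh_cont w * (w * Phi w - of_real \<kappa>) = of_real a"
    using wiener_hopf_constant by blast
  show ?thesis
  proof (rule exI[of _ \<kappa>], rule exI[of _ a], intro allI impI)
    fix s :: real assume s: "s > 0"
    define w where "w = - \<i> * complex_of_real s"
    define I where "I = (LBINT r:{0<..}. f (\<i> * of_real r) * of_real (exp (- s * r)))"
    have w: "Im w < 0" using s by (simp add: w_def)
    have b: "wh_cont w = wh_factor w" "wh_factor w \<noteq> 0" using wh_cont_lower[OF w] by auto
    have "w * Phi w = (- \<i> * of_real s) * (\<i> * I)" using Phi_imaginary_axis[OF s] by (simp only: w_def I_def)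
    also have "\<dots> = of_real s * I" by (simp add: algebra_simps)
    finally have "w * Phi w = of_real s * I" .
    moreover have "1 + \<i> * w = of_real (1 + s)" by (simp add: w_def)
    ultimately have "of_real (1 + s) * wh_factor w * (of_real s * I - of_real \<kappa>) = of_real a" using a[OF w] b(1) by simp
    then have "of_real s * I - of_real \<kappa> = of_real a / (of_real (1 + s) * wh_factor w)"
      using b(2) s by (simp add: eq_divide_eq mult_ac del: of_real_add)
    then have "(of_real s * I - of_real \<kappa>) / of_real s = of_real a / (of_real (1 + s) * wh_factor w) / of_real s" by simp
    then have I1: "I - of_real (\<kappa> * (1 / s)) = of_real a / (of_real (s * (1 + s)) * wh_factor w)"
      using s by (simp add: diff_divide_distrib mult_ac)
    have i: "set_integrable lborel {0<..} (\<lambda>r. complex_of_real \<kappa> * of_real (exp (- s * r)))"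
      using exp_decay_integral(1)[OF s] unfolding set_integrable_def
      by (intro set_integrable_mult_right[unfolded set_integrable_def])
         (simp add: scaleR_conv_of_real complex_of_real_integrable_eq flip: of_real_mult del: of_real_exp)
    have "(LBINT r:{0<..}. (f (\<i> * of_real r) - of_real \<kappa>) * of_real (exp (- s * r)))
       = (LBINT r:{0<..}. f (\<i> * of_real r) * of_real (exp (- s * r)) - complex_of_real \<kappa> * of_real (exp (- s * r)))"
      by (simp only: left_diff_distrib)
    also have "\<dots> = I - (LBINT r:{0<..}. complex_of_real \<kappa> * of_real (exp (- s * r)))"
      unfolding I_def by (rule set_integral_diff(2)[OF f_imaginary_integrable[OF s] i])
    also have "(LBINT r:{0<..}. complex_of_real \<kappa> * of_real (exp (- s * r))) = of_real (\<kappa> * (1 / s))"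
      by (simp only: set_integral_mult_right set_integral_complex_of_real exp_decay_integral(2)[OF s] of_real_mult)
    finally show "(LBINT r:{0<..}. (f (\<i> * of_real r) - of_real \<kappa>) * of_real (exp (- s * r)))
      = of_real a / (of_real (s * (1 + s)) * wh_factor (- \<i> * of_real s))" unfolding I1 w_def .
  qed
qed
end

section \<open>Uniqueness\<close>

text \<open>A real combination of the two solutions in which the constants \<open>a1\<close> and \<open>a2\<close> cancel has vanishing
  Laplace transform on the imaginary axis, and so is zero.\<close>

lemma dock_solutions_proportional:
  assumes "dock_solution f1 V1 M1" "dock_solution f2 V2 M2"
  shows "\<exists>a1 a2 :: real. (\<forall>z. Im z \<ge> 0 \<longrightarrow> a2 * V1 z = a1 * V2 z) \<and>
     (a1 = 0 \<longrightarrow> (\<forall>z. Im z \<ge> 0 \<longrightarrow> V1 z = 0))"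
proof -
  interpret A: dock_solution f1 V1 M1 by fact
  interpret B: dock_solution f2 V2 M2 by fact
  let ?q = "\<lambda>s. complex_of_real (s * (1 + s)) * wh_factor (- \<i> * of_real s)"
  obtain \<kappa>1 a1 where a1: "\<And>s. s > 0 \<Longrightarrow> (LBINT r:{0<..}. (f1 (\<i> * of_real r) - of_real \<kappa>1) * of_real (exp (- s * r))) = of_real a1 / ?q s"
    using A.Laplace_transform_on_imaginary_axis by blast
  obtain \<kappa>2 a2 where a2: "\<And>s. s > 0 \<Longrightarrow> (LBINT r:{0<..}. (f2 (\<i> * of_real r) - of_real \<kappa>2) * of_real (exp (- s * r))) = of_real a2 / ?q s"
    using B.Laplace_transform_on_imaginary_axis by blast
  have key: "\<alpha> * V1 z + \<beta> * V2 z = 0" if ab: "\<alpha> * a1 + \<beta> * a2 = 0" and z: "Im z \<ge> 0" for \<alpha> \<beta> :: real and z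
  proof -
    define F where "F z = of_real \<alpha> * (f1 z - of_real \<kappa>1) + of_real \<beta> * (f2 z - of_real \<kappa>2)" for z
    have Fh: "F holomorphic_on {z. Im z > 0}" unfolding F_def[abs_def]
      by (intro holomorphic_intros A.f_hol B.f_hol)
    have sect: "norm (f1 (\<i> * of_real r)) \<le> A.sector_const * (sqrt r + 1 / sqrt r)" "norm (f2 (\<i> * of_real r)) \<le> B.sector_const * (sqrt r + 1 / sqrt r)" if "r > 0" for r
    proof -
      have c: "of_real r * Complex 0 1 = \<i> * complex_of_real r" by (simp add: complex_eq_iff)
      show "norm (f1 (\<i> * of_real r)) \<le> A.sector_const * (sqrt r + 1 / sqrt r)"
        using A.f_sector[OF that, of 0] A.Lg_le[OF that] unfolding c by simp
      show "norm (f2 (\<i> * of_real r)) \<le> B.sector_const * (sqrt r + 1 / sqrt r)"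
        using B.f_sector[OF that, of 0] B.Lg_le[OF that] unfolding c by simp
    qed
    have int_const: "set_integrable lborel {0<..} (\<lambda>r. complex_of_real \<kappa> * of_real (exp (- s * r)))" if "s > 0" for s \<kappa>
    proof (rule set_integrable_halfline_bound[OF _ _ set_integrable_mult_right[OF exp_decay_integral(1)[OF that], of "\<bar>\<kappa>\<bar>"]])
      show "norm (complex_of_real \<kappa> * of_real (exp (- s * r))) \<le> \<bar>\<kappa>\<bar> * exp (- s * r)" for r
        by (simp add: norm_mult del: of_real_exp)
    qed (intro continuous_intros)
    have F0: "F (\<i> * of_real r) = 0" if "r > 0" for r
    proof (rule Laplace_transform_injective[OF _ _ _ _ that])
      have "continuous_on {0<..} (\<lambda>r. f1 (\<i> * of_real r))" "continuous_on {0<..} (\<lambda>r. f2 (\<i> * of_real r))"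
        using A.f_ray_continuous[of \<i>] B.f_ray_continuous[of \<i>] by (simp_all add: mult.commute)
      then show "continuous_on {0<..} (\<lambda>r. F (\<i> * of_real r))" unfolding F_def by (intro continuous_intros)
      define C where "C = \<bar>\<alpha>\<bar> * (A.sector_const + \<bar>\<kappa>1\<bar>) + \<bar>\<beta>\<bar> * (B.sector_const + \<bar>\<kappa>2\<bar>)"
      show "norm (F (\<i> * of_real r)) \<le> C * (sqrt r + 1 / sqrt r)" if r: "r > 0" for r
      proof -
        define P where "P = sqrt r + 1 / sqrt r"
        have P: "P \<ge> 1" using one_le_log_weight[OF r] by (simp add: P_def)
        have 1: "norm (f1 (\<i> * of_real r) - of_real \<kappa>1) \<le> (A.sector_const + \<bar>\<kappa>1\<bar>) * P"
          using norm_triangle_ineq4[of "f1 (\<i> * of_real r)" "of_real \<kappa>1"] sect(1)[OF r] mult_left_mono[OF P, of "\<bar>\<kappa>1\<bar>"]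
          unfolding P_def[symmetric] by (simp add: distrib_right)
        have 2: "norm (f2 (\<i> * of_real r) - of_real \<kappa>2) \<le> (B.sector_const + \<bar>\<kappa>2\<bar>) * P"
          using norm_triangle_ineq4[of "f2 (\<i> * of_real r)" "of_real \<kappa>2"] sect(2)[OF r] mult_left_mono[OF P, of "\<bar>\<kappa>2\<bar>"]
          unfolding P_def[symmetric] by (simp add: distrib_right)
        have "norm (F (\<i> * of_real r)) \<le> \<bar>\<alpha>\<bar> * norm (f1 (\<i> * of_real r) - of_real \<kappa>1) + \<bar>\<beta>\<bar> * norm (f2 (\<i> * of_real r) - of_real \<kappa>2)"
          unfolding F_def by (rule order_trans[OF norm_triangle_ineq]) (simp add: norm_mult)
        also have "\<dots> \<le> \<bar>\<alpha>\<bar> * ((A.sector_const + \<bar>\<kappa>1\<bar>) * P) + \<bar>\<beta>\<bar> * ((B.sector_const + \<bar>\<kappa>2\<bar>) * P)"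
          using 1 2 by (intro add_mono mult_left_mono) auto
        finally show ?thesis unfolding C_def P_def[symmetric] by (simp add: algebra_simps)
      qed
      fix s :: real assume s: "s > 0"
      define g1 where "g1 r = (f1 (\<i> * of_real r) - of_real \<kappa>1) * complex_of_real (exp (- s * r))" for r
      define g2 where "g2 r = (f2 (\<i> * of_real r) - of_real \<kappa>2) * complex_of_real (exp (- s * r))" for r
      have i1: "set_integrable lborel {0<..} g1" unfolding g1_def left_diff_distrib
        by (rule set_integral_diff(1)[OF A.f_imaginary_integrable[OF s] int_const[OF s]])
      have i2: "set_integrable lborel {0<..} g2" unfolding g2_def left_diff_distrib
        by (rule set_integral_diff(1)[OF B.f_imaginary_integrable[OF s] int_const[OF s]])
      have j1: "set_integrable lborel {0<..} (\<lambda>r. complex_of_real \<alpha> * g1 r)" by (rule set_integrable_mult_right[OF i1])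
      have j2: "set_integrable lborel {0<..} (\<lambda>r. complex_of_real \<beta> * g2 r)" by (rule set_integrable_mult_right[OF i2])
      have e: "F (\<i> * of_real r) * of_real (exp (- s * r)) = of_real \<alpha> * g1 r + of_real \<beta> * g2 r" for r
        unfolding F_def g1_def g2_def by (simp only: distrib_right mult.assoc)
      show "set_integrable lborel {0<..} (\<lambda>r. F (\<i> * of_real r) * of_real (exp (- s * r)))"
        unfolding e by (rule set_integral_add(1)[OF j1 j2])
      have "(LBINT r:{0<..}. F (\<i> * of_real r) * of_real (exp (- s * r))) = of_real \<alpha> * (of_real a1 / ?q s) + of_real \<beta> * (of_real a2 / ?q s)"
        unfolding e set_integral_add(2)[OF j1 j2] set_integral_mult_right unfolding g1_def g2_def a1[OF s] a2[OF s] ..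
      also have "\<dots> = of_real (\<alpha> * a1 + \<beta> * a2) / ?q s" by (simp add: add_divide_distrib)
      finally show "(LBINT r:{0<..}. F (\<i> * of_real r) * of_real (exp (- s * r))) = 0" unfolding ab by simp
    qed
    have up: "\<alpha> * V1 w + \<beta> * V2 w = 0" if w: "Im w > 0" for w
    proof -
      let ?U = "{\<i> * complex_of_real r |r. r > 0}"
      have "F w = 0"
      proof (rule analytic_continuation[OF Fh open_halfspace_Im_gt, of ?U "2 * \<i>"])
        show "connected {z. Im z > 0}" by (simp add: convex_connected convex_halfspace_Im_gt)
        show "2 * \<i> islimpt ?U"
        proof (rule islimptI)
          fix T assume T: "2 * \<i> \<in> T" "open T"
          then obtain e where e: "e > 0" "ball (2 * \<i>) e \<subseteq> T" by (auto simp: open_contains_ball)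
          define y where "y = \<i> * of_real (2 + e/2)"
          have "2 * \<i> - y = - (\<i> * of_real (e / 2))" by (simp add: y_def algebra_simps)
          then have "dist (2 * \<i>) y = e/2" using e by (simp add: dist_norm norm_mult)
          then have "y \<in> T" "y \<noteq> 2 * \<i>" using e by auto
          moreover have "y \<in> ?U" using e by (auto simp: y_def intro!: exI[of _ "2 + e/2"])
          ultimately show "\<exists>y\<in>?U. y \<in> T \<and> y \<noteq> 2 * \<i>" by blast
        qed
        show "F z = 0" if "z \<in> ?U" for z using F0 that by blast
      qed (use w in auto)
      then have "Im (F w) = 0" by simp
      then show ?thesis using A.V_f[OF w] B.V_f[OF w] by (simp add: F_def)
    qed
    have "(\<lambda>n. z + \<i> * of_real (inverse (real (Suc n)))) \<longlonglongrightarrow> z + \<i> * of_real 0"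
      by (intro tendsto_intros LIMSEQ_inverse_real_of_nat)
    then have zl: "(\<lambda>n. z + \<i> * of_real (inverse (real (Suc n)))) \<longlonglongrightarrow> z" by simp
    have "(\<lambda>n. \<alpha> * V1 (z + \<i> * of_real (inverse (real (Suc n)))) + \<beta> * V2 (z + \<i> * of_real (inverse (real (Suc n))))) \<longlonglongrightarrow> \<alpha> * V1 z + \<beta> * V2 z"
      by (intro tendsto_intros continuous_on_tendsto_compose[OF A.V_cont zl] continuous_on_tendsto_compose[OF B.V_cont zl])
         (use z in \<open>auto intro!: always_eventually\<close>)
    moreover have "\<alpha> * V1 (z + \<i> * of_real (inverse (real (Suc n)))) + \<beta> * V2 (z + \<i> * of_real (inverse (real (Suc n)))) = 0" for n
    proof -
      have "0 < inverse (real (Suc n))" by simp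
      then have "0 < Im (z + \<i> * of_real (inverse (real (Suc n))))" using z by (simp add: add_nonneg_pos del: of_nat_Suc)
      then show ?thesis by (rule up)
    qed
    ultimately show ?thesis by (simp add: LIMSEQ_const_iff)
  qed
  show ?thesis
  proof (rule exI[of _ a1], rule exI[of _ a2], intro conjI impI allI)
    fix z :: complex assume z: "Im z \<ge> 0"
    show "a2 * V1 z = a1 * V2 z" using key[of a2 "- a1" z] z by simp
  next
    fix z :: complex assume "a1 = 0" "Im z \<ge> 0"
    then show "V1 z = 0" using key[of 1 0 z] by simp
  qed
qed

text \<open>The rescaling \<open>z \<rightarrow> z / \<lambda>\<close> reduces the Steklov constant to \<open>1\<close>.\<close>

lemma bounded_solution_dock:
  assumes l: "l > 0" and v: "bounded_mixed_steklov_solution l {0<..} v"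
  shows "\<exists>f M. dock_solution f (\<lambda>z. v (Re z / l, Im z / l)) M"
proof -
  have vc: "continuous_on closed_upper_half_plane v" and v2: "C2_on upper_half_plane v"
    and vl: "\<And>x y. y > 0 \<Longrightarrow> laplacian v (x, y) = 0"
    and vR: "\<And>x. x > 0 \<Longrightarrow> ((\<lambda>y. (v (x, y) - v (x, 0)) / y) \<longlongrightarrow> - l * v (x, 0)) (at_right 0)"
    and v0: "\<And>x. x \<le> 0 \<Longrightarrow> v (x, 0) = 0"
    and vb: "bounded (v ` closed_upper_half_plane)"
    using v unfolding bounded_mixed_steklov_solution_def mixed_steklov_solution_def by auto
  obtain f where f: "f holomorphic_on {z. Im z > 0}" "\<And>z. Im z > 0 \<Longrightarrow> v (Re z, Im z) = Im (f z)"
    using harmonic_conjugate_exists[OF v2 vl] by blast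
  obtain B where B: "B > 0" "\<And>p. p \<in> closed_upper_half_plane \<Longrightarrow> norm (v p) \<le> B"
    using vb unfolding bounded_pos by auto
  define g where "g z = f (z / of_real l)" for z
  define V where "V z = v (Re z / l, Im z / l)" for z
  have "dock_solution g V B"
  proof
    show "B > 0" by (rule B)
    have "(f \<circ> (\<lambda>z. z / of_real l)) holomorphic_on {z. Im z > 0}"
      by (rule holomorphic_on_compose_gen[OF _ f(1)]) (use l in \<open>auto intro!: holomorphic_intros\<close>)
    then show "g holomorphic_on {z. Im z > 0}" by (simp add: g_def[abs_def] o_def)
    show "continuous_on {z. 0 \<le> Im z} V" unfolding V_def
      by (rule continuous_on_compose2[OF vc]) (use l in \<open>auto intro!: continuous_intros\<close>)
    show "V z = Im (g z)" if "Im z > 0" for z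
      using f(2)[of "z / of_real l"] that l by (simp add: V_def g_def)
    show "\<bar>V z\<bar> \<le> B" if "Im z \<ge> 0" for z
      using B(2)[of "(Re z / l, Im z / l)"] that l by (simp add: V_def)
    show "V (of_real x) = 0" if "x \<le> 0" for x using v0[of "x / l"] that l by (simp add: V_def divide_nonpos_pos)
    show "((\<lambda>y. (V (Complex x y) - V (of_real x)) / y) \<longlongrightarrow> - V (of_real x)) (at_right 0)" if x: "x > 0" for x
    proof -
      have "((\<lambda>y::real. y / l) \<longlongrightarrow> 0 / l) (at_right 0)" using l by (intro tendsto_intros) auto
      then have fl: "filterlim (\<lambda>y. y / l) (at_right 0) (at_right 0)" unfolding filterlim_at
        using l by (auto simp: eventually_at_filter)
      have "((\<lambda>y. (1 / l) * ((v (x / l, y / l) - v (x / l, 0)) / (y / l))) \<longlongrightarrow> (1 / l) * (- l * v (x / l, 0))) (at_right 0)"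
        by (intro tendsto_mult tendsto_const filterlim_compose[OF vR fl]) (use x l in simp)
      moreover have "(1 / l) * ((v (x / l, y / l) - v (x / l, 0)) / (y / l)) = (V (Complex x y) - V (of_real x)) / y" for y
        using l by (simp add: V_def)
      moreover have "(1 / l) * (- l * v (x / l, 0)) = - V (of_real x)" using l by (simp add: V_def)
      ultimately show ?thesis by (simp only:)
    qed
  qed
  then show ?thesis unfolding V_def[abs_def] by blast
qed

theorem theorem1:
  fixes l :: real
  assumes "l > 0"
  shows "\<exists>u :: real \<times> real \<Rightarrow> real.
    (\<forall>x\<ge>0. \<forall>y\<ge>0. u (x, y) =
       exp (- l * y) * sin (l * x + pi / 8)
       - sqrt 2 / (2 * pi) *
         (LBINT t:{0..}. (t * cos (t * l * y) - sin (t * l * y)) / (1 + t\<^sup>2)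
            * exp (- (1 / pi) * (LBINT s:{0..}. ln (t + s) / (1 + s\<^sup>2)))
            * exp (- t * l * x))) \<and>
    (\<forall>x\<le>0. \<forall>y\<ge>0. u (x, y) =
       sqrt 2 / (2 * pi) *
         (LBINT t:{0..}. sin (t * l * y) / (1 + t\<^sup>2)
            * exp (1 / pi * (LBINT s:{0..}. ln (t + s) / (1 + s\<^sup>2)))
            * exp (t * l * x))) \<and>
    bounded_mixed_steklov_solution l {0<..} u \<and>
    (\<exists>p \<in> closed_upper_half_plane. u p \<noteq> 0) \<and>
    (\<forall>v. bounded_mixed_steklov_solution l {0<..} v \<longrightarrow>
       (\<exists>c. \<forall>p \<in> closed_upper_half_plane. v p = c * u p))"
proof -
  let ?u = "dock_mode l"
  have sol: "bounded_mixed_steklov_solution l {0<..} ?u"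
    by (rule explicit_solution[OF assms])
  have nz: "?u (11 * pi / 8 / l, 0) \<noteq> 0" by (rule explicit_solution_nonzero[OF assms])
  have uniq: "\<exists>c. \<forall>p \<in> closed_upper_half_plane. v p = c * ?u p" if v: "bounded_mixed_steklov_solution l {0<..} v" for v
  proof -
    obtain f M where 1: "dock_solution f (\<lambda>z. ?u (Re z / l, Im z / l)) M"
      using bounded_solution_dock[OF assms sol] by blast
    obtain f' M' where 2: "dock_solution f' (\<lambda>z. v (Re z / l, Im z / l)) M'"
      using bounded_solution_dock[OF assms v] by blast
    obtain a b :: real where ab: "\<And>z. Im z \<ge> 0 \<Longrightarrow> b * ?u (Re z / l, Im z / l) = a * v (Re z / l, Im z / l)"
      "a = 0 \<Longrightarrow> (\<forall>z. Im z \<ge> 0 \<longrightarrow> ?u (Re z / l, Im z / l) = 0)"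
      using dock_solutions_proportional[OF 1 2] by blast
    have "a \<noteq> 0"
    proof
      assume "a = 0"
      then have "?u (Re (of_real (11 * pi / 8)) / l, Im (of_real (11 * pi / 8)) / l) = 0" using ab(2) by (metis Im_complex_of_real order_refl)
      then show False using nz by simp
    qed
    have "v (x, y) = b / a * ?u (x, y)" if "y \<ge> 0" for x y
      using ab(1)[of "Complex (l * x) (l * y)"] that assms \<open>a \<noteq> 0\<close> by (simp add: field_simps)
    then show ?thesis by (intro exI[of _ "b / a"]) auto
  qed
  have "(11 * pi / 8 / l, 0) \<in> closed_upper_half_plane" by simp
  then have nonzero: "\<exists>p \<in> closed_upper_half_plane. ?u p \<noteq> 0" using nz by blast
  show ?thesis
    by (rule exI[of _ ?u], intro conjI allI impI sol nonzero uniq explicit_solution_formula[OF assms])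
qed

end
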